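(* Let $G$ be a finite group and let $E$ be a normal subgroup of $G$ such that $G/E$ is nilpotent. Suppose that every minimal subgroup of $F^*(E)$ is contained in $Z_\infty(G)$, and every cyclic subgroup of $F^*(E)$ of order $4$ is an $\mathscr{H}C$-subgroup of $G$. Then $G$ is nilpotent.
   Context: All groups are finite. A subgroup $H$ of a group $G$ is an $\mathscr{H}C$-subgroup of $G$ if there exists a normal subgroup $T$ of $G$ such that $G=HT$ and $H^g\cap N_T(H)\leq H$ for all $g\in G$, where $N_T(H)=T\cap N_G(H)$ and $H^g=g^{-1}Hg$. A minimal subgroup is a subgroup of prime order. $Z_\infty(G)$ denotes the hypercenter of $G$, i.e. the final term of the upper central series of $G$. $F^*(E)$ denotes the generalized Fitting subgroup of $E$, that is, the largest normal quasinilpotent subgroup of $E$ (equivalently, the product of the Fitting subgroup of $E$ and the layer of $E$, the subgroup generated by all subnormal quasisimple subgroups). *)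

theory Defs
  imports "HOL-Algebra.Algebra"
begin

definition group_center :: "('a, 'b) monoid_scheme \<Rightarrow> 'a set" where
  "group_center G = {z \<in> carrier G. \<forall>g \<in> carrier G. z \<otimes>\<^bsub>G\<^esub> g = g \<otimes>\<^bsub>G\<^esub> z}"

(* The step is the full preimage in G of the centre of G / Z_n. *)
primrec upper_central :: "('a, 'b) monoid_scheme \<Rightarrow> nat \<Rightarrow> 'a set" where
  "upper_central G 0 = {\<one>\<^bsub>G\<^esub>}"
| "upper_central G (Suc n) =
     {x \<in> carrier G. upper_central G n #>\<^bsub>G\<^esub> x \<in> group_center (G Mod upper_central G n)}"

(* The series is ascending, so in a finite group the union is its final term. *)
definition hypercenter :: "('a, 'b) monoid_scheme \<Rightarrow> 'a set" where
  "hypercenter G = (\<Union>n. upper_central G n)"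

definition nilpotent_group :: "('a, 'b) monoid_scheme \<Rightarrow> bool" where
  "nilpotent_group G \<longleftrightarrow> group G \<and> (\<exists>n. upper_central G n = carrier G)"

definition fitting_subgroup :: "('a, 'b) monoid_scheme \<Rightarrow> 'a set" where
  "fitting_subgroup G =
     generate G (\<Union>{N. N \<lhd> G \<and> nilpotent_group (G\<lparr>carrier := N\<rparr>)})"

inductive subnormal :: "('a, 'b) monoid_scheme \<Rightarrow> 'a set \<Rightarrow> bool" for G where
  whole: "subnormal G (carrier G)"
| step: "subnormal G K \<Longrightarrow> H \<lhd> (G\<lparr>carrier := K\<rparr>) \<Longrightarrow> subnormal G H"

(* Perfect, and simple modulo the centre; perfectness forces the simple quotient
   to be non-abelian. *)
definition quasisimple :: "('a, 'b) monoid_scheme \<Rightarrow> bool" where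
  "quasisimple G \<longleftrightarrow>
     group G \<and> derived G (carrier G) = carrier G \<and> simple_group (G Mod group_center G)"

definition layer :: "('a, 'b) monoid_scheme \<Rightarrow> 'a set" where
  "layer G = generate G (\<Union>{K. subnormal G K \<and> quasisimple (G\<lparr>carrier := K\<rparr>)})"

definition generalized_fitting :: "('a, 'b) monoid_scheme \<Rightarrow> 'a set" where
  "generalized_fitting G = fitting_subgroup G <#>\<^bsub>G\<^esub> layer G"

definition HC_subgroup :: "('a, 'b) monoid_scheme \<Rightarrow> 'a set \<Rightarrow> bool" where
  "HC_subgroup G H \<longleftrightarrow>
     subgroup H G \<and>
     (\<exists>T. T \<lhd> G \<and> carrier G = H <#>\<^bsub>G\<^esub> T \<and>
          (\<forall>g \<in> carrier G.
             (inv\<^bsub>G\<^esub> g <#\<^bsub>G\<^esub> H #>\<^bsub>G\<^esub> g) \<inter> (T \<inter> normalizer G H) \<subseteq> H))"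

end

theory Submission
  imports Defs
begin

text \<open>For finite groups, nilpotency means that elements of coprime exponent commute. Let \<open>p\<close> be a
  prime and \<open>x\<close> a \<open>p'\<close>-element of \<open>G\<close>. It centralizes the elements of order \<open>p\<close> in \<open>O\<^sub>p(E)\<close>, since
  these are hypercentral. If \<open>p = 2\<close> and \<open>H\<close> is a cyclic subgroup of order \<open>4\<close> of \<open>O\<^sub>2(E)\<close> inside the
  normal subgroup generated by the elements of odd order, then the supplement \<open>T\<close> of \<open>H\<close> is \<open>G\<close>; as
  \<open>H\<close> is subnormal, the defining condition forces it to be normal, and \<open>x\<close> centralizes it. A coprime
  automorphism of a \<open>p\<close>-group that fixes the elements of order \<open>p\<close> (and \<open>4\<close>) is trivial, so \<open>x\<close>
  centralizes \<open>O\<^sub>p(E)\<close>.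

  A quasisimple subnormal subgroup of \<open>E\<close> would be perfect, hence contained in every supplement \<open>T\<close>, so
  the condition on subgroups of order \<open>4\<close> passes to all its subgroups. A minimal non-nilpotent group
  among these is excluded by Schmidt's counting argument on maximal subgroups and the automorphism
  lemma. Hence \<open>E\<close> has no layer, and the centralizer in \<open>E\<close> of all \<open>O\<^sub>p(E)\<close> is nilpotent. As
  \<open>G/E\<close> is nilpotent, the commutator of two elements of coprime order lies in this centralizer, and
  it turns out to be trivial.\<close>

section \<open>Conjugation and elements of coprime exponent\<close>

text \<open>The supplement \<open>T\<close> belongs to the ambient group, so the condition on cyclic
  subgroups of order 4 does not pass to subgroups as it stands. What helps is that
  \<open>G Mod T\<close> is cyclic of order dividing 4: elements of odd order and commutators lie in
  \<open>T\<close>. This is why the condition is exploited only inside the subgroup generated by the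
  elements of odd order, or inside a perfect subgroup. An arbitrary \<open>z\<close> in the 2-core
  is brought into that situation by its commutator with \<open>x\<close>, which lies in the smaller
  group and is therefore centralized by \<open>x\<close>. From there one elementary fact suffices,
  and it replaces the theory of coprime action throughout: if an automorphism
  \<open>\<alpha>\<close> of period \<open>b\<close> fixes \<open>c = g^-1 \<alpha>(g)\<close>, its
  iterates send \<open>g\<close> to \<open>g c^k\<close>, so \<open>c^b = 1\<close>, and
  \<open>c\<close> is trivial if it also has an exponent coprime to \<open>b\<close>. Order 4 has to
  be considered for \<open>p = 2\<close> because of the power formula in groups of class two, whose
  correction term has exponent \<open>n choose 2\<close>: an odd \<open>p\<close> divides
  \<open>p choose 2\<close>, but \<open>2 choose 2\<close> is odd.\<close>

definition conjugate_by :: "('a, 'b) monoid_scheme \<Rightarrow> 'a \<Rightarrow> 'a \<Rightarrow> 'a" where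
  "conjugate_by G x z = inv\<^bsub>G\<^esub> x \<otimes>\<^bsub>G\<^esub> z \<otimes>\<^bsub>G\<^esub> x"

text \<open>A finite group has this property iff it is nilpotent, but here the inheritance by
  subgroups is immediate.\<close>

definition coprime_commuting :: "('a, 'b) monoid_scheme \<Rightarrow> bool" where
  "coprime_commuting G \<longleftrightarrow>
     (\<forall>x \<in> carrier G. \<forall>y \<in> carrier G. \<forall>(a::nat) (b::nat). coprime a b \<longrightarrow>
        x [^]\<^bsub>G\<^esub> a = \<one>\<^bsub>G\<^esub> \<longrightarrow> y [^]\<^bsub>G\<^esub> b = \<one>\<^bsub>G\<^esub> \<longrightarrow> x \<otimes>\<^bsub>G\<^esub> y = y \<otimes>\<^bsub>G\<^esub> x)"

lemma coprime_commutingD: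
  "\<lbrakk>coprime_commuting G; x \<in> carrier G; y \<in> carrier G; coprime (a::nat) b;
    x [^]\<^bsub>G\<^esub> a = \<one>\<^bsub>G\<^esub>; y [^]\<^bsub>G\<^esub> b = \<one>\<^bsub>G\<^esub>\<rbrakk> \<Longrightarrow> x \<otimes>\<^bsub>G\<^esub> y = y \<otimes>\<^bsub>G\<^esub> x"
  unfolding coprime_commuting_def by blast

lemma pow_carrier_update [simp]: "x [^]\<^bsub>G\<lparr>carrier := H\<rparr>\<^esub> (n::nat) = x [^]\<^bsub>G\<^esub> n"
  by (simp add: nat_pow_def)

context group
begin

lemma pow_coprime_one:
  fixes a b :: nat
  assumes "x \<in> carrier G" "x [^] a = \<one>" "x [^] b = \<one>" "coprime a b"
  shows "x = \<one>"
proof -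
  have "ord x dvd a" "ord x dvd b" using assms pow_eq_id by simp_all
  then have "ord x = 1" using assms(4) coprime_common_divisor_nat by blast
  then show ?thesis using assms(1) ord_eq_1 by blast
qed

lemma pow_dvd_one:
  fixes a b :: nat
  shows "x \<in> carrier G \<Longrightarrow> x [^] a = \<one> \<Longrightarrow> a dvd b \<Longrightarrow> x [^] b = \<one>"
  by (metis dvd_trans pow_eq_id)

lemma subgroup_nat_pow_closed:
  "subgroup H G \<Longrightarrow> h \<in> H \<Longrightarrow> h [^] (n::nat) \<in> H"
  by (induction n) (auto simp: subgroup.one_closed subgroup.m_closed)

lemma conjugate_by_closed [simp]:
  "x \<in> carrier G \<Longrightarrow> z \<in> carrier G \<Longrightarrow> conjugate_by G x z \<in> carrier G"
  by (simp add: conjugate_by_def)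

lemma conjugate_by_mult:
  assumes "x \<in> carrier G" "y \<in> carrier G" "z \<in> carrier G"
  shows "conjugate_by G x (y \<otimes> z) = conjugate_by G x y \<otimes> conjugate_by G x z"
proof -
  have "x \<otimes> (inv x \<otimes> (z \<otimes> x)) = z \<otimes> x" using assms by (simp add: m_assoc [symmetric])
  then show ?thesis using assms by (simp add: conjugate_by_def m_assoc)
qed

lemma conjugate_by_hom: "x \<in> carrier G \<Longrightarrow> conjugate_by G x \<in> hom G G"
  by (auto simp: hom_def conjugate_by_mult)

lemma conjugate_by_eq_iff:
  assumes "x \<in> carrier G" "z \<in> carrier G" "w \<in> carrier G"
  shows "conjugate_by G x z = w \<longleftrightarrow> z \<otimes> x = x \<otimes> w"
  using assms by (metis conjugate_by_def inv_solve_left m_assoc m_closed inv_closed)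

lemma conjugate_by_conjugate_by:
  assumes "x \<in> carrier G" "y \<in> carrier G" "z \<in> carrier G"
  shows "conjugate_by G x (conjugate_by G y z) = conjugate_by G (y \<otimes> x) z"
  using assms by (simp add: conjugate_by_def inv_mult_group m_assoc)

lemma conjugate_by_one [simp]: "z \<in> carrier G \<Longrightarrow> conjugate_by G \<one> z = z"
  by (simp add: conjugate_by_def)

lemma conjugate_by_funpow:
  assumes "x \<in> carrier G" "z \<in> carrier G"
  shows "(conjugate_by G x ^^ k) z = conjugate_by G (x [^] k) z"
proof (induction k)
  case (Suc k)
  then show ?case using assms by (simp add: conjugate_by_conjugate_by)
qed (use assms in simp)

lemma conjugate_by_pow:
  assumes "x \<in> carrier G" "z \<in> carrier G"
  shows "conjugate_by G x z [^] (k::nat) = conjugate_by G x (z [^] k)"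
proof -
  interpret h: group_hom G G "conjugate_by G x"
    using assms conjugate_by_hom by unfold_locales auto
  show ?thesis using assms by (simp add: h.hom_nat_pow)
qed

lemma conjugate_by_inv_cancel:
  assumes "x \<in> carrier G" "z \<in> carrier G"
  shows "conjugate_by G (inv x) (conjugate_by G x z) = z"
    and "conjugate_by G x (conjugate_by G (inv x) z) = z"
  using assms by (simp_all add: conjugate_by_conjugate_by)

lemma normal_conjugate_by:
  "N \<lhd> G \<Longrightarrow> x \<in> carrier G \<Longrightarrow> z \<in> N \<Longrightarrow> conjugate_by G x z \<in> N"
  by (simp add: conjugate_by_def normal.inv_op_closed1)

lemma normal_conjugate_byI:
  assumes "subgroup N G"
    and "\<And>x z. x \<in> carrier G \<Longrightarrow> z \<in> N \<Longrightarrow> conjugate_by G x z \<in> N"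
  shows "N \<lhd> G"
proof (rule normal_invI [OF assms(1)])
  fix x h assume "x \<in> carrier G" "h \<in> N"
  then show "x \<otimes> h \<otimes> inv x \<in> N"
    using assms(2) [of "inv x" h] by (simp add: conjugate_by_def)
qed

section \<open>Displacements of a homomorphism and the basic coprimality argument\<close>

lemma fixed_displacement_funpow:
  assumes "\<alpha> \<in> hom G G" "g \<in> carrier G" "c \<in> carrier G" "\<alpha> c = c" "\<alpha> g = g \<otimes> c"
  shows "(\<alpha> ^^ k) g = g \<otimes> c [^] k"
proof (induction k)
  case (Suc k)
  interpret h: group_hom G G \<alpha> using assms by unfold_locales auto
  have "(\<alpha> ^^ Suc k) g = \<alpha> g \<otimes> \<alpha> (c [^] k)" using Suc assms by simp
  also have "\<dots> = g \<otimes> c \<otimes> c [^] k" using assms by (simp add: h.hom_nat_pow)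
  also have "\<dots> = g \<otimes> c [^] Suc k"
    using assms by (simp add: m_assoc nat_pow_Suc2 [symmetric])
  finally show ?case by simp
qed (use assms in simp)

text \<open>With \<open>c\<close> the displacement of \<open>g\<close>, the equations
  \<open>\<alpha> g = g \<otimes> c\<close> and \<open>\<alpha> c = c\<close> give
  \<open>(\<alpha> ^^ b) g = g \<otimes> c [^] b\<close>. So \<open>c\<close> has the coprime
  exponents \<open>a\<close> and \<open>b\<close>.\<close>

lemma fixed_displacement_trivial:
  fixes a b :: nat
  assumes "\<alpha> \<in> hom G G" "g \<in> carrier G" "(\<alpha> ^^ b) g = g" "\<alpha> (inv g \<otimes> \<alpha> g) = inv g \<otimes> \<alpha> g"
    and "(inv g \<otimes> \<alpha> g) [^] a = \<one>" "coprime a b"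
  shows "\<alpha> g = g"
proof -
  let ?c = "inv g \<otimes> \<alpha> g"
  have cl: "\<alpha> g \<in> carrier G" using assms by (auto simp: hom_def)
  have "\<alpha> g = g \<otimes> ?c" using assms cl by (simp add: m_assoc [symmetric])
  then have eq: "g = g \<otimes> ?c [^] b"
    using fixed_displacement_funpow [OF assms(1,2) _ assms(4), of b] assms cl by simp
  have "g \<otimes> ?c [^] b = g \<otimes> \<one>" using assms(2) by (simp add: eq [symmetric])
  then have "?c [^] b = \<one>"
    using l_cancel [of g "?c [^] b" \<one>] assms(2) cl
    by (meson inv_closed m_closed nat_pow_closed one_closed)
  then have "?c = \<one>" using pow_coprime_one assms cl by (meson inv_closed m_closed)
  then show ?thesis using assms(2) cl by (metis inv_closed inv_equality inv_inv)
qed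

text \<open>The automorphism is conjugation by \<open>x\<close>, whose period divides
  \<open>b\<close>; the commutator of \<open>z\<close> and \<open>x\<close> is the displacement of
  \<open>z\<close>.\<close>

lemma fixed_commutator_commute:
  fixes a b :: nat
  assumes "x \<in> carrier G" "z \<in> carrier G" "x [^] b = \<one>"
    and "(inv z \<otimes> conjugate_by G x z) \<otimes> x = x \<otimes> (inv z \<otimes> conjugate_by G x z)"
    and "(inv z \<otimes> conjugate_by G x z) [^] a = \<one>" "coprime a b"
  shows "z \<otimes> x = x \<otimes> z"
proof -
  have "conjugate_by G x z = z"
    using assms fixed_displacement_trivial [OF conjugate_by_hom, of x z b a]
    by (simp add: conjugate_by_funpow conjugate_by_eq_iff)
  then show ?thesis using assms by (simp add: conjugate_by_eq_iff)
qed

text \<open>If the commutator \<open>c\<close> also commutes with \<open>z\<close>, its exponent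
  comes for free: \<open>(z c)^a = z^a c^a\<close>, and the conjugate \<open>z c\<close> of
  \<open>z\<close> has exponent \<open>a\<close> like \<open>z\<close>.\<close>

lemma central_commutator_commute:
  fixes a b :: nat
  assumes "x \<in> carrier G" "z \<in> carrier G" "z [^] a = \<one>" "x [^] b = \<one>" "coprime a b"
    and "(inv z \<otimes> conjugate_by G x z) \<otimes> x = x \<otimes> (inv z \<otimes> conjugate_by G x z)"
    and "(inv z \<otimes> conjugate_by G x z) \<otimes> z = z \<otimes> (inv z \<otimes> conjugate_by G x z)"
  shows "z \<otimes> x = x \<otimes> z"
proof (rule fixed_commutator_commute [OF assms(1,2,4,6) _ assms(5)])
  let ?c = "inv z \<otimes> conjugate_by G x z"
  have c: "?c \<in> carrier G" using assms by simp
  have "conjugate_by G x z = z \<otimes> ?c" using assms by (simp add: m_assoc [symmetric])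
  then have "conjugate_by G x z [^] a = z [^] a \<otimes> ?c [^] a"
    using pow_mult_distrib [of z ?c a] assms c by simp
  then show "?c [^] a = \<one>" using assms c
    by (simp add: conjugate_by_pow) (simp add: conjugate_by_def)
qed

text \<open>This localizes a claim about \<open>y\<close> at one prime at a time. The hypothesis
  speaks of all powers of \<open>y\<close>, so it is inherited by the power of \<open>y\<close> to
  which the induction is applied.\<close>

lemma prime_power_parts_in_subgroup:
  assumes H: "subgroup H G" and "y \<in> carrier G" "y [^] b = \<one>" "b > (0::nat)"
    and "\<And>p e (k::nat). Factorial_Ring.prime (p::nat) \<Longrightarrow> (y [^] k) [^] (p ^ e) = \<one> \<Longrightarrow> y [^] k \<in> H"
  shows "y \<in> H"
  using assms(2-)
proof (induction b arbitrary: y rule: less_induct)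
  case (less b)
  show ?case
  proof (cases "b = 1")
    case True
    then show ?thesis using less.prems H subgroup.one_closed by simp
  next
    case False
    then obtain p where p: "Factorial_Ring.prime p" "p dvd b" using prime_factor_nat by blast
    obtain m where m: "b = p ^ multiplicity p b * m" "\<not> p dvd m"
      using multiplicity_decompose' [of b p] less.prems(3) p
      by (metis not_prime_unit neq0_conv mult.commute)
    define q where "q = p ^ multiplicity p b"
    have "multiplicity p b > 0" using p less.prems(3)
      by (simp add: prime_multiplicity_gt_zero_iff)
    then have q1: "q > 1" unfolding q_def using p prime_gt_1_nat one_less_power by blast
    have m0: "m > 0" using m less.prems(3) by (cases m) auto
    have cop: "coprime m q" unfolding q_def
      using p m by (metis prime_imp_coprime coprime_commute coprime_power_left_iff)
    \<comment> \<open>By Bezout, \<open>y\<close> is the quotient of \<open>y [^] (m * u)\<close>,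
      which has exponent \<open>q\<close>, by \<open>y [^] (q * v)\<close>, which has exponent
      \<open>m < b\<close>.\<close>
    obtain u v where uv: "m * u = q * v + 1"
      using bezout_nat [of m q] cop m0 by (metis coprime_iff_gcd_eq_1 neq0_conv)
    have 1: "y [^] (m * u) \<in> H"
    proof (rule less.prems(4) [OF p(1)])
      have "b dvd (q * m) * u" using m(1) q_def by (metis dvd_triv_left)
      then have "b dvd m * u * q" by (simp add: ac_simps)
      then show "(y [^] (m * u)) [^] (p ^ multiplicity p b) = \<one>"
        unfolding q_def [symmetric] using less.prems pow_dvd_one by (simp add: nat_pow_pow)
    qed
    have 2: "y [^] (q * v) \<in> H"
    proof (rule less.IH [of m])
      have "b = q * m" using m(1) q_def by simp
      moreover have "1 * m < q * m" using q1 m0 by (intro mult_strict_right_mono)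
      ultimately show "m < b" by simp
      have "b dvd (q * m) * v" using m(1) q_def by (metis dvd_triv_left)
      then have "b dvd q * v * m" by (simp add: ac_simps)
      then show "(y [^] (q * v)) [^] m = \<one>" using less.prems pow_dvd_one by (simp add: nat_pow_pow)
      show "(y [^] (q * v)) [^] k \<in> H"
        if "Factorial_Ring.prime p" "((y [^] (q * v)) [^] k) [^] (p ^ e) = \<one>" for p e k :: nat
        using less.prems that by (simp add: nat_pow_pow)
    qed (use less.prems m0 in auto)
    have "y [^] (m * u) = y [^] (q * v) \<otimes> y" using uv less.prems by simp
    then have "y = inv (y [^] (q * v)) \<otimes> y [^] (m * u)"
      using less.prems by (simp add: m_assoc [symmetric])
    then show ?thesis using 1 2 H
      by (metis subgroup.m_closed subgroup.m_inv_closed)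
  qed
qed

end

section \<open>Lifting elements from a quotient without losing coprimality\<close>

lemma dvd_power_times_coprime:
  fixes a r :: nat
  assumes "r > 0"
  shows "\<exists>m s. r dvd a ^ m * s \<and> coprime s a \<and> s > 0"
  using assms
proof (induction r rule: less_induct)
  case (less r)
  show ?case
  proof (cases "coprime r a")
    case True
    then show ?thesis using less.prems by (intro exI [of _ 0] exI [of _ r]) auto
  next
    case False
    then have g: "gcd r a > 1" using less.prems
      by (metis coprime_iff_gcd_eq_1 gcd_pos_nat less_one nat_neq_iff not_gr0)
    then obtain r' where r': "r = gcd r a * r'" by (metis dvdE gcd_dvd1)
    with less.prems have "r' > 0" by (metis mult_0_right neq0_conv)
    then have "1 * r' < gcd r a * r'" using g by (intro mult_strict_right_mono)
    then have "r' < r" using r' by simp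
    then obtain m s where ms: "r' dvd a ^ m * s" "coprime s a" "s > 0"
      using less.IH \<open>r' > 0\<close> by blast
    have "r dvd a * (a ^ m * s)" using r' ms mult_dvd_mono [of "gcd r a" a r'] by (metis gcd_dvd2)
    then show ?thesis using ms by (intro exI [of _ "Suc m"] exI [of _ s]) (auto simp: mult.assoc)
  qed
qed

context normal
begin

lemma rcos_eq_iff: "x \<in> carrier G \<Longrightarrow> H #> x = H \<longleftrightarrow> x \<in> H"
  by (metis coset_join1 coset_join2 subset subgroup_axioms)

text \<open>The order of \<open>x\<close> divides \<open>a ^ m * s\<close> with \<open>s\<close>
  prime to \<open>a\<close>. A multiple \<open>s * u\<close> congruent to 1 modulo \<open>a\<close>
  removes the factor \<open>s\<close> from the order and leaves the coset alone, because
  \<open>x [^] a\<close> is in \<open>H\<close>. Coprimality does not notice the change from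
  \<open>a\<close> to \<open>a ^ m\<close>.\<close>

lemma coset_lift_power:
  fixes a :: nat
  assumes "finite (carrier G)" "x \<in> carrier G" "x [^] a \<in> H" "a > 0"
  obtains y m where "y \<in> carrier G" "H #> y = H #> x" "y [^] (a ^ m) = \<one>"
proof -
  have "ord x > 0" using assms ord_ge_1 by force
  then obtain m s where ms: "ord x dvd a ^ m * s" "coprime s a" "s > 0"
    using dvd_power_times_coprime by blast
  then obtain u v where uv: "s * u = a * v + 1"
    using bezout_nat [of s a] by (metis coprime_iff_gcd_eq_1 neq0_conv)
  define y where "y = x [^] (s * u)"
  have "ord x dvd s * u * a ^ m" using ms by (metis dvd_mult2 mult.assoc mult.commute)
  then have "y [^] (a ^ m) = \<one>" unfolding y_def using assms pow_eq_id by (simp add: nat_pow_pow)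
  moreover have "H #> y = H #> x"
  proof -
    have "x [^] (a * v) \<in> H" using assms
      by (metis nat_pow_pow subgroup_axioms subgroup_nat_pow_closed)
    then have "H #> x [^] (a * v) = H" using assms rcos_eq_iff by simp
    moreover have "y = x [^] (a * v) \<otimes> x" unfolding y_def using uv assms by simp
    ultimately show ?thesis using assms
      by (metis coset_mult_assoc nat_pow_closed subset)
  qed
  moreover have "y \<in> carrier G" unfolding y_def using assms by simp
  ultimately show ?thesis using that by blast
qed

lemma coprime_commuting_quotient:
  assumes "finite (carrier G)" "coprime_commuting G"
  shows "coprime_commuting (G Mod H)"
proof -
  interpret Q: group "G Mod H" by (rule factorgroup_is_group)
  interpret h: group_hom G "G Mod H" "\<lambda>x. H #> x"
    using r_coset_hom_Mod by unfold_locales auto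
  have main: "(H #> x) \<otimes>\<^bsub>G Mod H\<^esub> (H #> y) = (H #> y) \<otimes>\<^bsub>G Mod H\<^esub> (H #> x)"
    if xy: "x \<in> carrier G" "y \<in> carrier G" "coprime a b"
      "(H #> x) [^]\<^bsub>G Mod H\<^esub> a = \<one>\<^bsub>G Mod H\<^esub>" "(H #> y) [^]\<^bsub>G Mod H\<^esub> b = \<one>\<^bsub>G Mod H\<^esub>"
    for x y and a b :: nat
  proof (cases "a = 0 \<or> b = 0")
    \<comment> \<open>Lifting needs positive exponents. If one exponent is 0, coprimality makes the
      other one 1.\<close>
    case True
    then have "H #> x = \<one>\<^bsub>G Mod H\<^esub> \<or> H #> y = \<one>\<^bsub>G Mod H\<^esub>"
      using xy by (metis Q.nat_pow_eone Q.nat_pow_one coprime_0_left_iff coprime_0_right_iff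
        h.hom_closed is_unit_gcd nat_dvd_1_iff_1 Q.pow_coprime_one Q.nat_pow_0)
    then show ?thesis using xy by (metis Q.l_one Q.r_one h.hom_closed)
  next
    case False
    have "x [^] a \<in> H" "y [^] b \<in> H"
      using xy rcos_eq_iff by (auto simp: FactGroup_pow)
    then obtain x' m y' n where
      x': "x' \<in> carrier G" "H #> x' = H #> x" "x' [^] (a ^ m) = \<one>" and
      y': "y' \<in> carrier G" "H #> y' = H #> y" "y' [^] (b ^ n) = \<one>"
      using coset_lift_power assms xy False by (metis neq0_conv)
    have "x' \<otimes> y' = y' \<otimes> x'"
      using coprime_commutingD [OF assms(2) x'(1) y'(1) _ x'(3) y'(3)] xy by simp
    then show ?thesis using x' y' h.hom_mult by metis
  qed
  show ?thesis unfolding coprime_commuting_def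
  proof (intro ballI allI impI)
    fix U V and a b :: nat
    assume "U \<in> carrier (G Mod H)" "V \<in> carrier (G Mod H)"
    then obtain x y where "x \<in> carrier G" "y \<in> carrier G" "U = H #> x" "V = H #> y"
      by (auto simp: carrier_FactGroup)
    moreover assume "coprime a b" "U [^]\<^bsub>G Mod H\<^esub> a = \<one>\<^bsub>G Mod H\<^esub>" "V [^]\<^bsub>G Mod H\<^esub> b = \<one>\<^bsub>G Mod H\<^esub>"
    ultimately show "U \<otimes>\<^bsub>G Mod H\<^esub> V = V \<otimes>\<^bsub>G Mod H\<^esub> U" using main by simp
  qed
qed

end

section \<open>Finite nilpotent groups\<close>

definition p_group :: "('a, 'b) monoid_scheme \<Rightarrow> nat \<Rightarrow> bool" where
  "p_group G p \<longleftrightarrow> (\<forall>x \<in> carrier G. \<exists>e. x [^]\<^bsub>G\<^esub> (p ^ e) = \<one>\<^bsub>G\<^esub>)"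

lemma group_centerD:
  assumes "z \<in> group_center G"
  shows "z \<in> carrier G" "g \<in> carrier G \<Longrightarrow> z \<otimes>\<^bsub>G\<^esub> g = g \<otimes>\<^bsub>G\<^esub> z"
  using assms unfolding group_center_def by blast+

lemma group_centerI:
  "\<lbrakk>z \<in> carrier G; \<And>g. g \<in> carrier G \<Longrightarrow> z \<otimes>\<^bsub>G\<^esub> g = g \<otimes>\<^bsub>G\<^esub> z\<rbrakk> \<Longrightarrow> z \<in> group_center G"
  unfolding group_center_def by blast

context group
begin

lemma normalizer_memD:
  assumes "subgroup H G" "g \<in> normalizer G H" "h \<in> H"
  shows "conjugate_by G g h \<in> H" "g \<in> carrier G"
proof -
  have sub: "H \<subseteq> carrier G" using assms subgroup.subset by blast
  have N: "subgroup (normalizer G H) G" using sub normalizer_imp_subgroup by blast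
  then show g: "g \<in> carrier G" using assms subgroup.mem_carrier by metis
  have "inv g \<in> normalizer G H" using N assms subgroup.m_inv_closed by metis
  then have "inv g <# H #> g = H"
    using sub g by (simp add: normalizer_def stabilizer_def)
  moreover have "inv g \<otimes> h \<otimes> g \<in> inv g <# H #> g"
    using assms(3) by (auto simp: l_coset_def r_coset_def)
  ultimately show "conjugate_by G g h \<in> H" by (simp add: conjugate_by_def)
qed

text \<open>Conjugation by \<open>g\<close> is injective, so on the finite set \<open>H\<close> the
  inclusion is an equality. The detour through \<open>inv g\<close> is due to the convention of
  \<open>normalizer\<close>, which stabilizes \<open>H\<close> under \<open>g H g^-1\<close>,
  opposite to \<open>conjugate_by\<close>.\<close>

lemma normalizer_memI:
  assumes "finite (carrier G)" "subgroup H G" "g \<in> carrier G"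
    "\<And>h. h \<in> H \<Longrightarrow> conjugate_by G g h \<in> H"
  shows "g \<in> normalizer G H"
proof -
  have sub: "H \<subseteq> carrier G" using assms subgroup.subset by blast
  have fin: "finite H" using sub assms finite_subset by blast
  have eq: "inv g <# H #> g = conjugate_by G g ` H"
    by (auto simp: l_coset_def r_coset_def conjugate_by_def)
  have "inj_on (conjugate_by G g) H"
    using sub assms(3) by (intro inj_on_inverseI [of _ "conjugate_by G (inv g)"])
      (auto simp: conjugate_by_inv_cancel)
  then have "conjugate_by G g ` H = H"
    using endo_inj_surj [OF fin] assms(4) by blast
  then have "inv g \<in> normalizer G H"
    using eq sub assms by (simp add: normalizer_def stabilizer_def)
  then show ?thesis
    using normalizer_imp_subgroup [OF sub] subgroup.m_inv_closed assms(3) by (metis inv_inv)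
qed

lemma normalizer_eq_carrier_imp_normal:
  assumes "subgroup H G" "carrier G \<subseteq> normalizer G H"
  shows "H \<lhd> G"
  using assms normalizer_memD normal_conjugate_byI by (metis subsetD)

lemma inv_commute:
  assumes "a \<otimes> z = z \<otimes> a" "a \<in> carrier G" "z \<in> carrier G"
  shows "inv a \<otimes> z = z \<otimes> inv a"
proof -
  have "inv a \<otimes> z = inv a \<otimes> (z \<otimes> a) \<otimes> inv a" using assms(2,3) by (simp add: m_assoc)
  also have "\<dots> = inv a \<otimes> (a \<otimes> z) \<otimes> inv a" by (simp only: assms(1))
  also have "\<dots> = z \<otimes> inv a" using assms(2,3) by (simp add: m_assoc [symmetric])
  finally show ?thesis .
qed

lemma mult_commute_closed:
  assumes "a \<otimes> z = z \<otimes> a" "b \<otimes> z = z \<otimes> b" "a \<in> carrier G" "b \<in> carrier G" "z \<in> carrier G"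
  shows "a \<otimes> b \<otimes> z = z \<otimes> (a \<otimes> b)"
proof -
  have "a \<otimes> b \<otimes> z = a \<otimes> (z \<otimes> b)" using assms by (simp add: m_assoc)
  also have "\<dots> = z \<otimes> a \<otimes> b" using assms by (simp add: m_assoc [symmetric])
  finally show ?thesis using assms by (simp add: m_assoc)
qed

definition set_centralizer :: "'a set \<Rightarrow> 'a set" where
  "set_centralizer D = {g \<in> carrier G. \<forall>d \<in> D. g \<otimes> d = d \<otimes> g}"

lemma set_centralizerD:
  assumes "g \<in> set_centralizer D"
  shows "g \<in> carrier G" "d \<in> D \<Longrightarrow> g \<otimes> d = d \<otimes> g"
  using assms unfolding set_centralizer_def by blast+

lemma set_centralizerI:
  "\<lbrakk>g \<in> carrier G; \<And>d. d \<in> D \<Longrightarrow> g \<otimes> d = d \<otimes> g\<rbrakk> \<Longrightarrow> g \<in> set_centralizer D"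
  unfolding set_centralizer_def by blast

lemma set_centralizer_subgroup:
  assumes "D \<subseteq> carrier G"
  shows "subgroup (set_centralizer D) G"
proof (rule subgroupI)
  show "set_centralizer D \<subseteq> carrier G" unfolding set_centralizer_def by blast
  have "\<one> \<in> set_centralizer D" using assms by (intro set_centralizerI) auto
  then show "set_centralizer D \<noteq> {}" by blast
  fix u v assume u: "u \<in> set_centralizer D"
  show "inv u \<in> set_centralizer D"
    using set_centralizerD [OF u] inv_commute assms by (intro set_centralizerI) (blast, blast)
  assume v: "v \<in> set_centralizer D"
  show "u \<otimes> v \<in> set_centralizer D"
    using set_centralizerD [OF u] set_centralizerD [OF v] mult_commute_closed assms
    by (intro set_centralizerI) (blast, blast)
qed

lemma set_centralizer_normal:
  assumes "D \<lhd> G"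
  shows "set_centralizer D \<lhd> G"
proof -
  have Dc: "D \<subseteq> carrier G" using assms normal_imp_subgroup subgroup.subset by metis
  show ?thesis
  proof (rule normal_conjugate_byI [OF set_centralizer_subgroup [OF Dc]])
    fix x z assume x: "x \<in> carrier G" and z: "z \<in> set_centralizer D"
    have zG: "z \<in> carrier G" by (rule set_centralizerD(1) [OF z])
    show "conjugate_by G x z \<in> set_centralizer D"
    proof (rule set_centralizerI)
      fix d assume d: "d \<in> D"
      have dG: "d \<in> carrier G" using d Dc by blast
      let ?d = "conjugate_by G (inv x) d"
      have d': "?d \<in> D" using normal_conjugate_by [OF assms _ d] x by simp
      have "conjugate_by G x (z \<otimes> ?d) = conjugate_by G x (?d \<otimes> z)"
        using set_centralizerD(2) [OF z d'] by simp
      then show "conjugate_by G x z \<otimes> d = d \<otimes> conjugate_by G x z"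
        using x zG dG by (simp add: conjugate_by_mult conjugate_by_inv_cancel(2))
    qed (use x zG in simp)
  qed
qed

definition centralizer_of :: "'a \<Rightarrow> 'a set" where
  "centralizer_of z = {g \<in> carrier G. g \<otimes> z = z \<otimes> g}"

lemma centralizer_of_subgroup:
  assumes "z \<in> carrier G"
  shows "subgroup (centralizer_of z) G"
proof -
  have "centralizer_of z = set_centralizer {z}"
    unfolding centralizer_of_def set_centralizer_def by simp
  then show ?thesis using set_centralizer_subgroup assms by simp
qed

lemma group_center_subgroup: "subgroup (group_center G) G"
proof (rule subgroupI)
  show "group_center G \<subseteq> carrier G" by (auto simp: group_center_def)
  have "\<one> \<in> group_center G" by (rule group_centerI) auto
  then show "group_center G \<noteq> {}" by blast
  fix a b assume a: "a \<in> group_center G"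
  show "inv a \<in> group_center G"
    using group_centerD [OF a] inv_commute by (intro group_centerI inv_closed) blast+
  assume b: "b \<in> group_center G"
  show "a \<otimes> b \<in> group_center G"
    using group_centerD [OF a] group_centerD [OF b] mult_commute_closed
    by (intro group_centerI m_closed) blast+
qed

lemma group_center_normal: "group_center G \<lhd> G"
proof (rule normal_conjugate_byI [OF group_center_subgroup])
  fix x z assume x: "x \<in> carrier G" and z: "z \<in> group_center G"
  then have "conjugate_by G x z = z"
    using group_centerD [OF z] by (subst conjugate_by_eq_iff) blast+
  then show "conjugate_by G x z \<in> group_center G" using z by simp
qed

section \<open>Sylow subgroups and nontrivial centres\<close>

lemma sylow_subgroup_exists:
  assumes "finite (carrier G)" "Factorial_Ring.prime p"
  obtains P where "subgroup P G" "card P = p ^ multiplicity p (order G)"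
proof -
  have "p ^ multiplicity p (order G) dvd order G" by (rule multiplicity_dvd)
  then obtain m where "order G = p ^ multiplicity p (order G) * m" by blast
  then show ?thesis using sylow_thm [OF assms(2) is_group _ assms(1)] that by blast
qed

lemma card_subgroup_dvd:
  assumes "subgroup P G" "subgroup H G" "P \<subseteq> H"
  shows "card P dvd card H"
proof -
  interpret H: group "G\<lparr>carrier := H\<rparr>" using assms subgroup_imp_group by blast
  have "subgroup P (G\<lparr>carrier := H\<rparr>)" using assms subgroup_incl by blast
  then show ?thesis using H.lagrange [of P] by (simp add: order_def) (metis dvd_triv_right)
qed

text \<open>One Sylow subgroup for each prime is enough: every prime power in \<open>order G\<close>
  then divides \<open>card H\<close>. This is how a centralizer or a normalizer is shown to be the
  whole group.\<close>

lemma subgroup_containing_sylows: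
  assumes "finite (carrier G)" "subgroup H G"
    and "\<And>p. Factorial_Ring.prime p \<Longrightarrow>
           \<exists>P. subgroup P G \<and> P \<subseteq> H \<and> card P = p ^ multiplicity p (order G)"
  shows "H = carrier G"
proof -
  have sub: "H \<subseteq> carrier G" using assms subgroup.subset by blast
  then have fin: "finite H" using assms finite_subset by blast
  have G0: "order G \<noteq> 0" using assms(1) order_gt_0_iff_finite by simp
  have "order G dvd card H"
  proof (rule multiplicity_le_imp_dvd [OF G0])
    fix p :: nat assume p: "Factorial_Ring.prime p"
    then obtain P where P: "subgroup P G" "P \<subseteq> H" "card P = p ^ multiplicity p (order G)"
      using assms(3) by blast
    then have "card P dvd card H" using card_subgroup_dvd assms(2) by blast
    moreover have "card H \<noteq> 0" using subgroup.finite_imp_card_positive [OF assms(2,1)] by simp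
    ultimately show "multiplicity p (order G) \<le> multiplicity p (card H)"
      using P p by (intro multiplicity_geI) auto
  qed
  moreover have "card H \<noteq> 0" using subgroup.finite_imp_card_positive [OF assms(2,1)] by simp
  ultimately have "order G \<le> card H" using dvd_imp_le by blast
  then show ?thesis using sub assms(1) unfolding order_def by (simp add: card_seteq)
qed

lemma p_group_of_card:
  assumes "finite (carrier G)" "subgroup P G" "card P = p ^ n"
  shows "p_group (G\<lparr>carrier := P\<rparr>) p"
proof -
  interpret PG: group "G\<lparr>carrier := P\<rparr>" using assms subgroup_imp_group by blast
  have "x [^] (p ^ n) = \<one>" if "x \<in> P" for x
    using PG.pow_order_eq_1 [of x] that assms by (simp add: order_def)
  then show ?thesis unfolding p_group_def by auto
qed

text \<open>Class equation modulo \<open>p\<close>: the conjugacy class of a noncentral element has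
  length divisible by \<open>p\<close>, so a trivial centre would make \<open>order G\<close>
  congruent to 1.\<close>

lemma p_group_center_nontrivial:
  assumes "finite (carrier G)" "Factorial_Ring.prime p" "order G = p ^ n" "n > 0"
  obtains z where "z \<in> group_center G" "z \<noteq> \<one>"
proof -
  let ?\<phi> = "\<lambda>g. \<lambda>h \<in> carrier G. g \<otimes> h \<otimes> inv g"
  interpret A: group_action G "carrier G" ?\<phi> by (rule action_by_conjugation)
  have fixed: "h \<in> group_center G" if h: "h \<in> carrier G" and c: "card (orbit G ?\<phi> h) = 1" for h
  proof -
    have "h \<in> orbit G ?\<phi> h" using A.orbit_refl h by blast
    moreover obtain w where "orbit G ?\<phi> h = {w}" using c card_1_singletonE by blast
    ultimately have o: "orbit G ?\<phi> h = {h}" by simp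
    have com: "h \<otimes> g = g \<otimes> h" if g: "g \<in> carrier G" for g
    proof -
      have "g \<otimes> h \<otimes> inv g \<in> orbit G ?\<phi> h"
        unfolding orbit_def using g h by (auto intro!: exI [of _ g])
      then have "g \<otimes> h \<otimes> inv g = h" using o by simp
      then show ?thesis using g h by (metis inv_closed inv_inv inv_solve_right m_closed)
    qed
    then show ?thesis using h by (intro group_centerI com)
  qed
  have pd: "p dvd card (orbit G ?\<phi> h)" if "h \<in> carrier G" "h \<notin> group_center G" for h
  proof -
    have "card (orbit G ?\<phi> h) dvd p ^ n"
      unfolding assms(3) [symmetric] A.orbit_stabilizer_theorem [OF that(1), symmetric]
      by (rule dvd_triv_left)
    then obtain i where i: "card (orbit G ?\<phi> h) = p ^ i" using divides_primepow_nat [OF assms(2)] by blast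
    have "i \<noteq> 0"
    proof
      assume "i = 0"
      then have "card (orbit G ?\<phi> h) = 1" using i by simp
      then show False using fixed that by blast
    qed
    then show ?thesis unfolding i by simp
  qed
  show ?thesis
  proof (cases "group_center G \<subseteq> {\<one>}")
    case True
    then have Z: "group_center G = {\<one>}" using group_center_subgroup subgroup.one_closed by blast
    let ?O = "orbits G (carrier G) ?\<phi>"
    have o1: "orbit G ?\<phi> \<one> = {\<one>}" unfolding orbit_def by (auto intro!: exI [of _ \<one>])
    have O1: "{\<one>} \<in> ?O" unfolding orbits_def using o1 by fastforce
    have finO: "finite ?O" unfolding orbits_def using assms(1) by simp
    have "order G = (\<Sum>orb\<in>?O. card orb)"
      using A.disjoint_sum [OF assms(1), of "\<lambda>_. 1 :: nat"] by (simp add: order_def)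
    also have "\<dots> = card {\<one>} + (\<Sum>orb\<in>?O - {{\<one>}}. card orb)"
      using finO O1 by (rule sum.remove)
    finally have eq: "order G = 1 + (\<Sum>orb\<in>?O - {{\<one>}}. card orb)" by simp
    have "p dvd (\<Sum>orb\<in>?O - {{\<one>}}. card orb)"
    proof (rule dvd_sum)
      fix orb assume orb: "orb \<in> ?O - {{\<one>}}"
      then obtain h where h: "h \<in> carrier G" "orb = orbit G ?\<phi> h" unfolding orbits_def by blast
      then have "h \<noteq> \<one>" using orb o1 by auto
      then show "p dvd card orb" using pd h Z by simp
    qed
    moreover have "p dvd 1 + (\<Sum>orb\<in>?O - {{\<one>}}. card orb)"
      unfolding eq [symmetric] using assms(3,4) by simp
    ultimately have "p dvd 1" by (simp only: dvd_add_left_iff)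
    then show ?thesis using assms(2) by (simp add: prime_nat_iff)
  next
    case False
    then show ?thesis using that by blast
  qed
qed

text \<open>A nontrivial central element of a Sylow \<open>p\<close>-subgroup commutes, by
  coprimality, with the Sylow subgroups for all other primes. So its centralizer contains a Sylow
  subgroup for every prime.\<close>

lemma coprime_commuting_center_nontrivial:
  assumes "finite (carrier G)" "coprime_commuting G" "carrier G \<noteq> {\<one>}"
  obtains z where "z \<in> group_center G" "z \<noteq> \<one>"
proof -
  have "order G \<noteq> 1" using assms(3) order_one_triv_iff by blast
  then obtain p where p: "Factorial_Ring.prime p" "p dvd order G" using prime_factor_nat by blast
  have G0: "order G \<noteq> 0" using assms(1) order_gt_0_iff_finite by simp
  obtain P where P: "subgroup P G" "card P = p ^ multiplicity p (order G)"
    using sylow_subgroup_exists assms(1) p by blast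
  interpret PG: group "G\<lparr>carrier := P\<rparr>" using P subgroup_imp_group by blast
  have Psub: "P \<subseteq> carrier G" using P subgroup.subset by blast
  have "multiplicity p (order G) > 0" using p G0 by (simp add: prime_multiplicity_gt_zero_iff)
  then obtain z where z: "z \<in> group_center (G\<lparr>carrier := P\<rparr>)" "z \<noteq> \<one>"
    using PG.p_group_center_nontrivial [of p "multiplicity p (order G)"] P p Psub assms(1)
    by (auto simp: order_def intro: finite_subset)
  then have zP: "z \<in> P" by (simp add: group_center_def)
  then have zG: "z \<in> carrier G" using Psub by blast
  have "centralizer_of z = carrier G"
  proof (rule subgroup_containing_sylows [OF assms(1) centralizer_of_subgroup [OF zG]])
    fix q :: nat assume q: "Factorial_Ring.prime q"
    show "\<exists>Q. subgroup Q G \<and> Q \<subseteq> centralizer_of z \<and> card Q = q ^ multiplicity q (order G)"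
    proof (cases "q = p")
      case True
      have "P \<subseteq> centralizer_of z"
        using group_centerD(2) [OF z(1)] Psub unfolding centralizer_of_def by fastforce
      then show ?thesis using True P by blast
    next
      case False
      obtain Q where Q: "subgroup Q G" "card Q = q ^ multiplicity q (order G)"
        using sylow_subgroup_exists assms(1) q by blast
      have Qsub: "Q \<subseteq> carrier G" using Q subgroup.subset by blast
      obtain e where e: "z [^] (p ^ e) = \<one>"
        using p_group_of_card [OF assms(1) P] zP by (auto simp: p_group_def)
      have "x \<in> centralizer_of z" if x: "x \<in> Q" for x
      proof -
        obtain f where f: "x [^] (q ^ f) = \<one>"
          using p_group_of_card [OF assms(1) Q] x by (auto simp: p_group_def)
        have "coprime (q ^ f) (p ^ e)" using False p q by (simp add: primes_coprime)
        then have "x \<otimes> z = z \<otimes> x"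
          using coprime_commutingD [OF assms(2) _ zG _ f e] x Qsub by blast
        then show ?thesis using x Qsub unfolding centralizer_of_def by blast
      qed
      then show ?thesis using Q by blast
    qed
  qed
  then have "z \<in> group_center G"
    using zG unfolding centralizer_of_def by (intro group_centerI) (blast, metis (mono_tags, lifting) mem_Collect_eq)
  then show ?thesis using that z by blast
qed

end

section \<open>The upper central series and elements of coprime exponent\<close>

context group
begin

lemma quotient_commute_iff:
  assumes "N \<lhd> G" "x \<in> carrier G" "g \<in> carrier G"
  shows "(N #> x) \<otimes>\<^bsub>G Mod N\<^esub> (N #> g) = (N #> g) \<otimes>\<^bsub>G Mod N\<^esub> (N #> x) \<longleftrightarrow>
    inv x \<otimes> conjugate_by G g x \<in> N"
proof -
  interpret N: normal N G by fact
  have "(N #> x) \<otimes>\<^bsub>G Mod N\<^esub> (N #> g) = (N #> g) \<otimes>\<^bsub>G Mod N\<^esub> (N #> x) \<longleftrightarrow>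
      N #> (x \<otimes> g) = N #> (g \<otimes> x)"
    using assms by (simp add: N.rcos_sum)
  also have "\<dots> \<longleftrightarrow> (g \<otimes> x) <# N = (x \<otimes> g) <# N"
    using assms N.coset_eq by auto
  also have "\<dots> \<longleftrightarrow> (x \<otimes> g) \<in> (g \<otimes> x) <# N"
    using assms N.is_subgroup by (metis l_repr_independence lcos_self m_closed)
  also have "\<dots> \<longleftrightarrow> (inv (g \<otimes> x)) \<otimes> (x \<otimes> g) \<in> N"
    using assms N.lcos_module_rev N.lcos_module_imp is_group by (metis m_closed)
  also have "(inv (g \<otimes> x)) \<otimes> (x \<otimes> g) = inv x \<otimes> conjugate_by G g x"
    using assms by (simp add: conjugate_by_def inv_mult_group m_assoc)
  finally show ?thesis .
qed

lemma quotient_center_iff: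
  assumes "N \<lhd> G" "x \<in> carrier G"
  shows "N #> x \<in> group_center (G Mod N) \<longleftrightarrow> (\<forall>g \<in> carrier G. inv x \<otimes> conjugate_by G g x \<in> N)"
proof -
  have "N #> x \<in> carrier (G Mod N)" using assms by (auto simp: carrier_FactGroup)
  then show ?thesis using quotient_commute_iff [OF assms]
    by (simp add: group_center_def carrier_FactGroup del: mult_FactGroup)
qed

lemma coset_preimage_normal:
  assumes "N \<lhd> G" "M \<lhd> G Mod N"
  shows "{x \<in> carrier G. N #> x \<in> M} \<lhd> G"
proof -
  interpret N: normal N G by fact
  interpret Q: group "G Mod N" by (rule N.factorgroup_is_group)
  interpret h: group_hom G "G Mod N" "\<lambda>x. N #> x"
    using N.r_coset_hom_Mod by unfold_locales auto
  have Ms: "subgroup M (G Mod N)" using assms(2) normal_imp_subgroup by blast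
  show ?thesis
  proof (rule normal_invI [OF subgroupI])
    fix a b assume a: "a \<in> {x \<in> carrier G. N #> x \<in> M}"
    then show "inv a \<in> {x \<in> carrier G. N #> x \<in> M}"
      using h.hom_inv [of a] subgroup.m_inv_closed [OF Ms] by auto
    assume "b \<in> {x \<in> carrier G. N #> x \<in> M}"
    then show "a \<otimes> b \<in> {x \<in> carrier G. N #> x \<in> M}"
      using a h.hom_mult [of a b] subgroup.m_closed [OF Ms] by auto
  next
    have "\<one> \<in> {x \<in> carrier G. N #> x \<in> M}"
      using h.hom_one subgroup.one_closed [OF Ms] by auto
    then show "{x \<in> carrier G. N #> x \<in> M} \<noteq> {}" by blast
  next
    fix x h assume "x \<in> carrier G" "h \<in> {x \<in> carrier G. N #> x \<in> M}"
    then show "x \<otimes> h \<otimes> inv x \<in> {x \<in> carrier G. N #> x \<in> M}"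
      using h.hom_mult h.hom_inv normal.inv_op_closed2 [OF assms(2), of "N #> x" "N #> h"]
      by (auto simp del: mult_FactGroup)
  qed auto
qed

lemma upper_central_Suc_iff:
  assumes "upper_central G n \<lhd> G"
  shows "x \<in> upper_central G (Suc n) \<longleftrightarrow>
    x \<in> carrier G \<and> (\<forall>g \<in> carrier G. inv x \<otimes> conjugate_by G g x \<in> upper_central G n)"
  using assms quotient_center_iff by auto

lemma upper_central_normal: "upper_central G n \<lhd> G"
proof (induction n)
  case 0
  then show ?case by (simp add: one_is_normal)
next
  case (Suc n)
  then interpret N: normal "upper_central G n" G .
  interpret Q: group "G Mod upper_central G n" by (rule N.factorgroup_is_group)
  show ?case using coset_preimage_normal [OF Suc Q.group_center_normal] by simp
qed

text \<open>The commutator of \<open>z\<close> and \<open>x\<close> is pushed down the series. Once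
  it lies in term \<open>Suc m\<close>, it is central modulo term \<open>m\<close>, where
  \<open>central_commutator_commute\<close> makes it trivial; in term 0 it is the identity.\<close>

lemma upper_central_commute:
  fixes a b :: nat
  assumes z: "z \<in> upper_central G n" "z [^] a = \<one>" and x: "x \<in> carrier G" "x [^] b = \<one>"
    and "coprime a b"
  shows "z \<otimes> x = x \<otimes> z"
proof -
  let ?c = "inv z \<otimes> conjugate_by G x z"
  have zG: "z \<in> carrier G"
    using z upper_central_normal normal_imp_subgroup subgroup.mem_carrier by metis
  have c: "?c \<in> carrier G" using zG x by simp
  have "?c \<in> upper_central G (n - k)" if "k \<le> n" for k
    using that
  proof (induction k)
    case 0
    interpret N: normal "upper_central G n" G by (rule upper_central_normal)
    show ?case using z x normal_conjugate_by [OF upper_central_normal] by simp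
  next
    case (Suc k)
    define m where "m = n - Suc k"
    then have m: "n - k = Suc m" using Suc.prems by simp
    let ?N = "upper_central G m"
    interpret N: normal ?N G by (rule upper_central_normal)
    interpret Q: group "G Mod ?N" by (rule N.factorgroup_is_group)
    interpret h: group_hom G "G Mod ?N" "\<lambda>x. ?N #> x"
      using N.r_coset_hom_Mod by unfold_locales auto
    have Z: "?N #> ?c \<in> group_center (G Mod ?N)" using Suc m by simp
    have c': "?N #> ?c = inv\<^bsub>G Mod ?N\<^esub> (?N #> z) \<otimes>\<^bsub>G Mod ?N\<^esub> conjugate_by (G Mod ?N) (?N #> x) (?N #> z)"
      using zG x unfolding conjugate_by_def
      by (simp only: h.hom_mult h.hom_inv m_closed inv_closed)
    have "(?N #> z) \<otimes>\<^bsub>G Mod ?N\<^esub> (?N #> x) = (?N #> x) \<otimes>\<^bsub>G Mod ?N\<^esub> (?N #> z)"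
    proof (rule Q.central_commutator_commute)
      show "(?N #> z) [^]\<^bsub>G Mod ?N\<^esub> a = \<one>\<^bsub>G Mod ?N\<^esub>" "(?N #> x) [^]\<^bsub>G Mod ?N\<^esub> b = \<one>\<^bsub>G Mod ?N\<^esub>"
        using z x zG by (metis h.hom_nat_pow h.hom_one)+
    qed (use Z zG x assms in \<open>auto simp: group_center_def c' [symmetric] simp del: mult_FactGroup\<close>)
    then have "?N #> ?c = \<one>\<^bsub>G Mod ?N\<^esub>"
      using zG x Q.conjugate_by_eq_iff [of "?N #> x" "?N #> z" "?N #> z"] c'
      by (metis Q.l_inv h.hom_closed)
    then show ?case using c N.rcos_eq_iff m_def by simp
  qed
  from this [of n] have "?c = \<one>" by simp
  then have "conjugate_by G x z = z" using zG x by (metis conjugate_by_closed inv_closed inv_equality inv_inv)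
  then show ?thesis using zG x by (simp add: conjugate_by_eq_iff)
qed

lemma hypercenter_commute:
  fixes a b :: nat
  assumes "z \<in> hypercenter G" "z [^] a = \<one>" "x \<in> carrier G" "x [^] b = \<one>" "coprime a b"
  shows "z \<otimes> x = x \<otimes> z"
  using assms upper_central_commute unfolding hypercenter_def by blast

lemma nilpotent_imp_coprime_commuting:
  assumes "nilpotent_group G"
  shows "coprime_commuting G"
  using assms upper_central_commute unfolding nilpotent_group_def coprime_commuting_def by metis

text \<open>Quotients inherit the property and, if nontrivial, have a nontrivial centre. So the
  upper central series grows strictly until it reaches \<open>G\<close>, which must happen because
  \<open>G\<close> is finite.\<close>

lemma coprime_commuting_imp_nilpotent:
  assumes "finite (carrier G)" "coprime_commuting G"
  shows "nilpotent_group G"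
proof -
  have sub: "upper_central G n \<subseteq> carrier G" for n
    using upper_central_normal normal_imp_subgroup subgroup.subset by metis
  have step: "upper_central G n \<subset> upper_central G (Suc n)" if n: "upper_central G n \<noteq> carrier G" for n
  proof -
    let ?N = "upper_central G n"
    interpret N: normal ?N G by (rule upper_central_normal)
    interpret Q: group "G Mod ?N" by (rule N.factorgroup_is_group)
    obtain w where w: "w \<in> carrier G" "w \<notin> ?N" using n sub by blast
    then have "?N #> w \<noteq> ?N" "?N #> w \<in> carrier (G Mod ?N)"
      using N.rcos_eq_iff by (auto simp: carrier_FactGroup)
    then have "carrier (G Mod ?N) \<noteq> {\<one>\<^bsub>G Mod ?N\<^esub>}" by auto
    moreover have "finite (carrier (G Mod ?N))"
      using assms(1) by (simp add: carrier_FactGroup)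
    ultimately obtain Z where Z: "Z \<in> group_center (G Mod ?N)" "Z \<noteq> \<one>\<^bsub>G Mod ?N\<^esub>"
      using Q.coprime_commuting_center_nontrivial N.coprime_commuting_quotient assms by metis
    then obtain z where z: "z \<in> carrier G" "Z = ?N #> z"
      by (auto simp: group_center_def carrier_FactGroup)
    then have "z \<in> upper_central G (Suc n)" "z \<notin> ?N" using Z N.rcos_eq_iff by auto
    moreover have "x \<in> upper_central G (Suc n)" if x: "x \<in> ?N" for x
    proof -
      have "x \<in> carrier G" using x sub by blast
      moreover have "inv x \<otimes> conjugate_by G g x \<in> ?N" if "g \<in> carrier G" for g
        using x that normal_conjugate_by [OF upper_central_normal] by simp
      ultimately show ?thesis using upper_central_Suc_iff [OF upper_central_normal] by blast
    qed
    ultimately show ?thesis by blast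
  qed
  show ?thesis
  proof (rule ccontr)
    assume "\<not> nilpotent_group G"
    then have ne: "upper_central G n \<noteq> carrier G" for n
      unfolding nilpotent_group_def using is_group by blast
    have "n \<le> card (upper_central G n)" for n
    proof (induction n)
      case (Suc n)
      have "finite (upper_central G (Suc n))" using sub assms(1) finite_subset by blast
      then have "card (upper_central G n) < card (upper_central G (Suc n))"
        using step [OF ne] psubset_card_mono by blast
      then show ?case using Suc by linarith
    qed simp
    moreover have "card (upper_central G n) \<le> card (carrier G)" for n
      using sub assms(1) card_mono by blast
    ultimately have "Suc (card (carrier G)) \<le> card (carrier G)" by (meson order_trans)
    then show False by simp
  qed
qed

text \<open>For the first term of the upper central series that is not inside \<open>D\<close>, any
  element \<open>g\<close> of it outside \<open>D\<close> will do: its commutators with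
  \<open>D\<close> lie in the previous term, hence in \<open>D\<close>.\<close>

lemma coprime_commuting_normalizer_grows:
  assumes "finite (carrier G)" "coprime_commuting G" "subgroup D G" "D \<noteq> carrier G"
  obtains g where "g \<in> carrier G" "g \<notin> D" "g \<in> normalizer G D"
proof -
  have sub: "D \<subseteq> carrier G" using assms subgroup.subset by blast
  obtain N where "upper_central G N = carrier G"
    using coprime_commuting_imp_nilpotent [OF assms(1,2)] unfolding nilpotent_group_def by blast
  then have "\<exists>n. \<not> upper_central G n \<subseteq> D" using assms(4) sub by blast
  then obtain n where n: "\<not> upper_central G n \<subseteq> D" "\<And>m. m < n \<Longrightarrow> upper_central G m \<subseteq> D"
    using exists_least_iff [of "\<lambda>n. \<not> upper_central G n \<subseteq> D"] by blast
  moreover have "upper_central G 0 \<subseteq> D" using assms(3) subgroup.one_closed by auto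
  ultimately obtain m where m: "n = Suc m" by (cases n) auto
  obtain g where g: "g \<in> upper_central G (Suc m)" "g \<notin> D" using n m by blast
  then have gG: "g \<in> carrier G" using upper_central_Suc_iff [OF upper_central_normal] by blast
  have "g \<in> normalizer G D"
  proof (rule normalizer_memI [OF assms(1,3) gG])
    fix d assume d: "d \<in> D"
    then have dG: "d \<in> carrier G" using sub by blast
    have "inv g \<otimes> conjugate_by G (inv d) g \<in> upper_central G m"
      using g dG upper_central_Suc_iff [OF upper_central_normal] by blast
    moreover have "inv g \<otimes> conjugate_by G (inv d) g = conjugate_by G g d \<otimes> inv d"
      using gG dG by (simp add: conjugate_by_def m_assoc)
    ultimately have "conjugate_by G g d \<otimes> inv d \<in> D" using n m by auto
    then have "conjugate_by G g d \<otimes> inv d \<otimes> d \<in> D" using d assms(3) subgroup.m_closed by metis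
    then show "conjugate_by G g d \<in> D" using gG dG by (simp add: m_assoc)
  qed
  then show ?thesis using that gG g by blast
qed

end

section \<open>Coprime automorphisms of p-groups\<close>

context group
begin

text \<open>Collection process: moving one more \<open>a\<close> past \<open>b [^] n\<close>
  produces the central factor \<open>z [^] n\<close>, and \<open>0 + 1 + ... + (n - 1)\<close> is
  \<open>n choose 2\<close>.\<close>

lemma power_mult_central_commutator:
  assumes "a \<in> carrier G" "b \<in> carrier G" "z \<in> group_center G" "b \<otimes> a = a \<otimes> b \<otimes> z"
  shows "(a \<otimes> b) [^] n = a [^] n \<otimes> b [^] n \<otimes> z [^] (n choose 2)"
proof -
  have zG: "z \<in> carrier G" by (rule group_centerD(1) [OF assms(3)])
  have zp: "z [^] (k::nat) \<otimes> g = g \<otimes> z [^] k" if "g \<in> carrier G" for g k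
    using that subgroup_nat_pow_closed [OF group_center_subgroup assms(3), of k]
    by (intro group_centerD(2))
  have ba: "b [^] n \<otimes> a = a \<otimes> b [^] n \<otimes> z [^] n" for n :: nat
  proof (induction n)
    case (Suc n)
    have "b [^] Suc n \<otimes> a = b [^] n \<otimes> (b \<otimes> a)" using assms by (simp add: m_assoc)
    also have "\<dots> = b [^] n \<otimes> a \<otimes> b \<otimes> z" using assms zG by (simp add: m_assoc)
    also have "\<dots> = a \<otimes> b [^] n \<otimes> (z [^] n \<otimes> b) \<otimes> z" using assms zG Suc by (simp add: m_assoc)
    also have "\<dots> = a \<otimes> b [^] n \<otimes> (b \<otimes> z [^] n) \<otimes> z" using zp assms by simp
    also have "\<dots> = a \<otimes> b [^] Suc n \<otimes> z [^] Suc n" using assms zG by (simp add: m_assoc)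
    finally show ?case .
  qed (use assms in simp)
  show ?thesis
  proof (induction n)
    case (Suc n)
    let ?k = "n choose 2"
    have "(a \<otimes> b) [^] Suc n = a [^] n \<otimes> b [^] n \<otimes> (z [^] ?k \<otimes> (a \<otimes> b))"
      using Suc assms zG by (simp add: m_assoc)
    also have "\<dots> = a [^] n \<otimes> b [^] n \<otimes> (a \<otimes> b \<otimes> z [^] ?k)" using zp assms by simp
    also have "\<dots> = a [^] n \<otimes> (b [^] n \<otimes> a) \<otimes> b \<otimes> z [^] ?k" using assms zG by (simp add: m_assoc)
    also have "\<dots> = a [^] n \<otimes> a \<otimes> b [^] n \<otimes> (z [^] n \<otimes> b) \<otimes> z [^] ?k"
      using assms zG ba by (simp add: m_assoc)
    also have "\<dots> = a [^] n \<otimes> a \<otimes> b [^] n \<otimes> (b \<otimes> z [^] n) \<otimes> z [^] ?k" using zp assms by simp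
    also have "\<dots> = a [^] Suc n \<otimes> b [^] Suc n \<otimes> (z [^] n \<otimes> z [^] ?k)"
      using assms zG by (simp add: m_assoc)
    also have "z [^] n \<otimes> z [^] ?k = z [^] (Suc n choose 2)"
      using zG by (simp add: nat_pow_mult numeral_2_eq_2)
    finally show ?case .
  qed (simp add: numeral_2_eq_2)
qed

lemma p_group_imp_coprime_commuting:
  assumes "p_group G p" "Factorial_Ring.prime p"
  shows "coprime_commuting G"
  unfolding coprime_commuting_def
proof (intro ballI allI impI)
  fix x y and a b :: nat
  assume xy: "x \<in> carrier G" "y \<in> carrier G" "coprime a b" "x [^] a = \<one>" "y [^] b = \<one>"
  obtain e f where ef: "x [^] (p ^ e) = \<one>" "y [^] (p ^ f) = \<one>"
    using assms(1) xy unfolding p_group_def by blast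
  have "coprime p a \<or> coprime p b"
    using xy(3) assms(2) by (metis coprime_common_divisor not_prime_unit prime_imp_coprime)
  then have "x = \<one> \<or> y = \<one>"
    using xy ef pow_coprime_one by (metis coprime_power_left_iff)
  then show "x \<otimes> y = y \<otimes> x" using xy by auto
qed

text \<open>A maximal proper invariant normal subgroup \<open>D\<close> is central, and \<open>G/D\<close> is elementary abelian.
  Hence every displacement \<open>inv g \<otimes> \<alpha> g\<close> has exponent \<open>m\<close> and is itself fixed by \<open>\<alpha>\<close>. The
  intended values of \<open>m\<close> are \<open>p\<close> for odd \<open>p\<close>, and \<open>4\<close> for \<open>p = 2\<close>.\<close>

lemma minimal_coprime_automorphism_trivial:
  fixes b p m :: nat
  assumes fin: "finite (carrier G)" and p: "Factorial_Ring.prime p" and pg: "p_group G p"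
    and hom: "\<alpha> \<in> hom G G" and per: "\<And>g. g \<in> carrier G \<Longrightarrow> (\<alpha> ^^ b) g = g" and cop: "coprime p b"
    and m: "p dvd m" "p dvd m choose 2"
    and fix_m: "\<And>g. g \<in> carrier G \<Longrightarrow> g [^] m = \<one> \<Longrightarrow> \<alpha> g = g"
    and proper: "\<And>H h. subgroup H G \<Longrightarrow> \<alpha> ` H \<subseteq> H \<Longrightarrow> H \<noteq> carrier G \<Longrightarrow> h \<in> H \<Longrightarrow> \<alpha> h = h"
    and g0: "g0 \<in> carrier G"
  shows "\<alpha> g0 = g0"
proof (rule ccontr)
  assume moved: "\<alpha> g0 \<noteq> g0"
  interpret h: group_hom G G \<alpha> using hom by unfold_locales auto
  have cl: "\<alpha> g \<in> carrier G" if "g \<in> carrier G" for g using that by simp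
  \<comment> \<open>A fixed displacement of \<open>g0\<close> would have exponent \<open>b\<close>
    as well as a power of \<open>p\<close>, hence be trivial. The rest of the proof aims at making
    \<open>\<alpha>\<close> fix this displacement.\<close>
  have fix0: "\<alpha> (inv g0 \<otimes> \<alpha> g0) \<noteq> inv g0 \<otimes> \<alpha> g0"
  proof
    assume eq: "\<alpha> (inv g0 \<otimes> \<alpha> g0) = inv g0 \<otimes> \<alpha> g0"
    obtain e where "(inv g0 \<otimes> \<alpha> g0) [^] (p ^ e) = \<one>" using pg g0 unfolding p_group_def by fastforce
    then show False
      using fixed_displacement_trivial [OF hom g0 per [OF g0] eq, of "p ^ e"] cop moved by simp
  qed
  have surj: "\<exists>h \<in> carrier G. \<alpha> h = g" if g: "g \<in> carrier G" for g
  proof -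
    have "b \<noteq> 0" using cop p by (metis coprime_0_right_iff not_prime_unit)
    then obtain b' where b': "b = Suc b'" using not0_implies_Suc by blast
    have "(\<alpha> ^^ b') g \<in> carrier G" by (induction b') (use g in auto)
    moreover have "\<alpha> ((\<alpha> ^^ b') g) = g" using per [OF g] b' by simp
    ultimately show ?thesis by blast
  qed
  \<comment> \<open>Since \<open>\<alpha>\<close> fixes both \<open>d\<close> and
    \<open>g0 d g0^-1\<close>, the displacement of \<open>g0\<close> centralizes \<open>D\<close>.
    If the centralizer of \<open>D\<close> were proper, \<open>\<alpha>\<close> would fix that
    displacement by \<open>proper\<close>; hence it is all of \<open>G\<close>.\<close>
  have central: "D \<subseteq> group_center G" if D: "D \<lhd> G" "\<alpha> ` D \<subseteq> D" "D \<noteq> carrier G" for D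
  proof -
    have Ds: "subgroup D G" using D normal_imp_subgroup by blast
    have Dc: "D \<subseteq> carrier G" using Ds subgroup.subset by blast
    have Df: "\<alpha> d = d" if "d \<in> D" for d using proper Ds D that by blast
    let ?C = "set_centralizer D"
    note C = set_centralizer_subgroup [OF Dc]
    have "\<alpha> ` ?C \<subseteq> ?C"
    proof clarify
      fix g assume g: "g \<in> ?C"
      show "\<alpha> g \<in> ?C"
      proof (rule set_centralizerI)
        fix d assume d: "d \<in> D"
        have "\<alpha> (g \<otimes> d) = \<alpha> (d \<otimes> g)" using set_centralizerD(2) [OF g d] by simp
        then show "\<alpha> g \<otimes> d = d \<otimes> \<alpha> g" using set_centralizerD(1) [OF g] d Dc Df by (simp add: subset_iff)
      qed (use set_centralizerD [OF g] in simp)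
    qed
    moreover have c: "inv g0 \<otimes> \<alpha> g0 \<in> ?C"
    proof (rule set_centralizerI)
      fix d assume d: "d \<in> D"
      then have dG: "d \<in> carrier G" using Dc by blast
      have "g0 \<otimes> d \<otimes> inv g0 \<in> D" using D d g0 normal_invE(2) by blast
      then have "\<alpha> (g0 \<otimes> d \<otimes> inv g0) = g0 \<otimes> d \<otimes> inv g0" using Df by blast
      then have eq: "\<alpha> g0 \<otimes> d \<otimes> inv (\<alpha> g0) = g0 \<otimes> d \<otimes> inv g0" using g0 dG d Df by simp
      have "inv g0 \<otimes> \<alpha> g0 \<otimes> d = inv g0 \<otimes> (\<alpha> g0 \<otimes> d \<otimes> inv (\<alpha> g0)) \<otimes> \<alpha> g0"
        using g0 dG by (simp add: m_assoc)
      also have "\<dots> = inv g0 \<otimes> (g0 \<otimes> d \<otimes> inv g0) \<otimes> \<alpha> g0" by (simp only: eq)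
      also have "\<dots> = d \<otimes> (inv g0 \<otimes> \<alpha> g0)" using g0 dG by (simp add: m_assoc [symmetric])
      finally show "inv g0 \<otimes> \<alpha> g0 \<otimes> d = d \<otimes> (inv g0 \<otimes> \<alpha> g0)" .
    qed (use g0 in simp)
    ultimately have "?C = carrier G" using proper [OF C] fix0 by blast
    then have "d \<in> group_center G" if "d \<in> D" for d
      using that Dc set_centralizerD(2) by (intro group_centerI) (blast, metis)
    then show ?thesis by blast
  qed
  define S where "S = {D. D \<lhd> G \<and> \<alpha> ` D \<subseteq> D \<and> D \<noteq> carrier G}"
  have "S \<subseteq> Pow (carrier G)" unfolding S_def using normal_imp_subgroup subgroup.subset by blast
  then have "finite S" using fin finite_subset by blast
  moreover have "{\<one>} \<in> S"
  proof -
    have "g0 \<noteq> \<one>" using moved by auto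
    then have "{\<one>} \<noteq> carrier G" using g0 by blast
    then show ?thesis unfolding S_def using one_is_normal by auto
  qed
  ultimately obtain D where "D \<in> S" and max: "\<And>D'. D' \<in> S \<Longrightarrow> card D' \<le> card D"
    using finite_has_maximal [of "card ` S"] by (metis (no_types, lifting) Max_ge Max_in
      empty_iff finite_imageI image_iff)
  then have D: "D \<lhd> G" "\<alpha> ` D \<subseteq> D" "D \<noteq> carrier G" unfolding S_def by auto
  interpret D: normal D G by fact
  have Dc: "D \<subseteq> carrier G" by (rule D.subset)
  have Df: "\<alpha> d = d" if "d \<in> D" for d using proper D.subgroup_axioms D that by blast
  have Dz: "D \<subseteq> group_center G" by (rule central [OF D])
  have bigger: "D' = carrier G" if "D' \<lhd> G" "\<alpha> ` D' \<subseteq> D'" "D \<subseteq> D'" "w \<in> D'" "w \<notin> D" for D' w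
  proof (rule ccontr)
    assume "D' \<noteq> carrier G"
    then have "card D' \<le> card D" using that max unfolding S_def by blast
    moreover have "finite D'" using that(1) normal_imp_subgroup subgroup.subset fin finite_subset by metis
    ultimately show False using that by (metis card_seteq)
  qed
  have comm: "inv x \<otimes> conjugate_by G g x \<in> D" if xg: "x \<in> carrier G" "g \<in> carrier G" for x g
  proof -
    interpret Q: group "G Mod D" by (rule D.factorgroup_is_group)
    interpret hQ: group_hom G "G Mod D" "\<lambda>x. D #> x"
      using D.r_coset_hom_Mod by unfold_locales auto
    \<comment> \<open>The preimage of the centre of \<open>G Mod D\<close> is invariant and strictly
      larger than \<open>D\<close>, so by maximality it is \<open>G\<close>, and the quotient is
      abelian.\<close>
    define D1 where "D1 = {x \<in> carrier G. D #> x \<in> group_center (G Mod D)}"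
    have mem: "x \<in> D1 \<longleftrightarrow> x \<in> carrier G \<and> (\<forall>g \<in> carrier G. inv x \<otimes> conjugate_by G g x \<in> D)" for x
      unfolding D1_def using quotient_center_iff [OF D(1)] by blast
    have "D1 \<lhd> G"
      unfolding D1_def by (rule coset_preimage_normal [OF D(1) Q.group_center_normal])
    moreover have "\<alpha> ` D1 \<subseteq> D1"
    proof clarify
      fix x assume x: "x \<in> D1"
      then have xG: "x \<in> carrier G" using mem by blast
      have "inv (\<alpha> x) \<otimes> conjugate_by G g (\<alpha> x) \<in> D" if "g \<in> carrier G" for g
      proof -
        obtain h where h: "h \<in> carrier G" "\<alpha> h = g" using surj \<open>g \<in> carrier G\<close> by blast
        have "\<alpha> (inv x \<otimes> conjugate_by G h x) \<in> D" using x h mem D(2) by blast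
        then show ?thesis using h xG by (simp add: conjugate_by_def)
      qed
      then show "\<alpha> x \<in> D1" using mem xG by simp
    qed
    moreover have "D \<subseteq> D1"
    proof
      fix d assume d: "d \<in> D"
      then have "inv d \<otimes> conjugate_by G g d \<in> D" if "g \<in> carrier G" for g
        using normal_conjugate_by [OF D(1) that d] by simp
      then show "d \<in> D1" using mem d Dc by blast
    qed
    moreover obtain w where "w \<in> D1" "w \<notin> D"
    proof -
      obtain w where w: "w \<in> carrier G" "w \<notin> D" using D(3) Dc by blast
      then have "D #> w \<noteq> D" "D #> w \<in> carrier (G Mod D)"
        using D.rcos_eq_iff by (auto simp: carrier_FactGroup)
      then have nt: "carrier (G Mod D) \<noteq> {\<one>\<^bsub>G Mod D\<^esub>}" by auto
      have finQ: "finite (carrier (G Mod D))" using fin by (simp add: carrier_FactGroup)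
      have "coprime_commuting (G Mod D)"
        using D.coprime_commuting_quotient [OF fin] p_group_imp_coprime_commuting [OF pg p] by blast
      then obtain Z where Z: "Z \<in> group_center (G Mod D)" "Z \<noteq> \<one>\<^bsub>G Mod D\<^esub>"
        using Q.coprime_commuting_center_nontrivial [OF finQ _ nt] by blast
      then have "Z \<in> carrier (G Mod D)" by (intro group_centerD(1))
      then obtain z where "z \<in> carrier G" "Z = D #> z" by (auto simp: carrier_FactGroup)
      then show ?thesis using that [of z] Z D.rcos_eq_iff unfolding D1_def by auto
    qed
    ultimately have "D1 = carrier G" using bigger by blast
    then show ?thesis using mem xg by blast
  qed
  have swap: "inv b \<otimes> conjugate_by G a b \<in> group_center G"
      "b \<otimes> a = a \<otimes> b \<otimes> (inv b \<otimes> conjugate_by G a b)" if "a \<in> carrier G" "b \<in> carrier G" for a b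
  proof -
    show "inv b \<otimes> conjugate_by G a b \<in> group_center G" using comm Dz that by blast
    show "b \<otimes> a = a \<otimes> b \<otimes> (inv b \<otimes> conjugate_by G a b)"
    proof -
      have "x \<otimes> (inv x \<otimes> w) = w" if "x \<in> carrier G" "w \<in> carrier G" for x w
        using that by (simp add: m_assoc [symmetric])
      then show ?thesis using that by (simp add: conjugate_by_def m_assoc)
    qed
  qed
  have pow: "x [^] p \<in> D" if x: "x \<in> carrier G" for x
  proof -
    \<comment> \<open>These elements have exponent \<open>p\<close> modulo \<open>D\<close>. They
      form a subgroup because commutators lie in \<open>D\<close>, and by maximality it is
      everything.\<close>
    define D2 where "D2 = {x \<in> carrier G. x [^] p \<in> D}"
    have "D2 \<lhd> G"
    proof (rule normal_conjugate_byI [OF subgroupI])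
      fix a b assume a: "a \<in> D2"
      then show "inv a \<in> D2" unfolding D2_def by (simp add: nat_pow_inv)
      assume b: "b \<in> D2"
      have ab: "a \<in> carrier G" "b \<in> carrier G" using a b unfolding D2_def by auto
      have "(a \<otimes> b) [^] p = a [^] p \<otimes> b [^] p \<otimes> (inv b \<otimes> conjugate_by G a b) [^] (p choose 2)"
        by (rule power_mult_central_commutator [OF ab swap [OF ab]])
      also have "\<dots> \<in> D"
        using a b subgroup_nat_pow_closed [OF D.subgroup_axioms comm [OF ab(2,1)]]
        unfolding D2_def by (intro D.m_closed) auto
      finally show "a \<otimes> b \<in> D2" unfolding D2_def using ab by simp
    next
      have "\<one> \<in> D2" unfolding D2_def by simp
      then show "D2 \<noteq> {}" by blast
    next
      fix x z assume "x \<in> carrier G" "z \<in> D2"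
      then show "conjugate_by G x z \<in> D2"
        unfolding D2_def using normal_conjugate_by [OF D(1)] by (simp add: conjugate_by_pow)
    qed (auto simp: D2_def)
    moreover have "\<alpha> ` D2 \<subseteq> D2"
    proof clarify
      fix x assume "x \<in> D2"
      then show "\<alpha> x \<in> D2" unfolding D2_def using D(2) by (auto simp: h.hom_nat_pow [symmetric])
    qed
    moreover have "D \<subseteq> D2"
      unfolding D2_def using Dc subgroup_nat_pow_closed [OF D.subgroup_axioms] by blast
    moreover obtain w where "w \<in> D2" "w \<notin> D"
    proof -
      obtain w where w: "w \<in> carrier G" "w \<notin> D" using D(3) Dc by blast
      obtain e where "w [^] (p ^ e) = \<one>" using pg w unfolding p_group_def by blast
      then have "\<exists>k. w [^] (p ^ k) \<in> D" by (metis D.one_closed)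
      then obtain k where k: "w [^] (p ^ k) \<in> D" "\<And>j. j < k \<Longrightarrow> w [^] (p ^ j) \<notin> D"
        using exists_least_iff [of "\<lambda>k. w [^] (p ^ k) \<in> D"] by blast
      have "k \<noteq> 0" using k w by (metis nat_pow_eone power_0)
      then obtain j where j: "k = Suc j" using not0_implies_Suc by blast
      have "(w [^] (p ^ j)) [^] p = w [^] (p ^ k)" using w j by (simp add: nat_pow_pow mult.commute)
      then show ?thesis using that [of "w [^] (p ^ j)"] k j w unfolding D2_def by simp
    qed
    ultimately have "D2 = carrier G" using bigger by blast
    then show ?thesis using x unfolding D2_def by blast
  qed
  \<comment> \<open>\<open>a \<otimes> b\<close> is the displacement of \<open>g0\<close>, and
    \<open>z\<close> is the central commutator that enters its powers. As \<open>b [^] p\<close> is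
    central, \<open>z\<close> has exponent \<open>p\<close>, so the correction
    \<open>z [^] (m choose 2)\<close> disappears.\<close>
  define a b z where "a = inv g0" and "b = \<alpha> g0" and "z = inv b \<otimes> conjugate_by G a b"
  have ab: "a \<in> carrier G" "b \<in> carrier G" unfolding a_def b_def using g0 by auto
  have z: "z \<in> group_center G" "b \<otimes> a = a \<otimes> b \<otimes> z" unfolding z_def by (rule swap [OF ab])+
  have zG: "z \<in> carrier G" by (rule group_centerD(1) [OF z(1)])
  have "z [^] p = \<one>"
  proof -
    have "conjugate_by G a b = b \<otimes> z" unfolding z_def using ab by (simp add: m_assoc [symmetric])
    moreover have "b \<otimes> z = z \<otimes> b" by (rule group_centerD(2) [OF z(1) ab(2), symmetric])
    ultimately have "conjugate_by G a b [^] p = b [^] p \<otimes> z [^] p"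
      using pow_mult_distrib ab zG by simp
    then have "conjugate_by G a (b [^] p) = b [^] p \<otimes> z [^] p" using ab by (simp add: conjugate_by_pow)
    moreover have "conjugate_by G a (b [^] p) = b [^] p"
    proof -
      have "b [^] p \<in> group_center G" using pow [OF ab(2)] Dz by blast
      then have "b [^] p \<otimes> a = a \<otimes> b [^] p" using ab(1) by (rule group_centerD(2))
      then show ?thesis using ab by (subst conjugate_by_eq_iff) auto
    qed
    ultimately have "b [^] p = b [^] p \<otimes> z [^] p" by simp
    then show ?thesis using l_cancel_one' [of "b [^] p" "z [^] p"] ab zG by simp
  qed
  then have "z [^] (m choose 2) = \<one>" using m(2) zG pow_dvd_one by blast
  then have "(a \<otimes> b) [^] m = a [^] m \<otimes> b [^] m"
    using power_mult_central_commutator [OF ab z] ab by simp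
  also have "\<dots> = inv (g0 [^] m) \<otimes> \<alpha> (g0 [^] m)"
    unfolding a_def b_def using g0 by (simp add: nat_pow_inv h.hom_nat_pow)
  also have "\<alpha> (g0 [^] m) = g0 [^] m"
  proof -
    obtain k where "m = p * k" using m(1) by blast
    then have "g0 [^] m = (g0 [^] p) [^] k" using g0 by (simp add: nat_pow_pow)
    then have "g0 [^] m \<in> D" using pow [OF g0] subgroup_nat_pow_closed [OF D.subgroup_axioms] by simp
    then show ?thesis by (rule Df)
  qed
  finally have "(a \<otimes> b) [^] m = \<one>" using g0 by simp
  then have "\<alpha> (a \<otimes> b) = a \<otimes> b" using fix_m ab by simp
  then show False using fix0 unfolding a_def b_def by simp
qed

end

text \<open>Induction on the order supplies the hypothesis \<open>proper\<close> of the minimal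
  case: all other assumptions restrict to an invariant subgroup, with the same map
  \<open>\<alpha>\<close>.\<close>

lemma coprime_automorphism_trivial:
  fixes G :: "('a, 'c) monoid_scheme" and b p m :: nat
  assumes "group G" "finite (carrier G)" "Factorial_Ring.prime p" "p_group G p"
    and "\<alpha> \<in> hom G G" "\<And>g. g \<in> carrier G \<Longrightarrow> (\<alpha> ^^ b) g = g" "coprime p b"
    and "p dvd m" "p dvd m choose 2"
    and "\<And>g. g \<in> carrier G \<Longrightarrow> g [^]\<^bsub>G\<^esub> m = \<one>\<^bsub>G\<^esub> \<Longrightarrow> \<alpha> g = g"
    and "g \<in> carrier G"
  shows "\<alpha> g = g"
  using assms
proof (induction "card (carrier G)" arbitrary: G g rule: less_induct)
  case less
  interpret group G by fact
  show ?case
  proof (rule minimal_coprime_automorphism_trivial [OF less.prems(2-9)])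
    fix H h assume H: "subgroup H G" "\<alpha> ` H \<subseteq> H" "H \<noteq> carrier G" "h \<in> H"
    have sub: "H \<subseteq> carrier G" using H subgroup.subset by blast
    have "card H < card (carrier G)" using sub H less.prems(2) by (simp add: psubset_card_mono psubset_eq)
    moreover have "\<alpha> \<in> hom (G\<lparr>carrier := H\<rparr>) (G\<lparr>carrier := H\<rparr>)"
      using less.prems(5) H(2) sub by (intro homI) (auto simp: hom_def subset_iff)
    moreover have "p_group (G\<lparr>carrier := H\<rparr>) p" using less.prems(4) sub by (auto simp: p_group_def)
    moreover have "group (G\<lparr>carrier := H\<rparr>)" using H subgroup_imp_group by blast
    moreover have "finite H" using sub less.prems(2) finite_subset by blast
    ultimately show "\<alpha> h = h"
      using less.prems(3,7-9) sub H(4)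
      by (intro less.hyps [of "G\<lparr>carrier := H\<rparr>" h])
        (auto intro: less.prems(6,10))
  qed (use less.prems in auto)
qed

section \<open>Normal p-subgroups\<close>

definition p_elements :: "('a, 'b) monoid_scheme \<Rightarrow> nat \<Rightarrow> 'a set" where
  "p_elements G p = {x \<in> carrier G. \<exists>e. x [^]\<^bsub>G\<^esub> (p ^ e) = \<one>\<^bsub>G\<^esub>}"

text \<open>The two equations say \<open>u = g^-1 a^i g\<close> and \<open>u a u^-1 = a^j\<close>: a conjugate of a power of \<open>a\<close> that
  normalizes \<open>\<langle>a\<rangle>\<close> lies in \<open>\<langle>a\<rangle>\<close>. Without inverses, the condition restricts to subgroups.\<close>

definition rigid_element :: "('a, 'b) monoid_scheme \<Rightarrow> 'a \<Rightarrow> bool" where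
  "rigid_element G a \<longleftrightarrow>
     (\<forall>g \<in> carrier G. \<forall>u \<in> carrier G. \<forall>(i::nat) (j::nat).
        g \<otimes>\<^bsub>G\<^esub> u = a [^]\<^bsub>G\<^esub> i \<otimes>\<^bsub>G\<^esub> g \<longrightarrow> u \<otimes>\<^bsub>G\<^esub> a = a [^]\<^bsub>G\<^esub> j \<otimes>\<^bsub>G\<^esub> u \<longrightarrow> (\<exists>k::nat. u = a [^]\<^bsub>G\<^esub> k))"

context group
begin

lemma conjugate_by_carrier_update:
  "subgroup N G \<Longrightarrow> x \<in> N \<Longrightarrow> conjugate_by (G\<lparr>carrier := N\<rparr>) x z = conjugate_by G x z"
  by (simp add: conjugate_by_def m_inv_consistent)

text \<open>A Sylow \<open>p\<close>-subgroup \<open>Q\<close> is centralized by the Sylow subgroups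
  for the other primes, so it is normal. The quotient has order prime to \<open>p\<close>, so every
  \<open>p\<close>-element lies in \<open>Q\<close>.\<close>

lemma p_elements_coprime_commuting:
  assumes fin: "finite (carrier G)" and cc: "coprime_commuting G" and p: "Factorial_Ring.prime p"
  shows "subgroup (p_elements G p) G"
proof -
  obtain Q where Q: "subgroup Q G" "card Q = p ^ multiplicity p (order G)"
    using sylow_subgroup_exists [OF fin p] by blast
  have Qc: "Q \<subseteq> carrier G" using Q subgroup.subset by blast
  have Qp: "\<exists>e. x [^] (p ^ e) = \<one>" if "x \<in> Q" for x
    using p_group_of_card [OF fin Q] that by (auto simp: p_group_def)
  have "normalizer G Q = carrier G"
  proof (rule subgroup_containing_sylows [OF fin normalizer_imp_subgroup [OF Qc]])
    fix q :: nat assume q: "Factorial_Ring.prime q"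
    obtain R where R: "subgroup R G" "card R = q ^ multiplicity q (order G)"
      using sylow_subgroup_exists [OF fin q] by blast
    have Rc: "R \<subseteq> carrier G" using R subgroup.subset by blast
    show "\<exists>P. subgroup P G \<and> P \<subseteq> normalizer G Q \<and> card P = q ^ multiplicity q (order G)"
    proof (cases "q = p")
      case True
      have "Q \<subseteq> normalizer G Q"
      proof
        fix x assume x: "x \<in> Q"
        then show "x \<in> normalizer G Q"
          using Q Qc by (intro normalizer_memI [OF fin]) (auto simp: conjugate_by_def
            intro!: subgroup.m_closed subgroup.m_inv_closed)
      qed
      then show ?thesis using True Q by blast
    next
      case False
      have "R \<subseteq> normalizer G Q"
      proof
        fix x assume x: "x \<in> R"
        show "x \<in> normalizer G Q"
        proof (rule normalizer_memI [OF fin Q(1)])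
          show xG: "x \<in> carrier G" using x Rc by blast
          fix h assume h: "h \<in> Q"
          obtain e where e: "h [^] (p ^ e) = \<one>" using Qp h by blast
          obtain f where f: "x [^] (q ^ f) = \<one>"
            using p_group_of_card [OF fin R] x by (auto simp: p_group_def)
          have "coprime (p ^ e) (q ^ f)" using False p q by (simp add: primes_coprime)
          then have "h \<otimes> x = x \<otimes> h" using coprime_commutingD [OF cc _ xG _ e f] h Qc by blast
          then have "conjugate_by G x h = h" using conjugate_by_eq_iff xG h Qc by blast
          then show "conjugate_by G x h \<in> Q" using h by simp
        qed
      qed
      then show ?thesis using R by blast
    qed
  qed
  then have "Q \<lhd> G" using normalizer_eq_carrier_imp_normal Q by blast
  then interpret Q: normal Q G .
  interpret F: group "G Mod Q" by (rule Q.factorgroup_is_group)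
  have "x \<in> Q" if x: "x \<in> carrier G" "x [^] (p ^ e) = \<one>" for x e
  proof -
    let ?X = "Q #> x"
    have X: "?X \<in> carrier (G Mod Q)" using x by (auto simp: carrier_FactGroup)
    have "?X [^]\<^bsub>G Mod Q\<^esub> (p ^ e) = \<one>\<^bsub>G Mod Q\<^esub>"
      using x by (simp add: Q.FactGroup_pow coset_mult_one Qc)
    moreover have "?X [^]\<^bsub>G Mod Q\<^esub> order (G Mod Q) = \<one>\<^bsub>G Mod Q\<^esub>"
      using X by (rule F.pow_order_eq_1)
    moreover have "coprime (p ^ e) (order (G Mod Q))"
    proof -
      have "order (G Mod Q) * p ^ multiplicity p (order G) = order G"
        using lagrange [OF Q(1)] Q(2) by (simp add: order_def FactGroup_def)
      moreover have "order G \<noteq> 0" using fin order_gt_0_iff_finite by simp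
      ultimately have "\<not> p dvd order (G Mod Q)"
        using p by (metis dvd_times_right_cancel_iff mult.commute mult_eq_0_iff multiplicity_dvd
            multiplicity_dvd' multiplicity_gt_zero_iff not_prime_unit power_Suc power_dvd_iff_le_multiplicity
            not_less_eq_eq order_refl mult_dvd_mono dvd_refl)
      then show ?thesis using p prime_imp_coprime coprime_power_left_iff by blast
    qed
    ultimately have "?X = \<one>\<^bsub>G Mod Q\<^esub>" using F.pow_coprime_one X by blast
    then show ?thesis using x Q.rcos_eq_iff by simp
  qed
  then have "p_elements G p = Q" unfolding p_elements_def using Qp Qc by blast
  then show ?thesis using Q by simp
qed

lemma p_elements_normal:
  assumes fin: "finite (carrier G)" and N: "N \<lhd> G" "coprime_commuting (G\<lparr>carrier := N\<rparr>)"
    and p: "Factorial_Ring.prime p"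
  shows "p_elements (G\<lparr>carrier := N\<rparr>) p \<lhd> G"
    and "p_group (G\<lparr>carrier := p_elements (G\<lparr>carrier := N\<rparr>) p\<rparr>) p"
proof -
  have Ns: "subgroup N G" using N normal_imp_subgroup by blast
  interpret NG: group "G\<lparr>carrier := N\<rparr>" using Ns subgroup_imp_group by blast
  have Nc: "N \<subseteq> carrier G" using Ns subgroup.subset by blast
  then have "finite N" using fin finite_subset by blast
  then have "subgroup (p_elements (G\<lparr>carrier := N\<rparr>) p) (G\<lparr>carrier := N\<rparr>)"
    using NG.p_elements_coprime_commuting N p by simp
  then have sub: "subgroup (p_elements (G\<lparr>carrier := N\<rparr>) p) G"
    using Ns incl_subgroup by blast
  show "p_elements (G\<lparr>carrier := N\<rparr>) p \<lhd> G"
  proof (rule normal_conjugate_byI [OF sub])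
    fix x z assume x: "x \<in> carrier G" and z: "z \<in> p_elements (G\<lparr>carrier := N\<rparr>) p"
    then obtain e where e: "z \<in> N" "z [^] (p ^ e) = \<one>" by (auto simp: p_elements_def)
    have "conjugate_by G x z [^] (p ^ e) = conjugate_by G x (z [^] (p ^ e))"
      using x e Nc conjugate_by_pow by blast
    also have "\<dots> = \<one>" using x e by (simp add: conjugate_by_def)
    finally have "conjugate_by G x z [^] (p ^ e) = \<one>" .
    then show "conjugate_by G x z \<in> p_elements (G\<lparr>carrier := N\<rparr>) p"
      using normal_conjugate_by [OF N(1) x e(1)] by (auto simp: p_elements_def)
  qed
  show "p_group (G\<lparr>carrier := p_elements (G\<lparr>carrier := N\<rparr>) p\<rparr>) p"
    by (auto simp: p_group_def p_elements_def)
qed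

text \<open>If the normalizer \<open>D\<close> of \<open>H\<close> in \<open>P\<close> were proper,
  some \<open>g\<close> in \<open>P\<close> outside \<open>D\<close> would normalize
  \<open>D\<close>. The conjugates by \<open>g\<close> of elements of \<open>H\<close> would then
  lie in \<open>D\<close>, so normalize \<open>H\<close>, and rigidity would put them back into
  \<open>H\<close>; thus \<open>g\<close> would normalize \<open>H\<close> after all. Once
  \<open>P\<close> normalizes \<open>H\<close>, rigidity applies to every \<open>x\<close> in
  \<open>G\<close>, because conjugation by \<open>x\<close> does not leave \<open>P\<close>.\<close>

lemma rigid_order_four_normalized:
  assumes fin: "finite (carrier G)" and P: "P \<lhd> G" "coprime_commuting (G\<lparr>carrier := P\<rparr>)"
    and a: "a \<in> P" "rigid_element G a" and x: "x \<in> carrier G"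
  obtains k :: nat where "conjugate_by G x a = a [^] k"
proof -
  have Ps: "subgroup P G" using P normal_imp_subgroup by blast
  have Pc: "P \<subseteq> carrier G" using Ps subgroup.subset by blast
  have aG: "a \<in> carrier G" using a Pc by blast
  interpret PG: group "G\<lparr>carrier := P\<rparr>" using Ps subgroup_imp_group by blast
  define H where "H = {a [^] k | k::nat. k \<in> UNIV}"
  have Heq: "H = generate G {a}" unfolding H_def using generate_pow_on_finite_carrier [OF fin aG] by simp
  have Hs: "subgroup H G" unfolding Heq using aG generate_is_subgroup by simp
  have aH: "a \<in> H" unfolding Heq by (simp add: generate.incl)
  have HP: "H \<subseteq> P" unfolding H_def using subgroup_nat_pow_closed [OF Ps a(1)] by blast
  have rigid: "conjugate_by G g h \<in> H"
    if gh: "g \<in> carrier G" "h \<in> H" "conjugate_by G g h \<in> normalizer G H" for g h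
  proof -
    let ?u = "conjugate_by G g h"
    obtain i where i: "h = a [^] (i::nat)" using gh unfolding H_def by blast
    have hG: "h \<in> carrier G" using i aG by simp
    have uG: "?u \<in> carrier G" using hG gh by simp
    have "inv ?u \<in> normalizer G H"
      using gh(3) normalizer_imp_subgroup subgroup.m_inv_closed HP Pc by (metis order_trans)
    then have "conjugate_by G (inv ?u) a \<in> H" using normalizer_memD(1) [OF Hs] aH by blast
    then obtain j where j: "conjugate_by G (inv ?u) a = a [^] (j::nat)" unfolding H_def by blast
    have "?u \<otimes> a = a [^] j \<otimes> ?u"
      using j uG aG by (simp add: conjugate_by_def) (metis inv_solve_right' m_closed nat_pow_closed)
    moreover have "g \<otimes> ?u = a [^] i \<otimes> g"
      using conjugate_by_eq_iff [OF gh(1) hG uG] i by simp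
    ultimately show ?thesis
      using a(2) gh(1) uG unfolding rigid_element_def H_def by blast
  qed
  have Nc: "normalizer G H \<subseteq> carrier G" using normalizer_imp_subgroup subgroup.subset HP Pc by (metis order_trans)
  have "P \<subseteq> normalizer G H"
  proof (rule ccontr)
    assume not: "\<not> P \<subseteq> normalizer G H"
    define D where "D = P \<inter> normalizer G H"
    have "subgroup D G" unfolding D_def
      using Ps normalizer_imp_subgroup HP Pc subgroups_Inter_pair by (metis order_trans)
    then have "subgroup D (G\<lparr>carrier := P\<rparr>)" using Ps subgroup_incl D_def by blast
    moreover have "D \<noteq> P" using not unfolding D_def by blast
    moreover have "finite P" using Pc fin finite_subset by blast
    ultimately obtain g where g: "g \<in> P" "g \<notin> D" "g \<in> normalizer (G\<lparr>carrier := P\<rparr>) D"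
      using PG.coprime_commuting_normalizer_grows [of D] P(2) by auto
    have HD: "H \<subseteq> D"
    proof
      fix h assume h: "h \<in> H"
      then have "h \<in> normalizer G H"
        using Hs HP Pc by (intro normalizer_memI [OF fin]) (auto simp: conjugate_by_def
            intro!: subgroup.m_closed subgroup.m_inv_closed)
      then show "h \<in> D" using h HP unfolding D_def by blast
    qed
    have "g \<in> normalizer G H"
    proof (rule normalizer_memI [OF fin Hs])
      show gG: "g \<in> carrier G" using g Pc by blast
      fix h assume h: "h \<in> H"
      have "conjugate_by (G\<lparr>carrier := P\<rparr>) g h \<in> D"
        using PG.normalizer_memD(1) [OF \<open>subgroup D (G\<lparr>carrier := P\<rparr>)\<close> g(3)] h HD by blast
      then have "conjugate_by G g h \<in> normalizer G H"
        using conjugate_by_carrier_update [OF Ps g(1)] unfolding D_def by simp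
      then show "conjugate_by G g h \<in> H" using rigid gG h by blast
    qed
    then show False using g unfolding D_def by blast
  qed
  then have "conjugate_by G x a \<in> H"
    using rigid [OF x aH] normal_conjugate_by [OF P(1) x a(1)] by blast
  then show ?thesis using that unfolding H_def by blast
qed

lemma normal_p_subgroup_coprime_centralized:
  fixes b :: nat
  assumes fin: "finite (carrier G)" and P: "P \<lhd> G" and p: "Factorial_Ring.prime p"
    and pg: "p_group (G\<lparr>carrier := P\<rparr>) p"
    and prime_order: "\<And>z x b. \<lbrakk>z \<in> P; z [^] p = \<one>; x \<in> carrier G; x [^] (b::nat) = \<one>; coprime p b\<rbrakk>
      \<Longrightarrow> z \<otimes> x = x \<otimes> z"
    and four: "\<And>a. \<lbrakk>p = 2; a \<in> P; a [^] (4::nat) = \<one>; a [^] (2::nat) \<noteq> \<one>\<rbrakk> \<Longrightarrow> rigid_element G a"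
    and x: "x \<in> carrier G" "x [^] b = \<one>" "coprime p b" and z: "z \<in> P"
  shows "z \<otimes> x = x \<otimes> z"
proof -
  have Ps: "subgroup P G" using P normal_imp_subgroup by blast
  have Pc: "P \<subseteq> carrier G" using Ps subgroup.subset by blast
  interpret PG: group "G\<lparr>carrier := P\<rparr>" using Ps subgroup_imp_group by blast
  have ccP: "coprime_commuting (G\<lparr>carrier := P\<rparr>)" using PG.p_group_imp_coprime_commuting pg p by blast
  \<comment> \<open>\<open>2 choose 2\<close> is odd, so exponent 2 does not meet the divisibility
    requirement for \<open>p = 2\<close>, while \<open>4 choose 2 = 6\<close> does. This is where
    elements of order 4 enter.\<close>
  define m where "m = (if p = 2 then 4 else p)"
  have m: "p dvd m" "p dvd m choose 2"
  proof -
    show "p dvd m" unfolding m_def by auto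
    show "p dvd m choose 2"
    proof (cases "p = 2")
      case True
      then show ?thesis unfolding m_def by (simp add: choose_two)
    next
      case False
      then show ?thesis unfolding m_def using dvd_choose_prime [of 2 p] p prime_ge_2_nat [OF p] by simp
    qed
  qed
  have "conjugate_by G x z = z"
  proof (rule coprime_automorphism_trivial [OF PG.is_group _ p pg _ _ x(3) m])
    show "finite (carrier (G\<lparr>carrier := P\<rparr>))" using Pc fin finite_subset by auto
    show "conjugate_by G x \<in> hom (G\<lparr>carrier := P\<rparr>) (G\<lparr>carrier := P\<rparr>)"
      using Pc x conjugate_by_mult normal_conjugate_by [OF P x(1)] by (intro homI) (auto simp: subset_iff)
    show "(conjugate_by G x ^^ b) g = g" if "g \<in> carrier (G\<lparr>carrier := P\<rparr>)" for g
      using that Pc x by (auto simp: conjugate_by_funpow subset_iff)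
    show "z \<in> carrier (G\<lparr>carrier := P\<rparr>)" using z by simp
    fix g assume g: "g \<in> carrier (G\<lparr>carrier := P\<rparr>)" "g [^]\<^bsub>G\<lparr>carrier := P\<rparr>\<^esub> m = \<one>\<^bsub>G\<lparr>carrier := P\<rparr>\<^esub>"
    then have gP: "g \<in> P" and gm: "g [^] m = \<one>" by auto
    have gG: "g \<in> carrier G" using gP Pc by blast
    have "g \<otimes> x = x \<otimes> g"
    proof (cases "p = 2 \<and> g [^] (2::nat) \<noteq> \<one>")
      case False
      then have "g [^] p = \<one>" using gm unfolding m_def by (auto split: if_splits)
      then show ?thesis using prime_order gP x by blast
    next
      case True
      then have p2: "p = 2" and g2: "g [^] (2::nat) \<noteq> \<one>" by auto
      have g4: "g [^] (4::nat) = \<one>" using gm p2 unfolding m_def by simp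
      obtain k :: nat where k: "conjugate_by G x g = g [^] k"
        using rigid_order_four_normalized [OF fin P ccP gP _ x(1)] four p2 gP g4 g2 by blast
      let ?c = "inv g \<otimes> conjugate_by G x g"
      have cG: "?c \<in> carrier G" using gG x by simp
      have "odd k"
      proof
        assume "even k"
        then have "4 dvd k * 2" by auto
        then have "conjugate_by G x g [^] (2::nat) = \<one>"
          unfolding k using pow_dvd_one [OF gG g4] gG by (simp add: nat_pow_pow)
        then have "conjugate_by G x (g [^] (2::nat)) = \<one>" using gG x by (simp add: conjugate_by_pow)
        then have "g [^] (2::nat) \<otimes> x = x \<otimes> \<one>" using gG x conjugate_by_eq_iff by blast
        then show False using g2 gG x(1) by (simp add: l_cancel_one)
      qed
      \<comment> \<open>\<open>k + 3\<close> stands for \<open>k - 1\<close>, as \<open>g\<close>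
        has exponent 4. Since \<open>k\<close> is odd, \<open>?c\<close> has exponent 2 and falls
        under the prime case: \<open>x\<close> centralizes \<open>?c\<close>, and by coprimality
        also \<open>g\<close>.\<close>
      have ceq: "?c = g [^] (k + 3)"
      proof -
        have "g [^] (k + 3) = g [^] k \<otimes> g [^] (3::nat)" using gG by (simp add: nat_pow_mult)
        moreover have "g [^] (3::nat) = inv g"
        proof -
          have "g [^] (3::nat) \<otimes> g = \<one>" using g4 gG by (simp add: numeral_eq_Suc)
          then show ?thesis using gG inv_equality by (metis nat_pow_closed)
        qed
        moreover have "inv g \<otimes> g [^] k = g [^] k \<otimes> inv g"
          using gG by (intro inv_commute) (simp_all add: nat_pow_Suc2 [symmetric])
        ultimately show ?thesis using k by simp
      qed
      have "4 dvd (k + 3) * 2" using \<open>odd k\<close> by (elim oddE) auto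
      then have c2: "?c [^] (2::nat) = \<one>"
        unfolding ceq using pow_dvd_one [OF gG g4] gG by (simp add: nat_pow_pow)
      have cP: "?c \<in> P" unfolding ceq using subgroup_nat_pow_closed [OF Ps gP] .
      have "?c \<otimes> x = x \<otimes> ?c" using prime_order [OF cP _ x(1,2,3)] c2 p2 by blast
      then show ?thesis using fixed_commutator_commute [OF x(1) gG x(2) _ c2] x(3) p2 by blast
    qed
    then show "conjugate_by G x g = g" using conjugate_by_eq_iff x gG by blast
  qed
  then show ?thesis using conjugate_by_eq_iff x z Pc by blast
qed

end

section \<open>Groups with restricted elements of order p and 4\<close>

definition maximal_subgroup :: "('a, 'b) monoid_scheme \<Rightarrow> 'a set \<Rightarrow> bool" where
  "maximal_subgroup G M \<longleftrightarrow> subgroup M G \<and> M \<noteq> carrier G \<and>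
     (\<forall>K. subgroup K G \<longrightarrow> M \<subseteq> K \<longrightarrow> K = M \<or> K = carrier G)"

context group
begin

lemma proper_subgroup_in_maximal:
  assumes "finite (carrier G)" "subgroup H G" "H \<noteq> carrier G"
  obtains M where "maximal_subgroup G M" "H \<subseteq> M"
proof -
  define S where "S = {K. subgroup K G \<and> K \<noteq> carrier G \<and> H \<subseteq> K}"
  have "S \<subseteq> Pow (carrier G)" unfolding S_def using subgroup.subset by blast
  then have fin: "finite S" using assms(1) finite_subset by blast
  moreover have "H \<in> S" unfolding S_def using assms by blast
  ultimately obtain M where M: "M \<in> S" "\<And>K. K \<in> S \<Longrightarrow> M \<subseteq> K \<Longrightarrow> M = K"
    using finite_has_maximal [of S] by (metis empty_iff)
  have "maximal_subgroup G M" unfolding maximal_subgroup_def using M unfolding S_def by blast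
  then show ?thesis using that M unfolding S_def by blast
qed

lemma subgroup_conjugate_image:
  assumes "subgroup H G" "x \<in> carrier G"
  shows "subgroup (conjugate_by G x ` H) G"
proof -
  interpret h: group_hom G G "conjugate_by G x"
    using assms conjugate_by_hom by unfold_locales auto
  show ?thesis using assms(1) by (rule h.subgroup_img_is_subgroup)
qed

lemma conjugate_image_cancel:
  assumes "H \<subseteq> carrier G" "x \<in> carrier G"
  shows "conjugate_by G (inv x) ` (conjugate_by G x ` H) = H"
    and "conjugate_by G x ` (conjugate_by G (inv x) ` H) = H"
  using assms conjugate_by_inv_cancel by (force simp: image_image subset_iff)+

lemma conjugate_by_inj_on:
  "x \<in> carrier G \<Longrightarrow> inj_on (conjugate_by G x) (carrier G)"
  by (intro inj_on_inverseI [of _ "conjugate_by G (inv x)"]) (simp add: conjugate_by_inv_cancel)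

lemma maximal_subgroup_conjugate:
  assumes M: "maximal_subgroup G M" and x: "x \<in> carrier G"
  shows "maximal_subgroup G (conjugate_by G x ` M)"
  unfolding maximal_subgroup_def
proof (intro conjI allI impI)
  have Ms: "subgroup M G" and Mc: "M \<subseteq> carrier G" and Mn: "M \<noteq> carrier G"
    using M subgroup.subset unfolding maximal_subgroup_def by blast+
  have img: "conjugate_by G y ` carrier G = carrier G" if y: "y \<in> carrier G" for y
  proof -
    have "conjugate_by G y z \<in> carrier G" if "z \<in> carrier G" for z using that y by simp
    moreover have "z \<in> conjugate_by G y ` carrier G" if "z \<in> carrier G" for z
      using that y conjugate_by_inv_cancel(2) [of y z] by (metis conjugate_by_closed image_eqI inv_closed)
    ultimately show ?thesis by blast
  qed
  show "subgroup (conjugate_by G x ` M) G" using subgroup_conjugate_image Ms x by blast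
  show "conjugate_by G x ` M \<noteq> carrier G"
    using conjugate_image_cancel(1) [OF Mc x] img [of "inv x"] Mn x by (metis inv_closed)
  fix K assume K: "subgroup K G" "conjugate_by G x ` M \<subseteq> K"
  have Kc: "K \<subseteq> carrier G" using K subgroup.subset by blast
  have "M \<subseteq> conjugate_by G (inv x) ` K"
    using image_mono [OF K(2), of "conjugate_by G (inv x)"] conjugate_image_cancel(1) [OF Mc x] by simp
  then have "conjugate_by G (inv x) ` K = M \<or> conjugate_by G (inv x) ` K = carrier G"
    using M subgroup_conjugate_image [OF K(1), of "inv x"] x unfolding maximal_subgroup_def by simp
  then show "K = conjugate_by G x ` M \<or> K = carrier G"
    using conjugate_image_cancel(2) [OF Kc x] img [OF x] by metis
qed

text \<open>In a counterexample, distinct maximal subgroups intersect in the centre, and the conjugates of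
  one maximal subgroup cover at least half of \<open>G\<close>, but not all noncentral elements. A second
  conjugacy class of maximal subgroups then leaves no room for the centre.\<close>

lemma central_normal_subgroups_imp_abelian:
  assumes fin: "finite (carrier G)"
    and normal_central: "\<And>D. D \<lhd> G \<Longrightarrow> D \<noteq> carrier G \<Longrightarrow> D \<subseteq> group_center G"
    and proper_cc: "\<And>H. subgroup H G \<Longrightarrow> H \<noteq> carrier G \<Longrightarrow> coprime_commuting (G\<lparr>carrier := H\<rparr>)"
  shows "group_center G = carrier G"
proof (rule ccontr)
  assume nonab: "group_center G \<noteq> carrier G"
  let ?Z = "group_center G"
  have Zc: "?Z \<subseteq> carrier G" using group_center_subgroup subgroup.subset by blast
  have Zcom: "z \<otimes> g = g \<otimes> z" if "z \<in> ?Z" "g \<in> carrier G" for z g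
    using group_centerD(2) [OF that] .
  have full_centralizer: "x \<in> ?Z" if x: "x \<in> carrier G" "centralizer_of x = carrier G" for x
  proof (rule group_centerI [OF x(1)])
    fix g assume "g \<in> carrier G"
    then have "g \<in> centralizer_of x" using x by simp
    then show "x \<otimes> g = g \<otimes> x" unfolding centralizer_of_def by simp
  qed
  have mxD: "subgroup M G" "M \<subseteq> carrier G" "M \<noteq> carrier G"
      "\<And>K. subgroup K G \<Longrightarrow> M \<subseteq> K \<Longrightarrow> K = M \<or> K = carrier G"
    if "maximal_subgroup G M" for M
    using that subgroup.subset unfolding maximal_subgroup_def by blast+
  \<comment> \<open>A normal \<open>M\<close> would be central. For \<open>x\<close> outside
    \<open>M\<close>, the centralizer of \<open>x\<close> would contain \<open>M\<close> and
    \<open>x\<close>, so it would be \<open>G\<close>, and every element would be central.\<close>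
  have not_normal: "\<not> M \<lhd> G" if M: "maximal_subgroup G M" for M
  proof
    assume "M \<lhd> G"
    then have MZ: "M \<subseteq> ?Z" using normal_central mxD(3) [OF M] by blast
    have "x \<in> ?Z" if x: "x \<in> carrier G" for x
    proof (cases "x \<in> M")
      case False
      have "M \<subseteq> centralizer_of x"
        unfolding centralizer_of_def using MZ Zc Zcom x by blast
      moreover have "x \<in> centralizer_of x" unfolding centralizer_of_def using x by simp
      ultimately have "centralizer_of x = carrier G"
        using mxD(4) [OF M centralizer_of_subgroup [OF x]] False by blast
      then show ?thesis using full_centralizer x by blast
    qed (use MZ in blast)
    then show False using nonab Zc by blast
  qed
  have subgroup_in_normalizer: "H \<subseteq> normalizer G H" if H: "subgroup H G" for H
  proof
    fix h assume h: "h \<in> H"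
    have "H \<subseteq> carrier G" using H subgroup.subset by blast
    then show "h \<in> normalizer G H"
      using h H by (intro normalizer_memI [OF fin H]) (auto simp: conjugate_by_def
            intro!: subgroup.m_closed subgroup.m_inv_closed)
  qed
  have self_normalizing: "normalizer G M = M" if M: "maximal_subgroup G M" for M
  proof -
    have "normalizer G M \<noteq> carrier G"
      using normalizer_eq_carrier_imp_normal [OF mxD(1) [OF M]] not_normal [OF M] by blast
    then show ?thesis
      using mxD(4) [OF M normalizer_imp_subgroup [OF mxD(2) [OF M]]]
        subgroup_in_normalizer [OF mxD(1) [OF M]] by blast
  qed
  have Z_le: "?Z \<subseteq> M" if M: "maximal_subgroup G M" for M
  proof
    fix z assume z: "z \<in> ?Z"
    have zG: "z \<in> carrier G" using z Zc by blast
    have "z \<in> normalizer G M"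
    proof (rule normalizer_memI [OF fin mxD(1) [OF M] zG])
      fix h assume h: "h \<in> M"
      then have hG: "h \<in> carrier G" using mxD(2) [OF M] by blast
      have "conjugate_by G z h = h" using conjugate_by_eq_iff [OF zG hG hG] Zcom [OF z hG] by simp
      then show "conjugate_by G z h \<in> M" using h by simp
    qed
    then show "z \<in> M" using self_normalizing M by blast
  qed
  \<comment> \<open>Take \<open>D\<close> maximal among the noncentral intersections. Its normalizer
    is proper, so it lies in a maximal \<open>L\<close>. In a maximal \<open>N\<close> strictly
    above \<open>D\<close> the normalizer of \<open>D\<close> grows, so if \<open>N\<close> differed
    from \<open>L\<close>, then \<open>N \<inter> L\<close> would be a larger such intersection.
    Hence both members of the pair equal \<open>L\<close>.\<close>
  have inter: "M1 \<inter> M2 \<subseteq> ?Z" if M: "maximal_subgroup G M1" "maximal_subgroup G M2" "M1 \<noteq> M2" for M1 M2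
  proof (rule ccontr)
    assume "\<not> M1 \<inter> M2 \<subseteq> ?Z"
    define S where "S = {D. \<exists>M1 M2. maximal_subgroup G M1 \<and> maximal_subgroup G M2 \<and> M1 \<noteq> M2 \<and>
      D = M1 \<inter> M2 \<and> \<not> D \<subseteq> ?Z}"
    have "S \<subseteq> Pow (carrier G)" unfolding S_def using mxD(2) by blast
    then have "finite S" using fin finite_subset by blast
    moreover have "M1 \<inter> M2 \<in> S" unfolding S_def using M \<open>\<not> M1 \<inter> M2 \<subseteq> ?Z\<close> by blast
    ultimately obtain D where DS: "D \<in> S" and Dmax: "\<And>K. K \<in> S \<Longrightarrow> D \<subseteq> K \<Longrightarrow> D = K"
      using finite_has_maximal [of S] by (metis empty_iff)
    then obtain N1 N2 where N: "maximal_subgroup G N1" "maximal_subgroup G N2" "N1 \<noteq> N2"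
      "D = N1 \<inter> N2" "\<not> D \<subseteq> ?Z" unfolding S_def by blast
    have Ds: "subgroup D G" using N mxD(1) subgroups_Inter_pair by blast
    have Dc: "D \<subseteq> carrier G" using Ds subgroup.subset by blast
    have Dne: "D \<noteq> carrier G" using N mxD by blast
    have "normalizer G D \<noteq> carrier G"
      using normalizer_eq_carrier_imp_normal [OF Ds] normal_central Dne N(5) by blast
    then obtain L where L: "maximal_subgroup G L" "normalizer G D \<subseteq> L"
      using proper_subgroup_in_maximal [OF fin normalizer_imp_subgroup [OF Dc]] by blast
    have eq: "N = L" if N: "maximal_subgroup G N" "D \<subseteq> N" "D \<noteq> N" for N
    proof (rule ccontr)
      assume "N \<noteq> L"
      have Ns: "subgroup N G" using mxD(1) N by blast
      interpret NG: group "G\<lparr>carrier := N\<rparr>" using Ns subgroup_imp_group by blast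
      have DN: "subgroup D (G\<lparr>carrier := N\<rparr>)" using Ds Ns N subgroup_incl by blast
      have "finite N" using mxD(2) N fin finite_subset by blast
      then obtain g where g: "g \<in> N" "g \<notin> D" "g \<in> normalizer (G\<lparr>carrier := N\<rparr>) D"
        using NG.coprime_commuting_normalizer_grows [OF _ _ DN] proper_cc Ns mxD(3) N by auto
      have gG: "g \<in> carrier G" using g mxD(2) N by blast
      have "g \<in> normalizer G D"
        using NG.normalizer_memD(1) [OF DN g(3)] conjugate_by_carrier_update [OF Ns g(1)] gG
        by (intro normalizer_memI [OF fin Ds]) auto
      then have "g \<in> N \<inter> L" using g L by blast
      moreover have DL: "D \<subseteq> N \<inter> L" using subgroup_in_normalizer Ds L N by blast
      moreover have "N \<inter> L \<in> S" unfolding S_def using N(1) L(1) \<open>N \<noteq> L\<close> DL \<open>\<not> D \<subseteq> ?Z\<close> by blast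
      ultimately show False using Dmax g by blast
    qed
    have "D \<noteq> N1" "D \<noteq> N2"
      using N mxD(3) mxD(4) [OF N(1) mxD(1) [OF N(2)]] mxD(4) [OF N(2) mxD(1) [OF N(1)]] by blast+
    then have "N1 = L" "N2 = L" using eq N by blast+
    then show False using N by blast
  qed
  let ?\<phi> = "\<lambda>g. \<lambda>H \<in> {H. H \<subseteq> carrier G}. g <# H #> (inv g)"
  interpret A: group_action G "{H. H \<subseteq> carrier G}" ?\<phi>
    by (rule action_by_conjugation_on_power_set)
  define orb where "orb M = orbit G ?\<phi> M" for M
  define U where "U M = (\<Union>K \<in> orb M. K - ?Z)" for M
  have orb_mem: "\<exists>x \<in> carrier G. K = conjugate_by G x ` M"
    if M: "maximal_subgroup G M" and K: "K \<in> orb M" for K M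
  proof -
    obtain g where g: "g \<in> carrier G" "K = g <# M #> (inv g)"
      using K mxD(2) [OF M] unfolding orb_def orbit_def by auto
    have "K = conjugate_by G (inv g) ` M"
      using g by (auto simp: l_coset_def r_coset_def conjugate_by_def)
    then show ?thesis using g by blast
  qed
  have orb_max: "maximal_subgroup G K" if "maximal_subgroup G M" "K \<in> orb M" for K M
    using orb_mem [OF that] maximal_subgroup_conjugate [OF that(1)] by blast
  have orb_card: "card K = card M" if "maximal_subgroup G M" "K \<in> orb M" for K M
    using orb_mem [OF that] conjugate_by_inj_on mxD(2) [OF that(1)] card_image inj_on_subset by metis
  have orb_fin: "finite (orb M)" for M unfolding orb_def orbit_def using fin by simp
  have finK: "finite K" if "maximal_subgroup G K" for K using mxD(2) [OF that] fin finite_subset by blast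
  have finZ: "finite ?Z" using Zc fin finite_subset by blast
  have Zpos: "card ?Z > 0" using subgroup.finite_imp_card_positive [OF group_center_subgroup fin] .
  have orb_self: "M \<in> orb M" if "maximal_subgroup G M" for M
    unfolding orb_def using A.orbit_refl mxD(2) [OF that] by blast
  \<comment> \<open>As \<open>M\<close> is self-normalizing, the number of its conjugates is its
    index. They are disjoint outside the centre, which is a proper subgroup of \<open>M\<close> and
    so has at most half its order.\<close>
  have count: "order G = card (orb M) * card M" "card (U M) = card (orb M) * (card M - card ?Z)"
      "2 * card ?Z \<le> card M" "1 < card (orb M)" if M: "maximal_subgroup G M" for M
  proof -
    have "card (orb M) * card (normalizer G M) = order G"
      using A.orbit_stabilizer_theorem [of M] mxD(2) [OF M] unfolding orb_def normalizer_def by simp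
    then show o: "order G = card (orb M) * card M" using self_normalizing [OF M] by simp
    have "card (U M) = (\<Sum>K \<in> orb M. card (K - ?Z))"
      unfolding U_def
    proof (rule card_UN_disjoint [OF orb_fin])
      show "\<forall>K \<in> orb M. finite (K - ?Z)" using finK orb_max [OF M] by blast
      show "\<forall>K \<in> orb M. \<forall>L \<in> orb M. K \<noteq> L \<longrightarrow> (K - ?Z) \<inter> (L - ?Z) = {}"
        using inter orb_max [OF M] by blast
    qed
    also have "\<dots> = (\<Sum>K \<in> orb M. card M - card ?Z)"
    proof (rule sum.cong [OF refl])
      fix K assume K: "K \<in> orb M"
      then show "card (K - ?Z) = card M - card ?Z"
        using card_Diff_subset [OF finZ Z_le [OF orb_max [OF M K]]] orb_card [OF M K] by simp
    qed
    finally show "card (U M) = card (orb M) * (card M - card ?Z)" by simp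
    have "card ?Z dvd card M"
      using card_subgroup_dvd [OF group_center_subgroup mxD(1) [OF M] Z_le [OF M]] .
    moreover have "card ?Z \<noteq> card M"
      using card_subset_eq [OF finK [OF M] Z_le [OF M]] not_normal [OF M] group_center_normal by metis
    moreover have "card M > 0" using subgroup.finite_imp_card_positive [OF mxD(1) [OF M] fin] .
    ultimately obtain k where k: "card M = card ?Z * k" "k \<noteq> 0" "k \<noteq> 1" by (metis dvdE mult_0_right
      mult.right_neutral neq0_conv)
    then have "2 \<le> k" by linarith
    then show "2 * card ?Z \<le> card M" using k by (metis mult.commute mult_le_mono2)
    have "card M < order G" unfolding order_def using mxD(2,3) [OF M] fin by (simp add: psubset_card_mono psubset_eq)
    then show "1 < card (orb M)" using o by (metis less_one linorder_neqE_nat mult_1 mult_0 not_less_zero less_irrefl)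
  qed
  have big: "order G \<le> 2 * card (U M)" if M: "maximal_subgroup G M" for M
  proof -
    have "card M \<le> 2 * (card M - card ?Z)" using count(3) [OF M] by linarith
    then have "card (orb M) * card M \<le> card (orb M) * (2 * (card M - card ?Z))" by (rule mult_le_mono2)
    then show ?thesis using count(1,2) [OF M] by simp
  qed
  have Usub: "U M \<subseteq> carrier G - ?Z" if M: "maximal_subgroup G M" for M
    unfolding U_def using mxD(2) orb_max [OF M] by blast
  have generated_proper: "\<exists>M. maximal_subgroup G M \<and> y \<in> M" if y: "y \<in> carrier G" "y \<notin> ?Z" for y
  proof -
    have "y \<in> centralizer_of y" unfolding centralizer_of_def using y by simp
    moreover have "centralizer_of y \<noteq> carrier G" using full_centralizer y by blast
    then obtain M where "maximal_subgroup G M" "centralizer_of y \<subseteq> M"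
      by (rule proper_subgroup_in_maximal [OF fin centralizer_of_subgroup [OF y(1)]])
    ultimately show ?thesis by blast
  qed
  obtain x where "x \<in> carrier G" "x \<notin> ?Z" using nonab Zc by blast
  then obtain M where M: "maximal_subgroup G M" using generated_proper by blast
  \<comment> \<open>With \<open>n > 1\<close> conjugates the union has
    \<open>order G - n * card ?Z\<close> elements, fewer than the \<open>order G - card ?Z\<close>
    noncentral ones. So some noncentral \<open>y\<close> is missed.\<close>
  have "card (U M) < card (carrier G - ?Z)"
  proof -
    have "card (orb M) * card ?Z > card ?Z" using count(4) [OF M] Zpos by simp
    moreover have "card (U M) + card (orb M) * card ?Z = order G"
      using count(1,2,3) [OF M] by (simp add: algebra_simps diff_mult_distrib2)
    moreover have "card (carrier G - ?Z) + card ?Z = order G"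
      using card_Diff_subset [OF finZ Zc] card_mono [OF fin Zc] unfolding order_def by simp
    ultimately show ?thesis by linarith
  qed
  then obtain y where y: "y \<in> carrier G" "y \<notin> ?Z" "y \<notin> U M"
    using card_mono [of "U M" "carrier G - ?Z"] finite_subset [OF Usub [OF M]] fin
    by (metis DiffE finite_Diff leD subsetI)
  then obtain L where L: "maximal_subgroup G L" "y \<in> L" using generated_proper by blast
  have "L \<notin> orb M" using L y unfolding U_def by blast
  then have "orb L \<noteq> orb M" using orb_self [OF L(1)] by blast
  moreover have "orb L \<in> orbits G {H. H \<subseteq> carrier G} ?\<phi>" "orb M \<in> orbits G {H. H \<subseteq> carrier G} ?\<phi>"
    unfolding orb_def orbits_def using mxD(2) M L(1) by blast+
  ultimately have disj: "orb L \<inter> orb M = {}" using A.disjoint_union by blast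
  have "U L \<inter> U M = {}"
  proof (rule ccontr)
    assume "U L \<inter> U M \<noteq> {}"
    then obtain w K K' where "w \<notin> ?Z" "w \<in> K" "w \<in> K'" "K \<in> orb L" "K' \<in> orb M"
      unfolding U_def by blast
    then show False using inter orb_max [OF L(1)] orb_max [OF M] disj by blast
  qed
  then have "card (U L \<union> U M) = card (U L) + card (U M)"
    using Usub [OF L(1)] Usub [OF M] fin by (intro card_Un_disjoint) (auto intro: finite_subset)
  moreover have "card (U L \<union> U M) \<le> card (carrier G - ?Z)"
    using Usub [OF L(1)] Usub [OF M] fin by (intro card_mono) auto
  moreover have "card (carrier G - ?Z) + card ?Z = order G"
    using card_Diff_subset [OF finZ Zc] card_mono [OF fin Zc] unfolding order_def by simp
  ultimately show False using big [OF L(1)] big [OF M] Zpos by linarith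
qed

end

text \<open>For a prime \<open>p\<close> and finite \<open>G\<close> this is O^p(G), given by its
  generators, the elements of order prime to \<open>p\<close>.\<close>

definition p_residual :: "('a, 'b) monoid_scheme \<Rightarrow> nat \<Rightarrow> 'a set" where
  "p_residual G p = generate G {x \<in> carrier G. \<exists>a::nat. coprime p a \<and> x [^]\<^bsub>G\<^esub> a = \<one>\<^bsub>G\<^esub>}"

text \<open>Hypercentre and supplements refer to the whole group. These two consequences of the
  hypotheses speak of elements only and pass to subgroups, which is what an induction on the order
  requires.\<close>

definition small_elements_condition :: "('a, 'b) monoid_scheme \<Rightarrow> bool" where
  "small_elements_condition G \<longleftrightarrow>
     (\<forall>z \<in> carrier G. \<forall>x \<in> carrier G. \<forall>(p::nat) (b::nat). Factorial_Ring.prime p \<longrightarrow>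
        z [^]\<^bsub>G\<^esub> p = \<one>\<^bsub>G\<^esub> \<longrightarrow> x [^]\<^bsub>G\<^esub> b = \<one>\<^bsub>G\<^esub> \<longrightarrow> coprime p b \<longrightarrow> z \<otimes>\<^bsub>G\<^esub> x = x \<otimes>\<^bsub>G\<^esub> z) \<and>
     (\<forall>a \<in> carrier G. a [^]\<^bsub>G\<^esub> (4::nat) = \<one>\<^bsub>G\<^esub> \<longrightarrow> a [^]\<^bsub>G\<^esub> (2::nat) \<noteq> \<one>\<^bsub>G\<^esub> \<longrightarrow> rigid_element G a)"

lemma small_elements_conditionD:
  assumes "small_elements_condition G"
  shows "\<lbrakk>z \<in> carrier G; x \<in> carrier G; Factorial_Ring.prime (p::nat);
      z [^]\<^bsub>G\<^esub> p = \<one>\<^bsub>G\<^esub>; x [^]\<^bsub>G\<^esub> (b::nat) = \<one>\<^bsub>G\<^esub>; coprime p b\<rbrakk> \<Longrightarrow> z \<otimes>\<^bsub>G\<^esub> x = x \<otimes>\<^bsub>G\<^esub> z"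
    and "\<lbrakk>a \<in> carrier G; a [^]\<^bsub>G\<^esub> (4::nat) = \<one>\<^bsub>G\<^esub>; a [^]\<^bsub>G\<^esub> (2::nat) \<noteq> \<one>\<^bsub>G\<^esub>\<rbrakk> \<Longrightarrow> rigid_element G a"
  using assms unfolding small_elements_condition_def by blast+

lemma small_elements_condition_subset:
  assumes "small_elements_condition G" "H \<subseteq> carrier G"
  shows "small_elements_condition (G\<lparr>carrier := H\<rparr>)"
proof -
  have "rigid_element (G\<lparr>carrier := H\<rparr>) a"
    if a: "a \<in> H" "a [^]\<^bsub>G\<^esub> (4::nat) = \<one>\<^bsub>G\<^esub>" "a [^]\<^bsub>G\<^esub> (2::nat) \<noteq> \<one>\<^bsub>G\<^esub>" for a
  proof -
    have "rigid_element G a" using small_elements_conditionD(2) [OF assms(1)] a assms(2) by blast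
    then show ?thesis unfolding rigid_element_def using assms(2) by (simp add: subset_iff) blast
  qed
  moreover have "z \<otimes>\<^bsub>G\<^esub> x = x \<otimes>\<^bsub>G\<^esub> z" if "z \<in> H" "x \<in> H" "Factorial_Ring.prime (p::nat)"
      "z [^]\<^bsub>G\<^esub> p = \<one>\<^bsub>G\<^esub>" "x [^]\<^bsub>G\<^esub> (b::nat) = \<one>\<^bsub>G\<^esub>" "coprime p b" for z x p b
    using small_elements_conditionD(1) [OF assms(1), of z x p b] that assms(2) by blast
  ultimately show ?thesis unfolding small_elements_condition_def by simp blast
qed

context group
begin

text \<open>The \<open>p\<close>-part of \<open>y\<close> lies in the normal
  \<open>p\<close>-subgroup of all \<open>p\<close>-elements of \<open>N\<close>. If
  \<open>p\<close> does not divide \<open>a\<close>, the automorphism argument applies there; if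
  \<open>p\<close> divides \<open>a\<close>, it does not divide \<open>b\<close>, and the part is
  trivial.\<close>

lemma normal_coprime_commuting_centralized:
  fixes a b :: nat
  assumes fin: "finite (carrier G)" and sec: "small_elements_condition G"
    and N: "N \<lhd> G" "coprime_commuting (G\<lparr>carrier := N\<rparr>)"
    and y: "y \<in> N" "y [^] b = \<one>" and x: "x \<in> carrier G" "x [^] a = \<one>" and cop: "coprime a b"
  shows "y \<otimes> x = x \<otimes> y"
proof (cases "b = 0")
  case True
  then have "x = \<one>" using cop x by simp
  moreover have "y \<in> carrier G" using y N normal_imp_subgroup subgroup.mem_carrier by metis
  ultimately show ?thesis by simp
next
  case False
  have Ns: "subgroup N G" using N normal_imp_subgroup by blast
  have Nc: "N \<subseteq> carrier G" using Ns subgroup.subset by blast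
  have yG: "y \<in> carrier G" using y Nc by blast
  have "y \<in> centralizer_of x"
  proof (rule prime_power_parts_in_subgroup [OF centralizer_of_subgroup [OF x(1)] yG y(2)])
    fix p e k :: nat
    assume p: "Factorial_Ring.prime p" and pe: "(y [^] k) [^] (p ^ e) = \<one>"
    have ykN: "y [^] k \<in> N" using subgroup_nat_pow_closed [OF Ns y(1)] .
    have ykG: "y [^] k \<in> carrier G" using yG by simp
    have "y [^] k \<otimes> x = x \<otimes> y [^] k"
    proof (cases "coprime p a")
      case True
      show ?thesis
      proof (rule normal_p_subgroup_coprime_centralized [OF fin p_elements_normal(1) [OF fin N p] p
            p_elements_normal(2) [OF fin N p] _ _ x True])
        show "y [^] k \<in> p_elements (G\<lparr>carrier := N\<rparr>) p"
          using ykN pe by (auto simp: p_elements_def)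
      next
        fix z w b assume "z \<in> p_elements (G\<lparr>carrier := N\<rparr>) p" "z [^] p = \<one>" "w \<in> carrier G"
          "w [^] (b::nat) = \<one>" "coprime p b"
        then show "z \<otimes> w = w \<otimes> z"
          using Nc small_elements_conditionD(1) [OF sec _ _ p] by (auto simp: p_elements_def)
      next
        fix z assume "z \<in> p_elements (G\<lparr>carrier := N\<rparr>) p" "z [^] (4::nat) = \<one>" "z [^] (2::nat) \<noteq> \<one>"
        then show "rigid_element G z"
          using Nc small_elements_conditionD(2) [OF sec] by (auto simp: p_elements_def)
      qed
    next
      case False
      then have "p dvd a" using p prime_imp_coprime by blast
      then have "coprime p b" using coprime_divisors [OF _ dvd_refl cop] by simp
      then have "coprime (p ^ e) b" by simp
      moreover have "(y [^] k) [^] b = \<one>"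
        using y yG by (metis nat_pow_pow mult.commute nat_pow_one)
      ultimately have "y [^] k = \<one>" using pow_coprime_one [OF ykG pe] by blast
      then show ?thesis using x by simp
    qed
    then show "y [^] k \<in> centralizer_of x" using ykG unfolding centralizer_of_def by simp
  qed (use False in auto)
  then show ?thesis unfolding centralizer_of_def by simp
qed

lemma p_residual_normal:
  "p_residual G p \<lhd> G"
  unfolding p_residual_def
proof (rule normal_generateI)
  let ?X = "{x \<in> carrier G. \<exists>a. coprime p a \<and> x [^] (a::nat) = \<one>}"
  fix h g assume h: "h \<in> ?X" and g: "g \<in> carrier G"
  then obtain a :: nat where a: "h \<in> carrier G" "coprime p a" "h [^] a = \<one>" by blast
  have "conjugate_by G (inv g) h [^] a = conjugate_by G (inv g) (h [^] a)"
    using a g conjugate_by_pow by simp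
  also have "\<dots> = \<one>" using a g by (simp add: conjugate_by_def)
  finally have "(g \<otimes> h \<otimes> inv g) [^] a = \<one>" using g by (simp add: conjugate_by_def)
  then show "g \<otimes> h \<otimes> inv g \<in> ?X" using a g by auto
qed blast

lemma p_residual_incl:
  "\<lbrakk>x \<in> carrier G; x [^] (a::nat) = \<one>; coprime p a\<rbrakk> \<Longrightarrow> x \<in> p_residual G p"
  unfolding p_residual_def by (intro generate.incl) blast

lemma p_residual_subset:
  assumes "subgroup H G"
    and "\<And>x a. \<lbrakk>x \<in> carrier G; x [^] (a::nat) = \<one>; coprime p a\<rbrakk> \<Longrightarrow> x \<in> H"
  shows "p_residual G p \<subseteq> H"
  unfolding p_residual_def using assms by (intro generate_subgroup_incl) blast

text \<open>If O^p(G) is proper for some prime \<open>p\<close>, it contains one member of every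
  coprime pair, and being normal with commuting coprime elements it makes the pair commute.
  Otherwise, for every \<open>p\<close>, the elements of order prime to \<open>p\<close> generate
  \<open>G\<close>; they centralize the \<open>p\<close>-parts of any proper normal subgroup, which
  is therefore central, and the counting argument applies.\<close>

lemma small_elements_imp_coprime_commuting_step:
  assumes fin: "finite (carrier G)" and sec: "small_elements_condition G"
    and proper_cc: "\<And>H. subgroup H G \<Longrightarrow> H \<noteq> carrier G \<Longrightarrow> coprime_commuting (G\<lparr>carrier := H\<rparr>)"
  shows "coprime_commuting G"
proof (rule ccontr)
  assume not: "\<not> coprime_commuting G"
  have residual: "p_residual G p = carrier G" if p: "Factorial_Ring.prime p" for p
  proof (rule ccontr)
    let ?O = "p_residual G p"
    assume ne: "?O \<noteq> carrier G"
    note O = p_residual_normal [of p]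
    have cc: "coprime_commuting (G\<lparr>carrier := ?O\<rparr>)"
      using proper_cc O normal_imp_subgroup ne by blast
    have "x \<otimes> y = y \<otimes> x"
      if xy: "x \<in> carrier G" "y \<in> carrier G" "coprime a b" "x [^] (a::nat) = \<one>" "y [^] (b::nat) = \<one>"
      for x y a b
    proof -
      have "coprime p a \<or> coprime p b"
        using xy(3) p by (metis coprime_common_divisor not_prime_unit prime_imp_coprime)
      then show ?thesis
      proof
        assume "coprime p a"
        then have "x \<in> ?O" using xy p_residual_incl by blast
        then show ?thesis
          using normal_coprime_commuting_centralized [OF fin sec O cc _ xy(4) xy(2,5)] xy(3)
          by (simp add: coprime_commute)
      next
        assume "coprime p b"
        then have "y \<in> ?O" using xy p_residual_incl by blast
        then show ?thesis
          using normal_coprime_commuting_centralized [OF fin sec O cc _ xy(5) xy(1,4)] xy(3) by simp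
      qed
    qed
    then show False using not unfolding coprime_commuting_def by blast
  qed
  have "group_center G = carrier G"
  proof (rule central_normal_subgroups_imp_abelian [OF fin _ proper_cc])
    fix D assume D: "D \<lhd> G" "D \<noteq> carrier G"
    have Ds: "subgroup D G" using D normal_imp_subgroup by blast
    have Dc: "D \<subseteq> carrier G" using Ds subgroup.subset by blast
    show "D \<subseteq> group_center G"
    proof
      fix y assume y: "y \<in> D"
      then have yG: "y \<in> carrier G" using Dc by blast
      show "y \<in> group_center G"
      proof (rule prime_power_parts_in_subgroup [OF group_center_subgroup yG pow_order_eq_1 [OF yG]])
        fix p e k :: nat
        assume p: "Factorial_Ring.prime p" and pe: "(y [^] k) [^] (p ^ e) = \<one>"
        have ykD: "y [^] k \<in> D" using subgroup_nat_pow_closed [OF Ds y] .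
        have ykG: "y [^] k \<in> carrier G" using yG by simp
        have "p_residual G p \<subseteq> centralizer_of (y [^] k)"
        proof (rule p_residual_subset [OF centralizer_of_subgroup [OF ykG]])
          fix x and a :: nat assume a: "x \<in> carrier G" "x [^] a = \<one>" "coprime p a"
          have "coprime a (p ^ e)" using a by (simp add: coprime_commute)
          then have "y [^] k \<otimes> x = x \<otimes> y [^] k"
            using normal_coprime_commuting_centralized [OF fin sec D(1) proper_cc [OF Ds D(2)] ykD pe a(1,2)]
            by blast
          then show "x \<in> centralizer_of (y [^] k)" unfolding centralizer_of_def using a by simp
        qed
        then have "carrier G \<subseteq> centralizer_of (y [^] k)" using residual [OF p] by simp
        then show "y [^] k \<in> group_center G"
          unfolding centralizer_of_def by (intro group_centerI [OF ykG]) auto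
      qed (use fin order_gt_0_iff_finite in auto)
    qed
  qed
  then have "coprime_commuting G"
    unfolding coprime_commuting_def using group_centerD(2) by (metis (no_types))
  then show False using not by blast
qed

end

lemma small_elements_imp_coprime_commuting:
  fixes G :: "('a, 'c) monoid_scheme"
  assumes "group G" "finite (carrier G)" "small_elements_condition G"
  shows "coprime_commuting G"
  using assms
proof (induction "card (carrier G)" arbitrary: G rule: less_induct)
  case less
  interpret group G by fact
  show ?case
  proof (rule small_elements_imp_coprime_commuting_step [OF less.prems(2,3)])
    fix H assume H: "subgroup H G" "H \<noteq> carrier G"
    have sub: "H \<subseteq> carrier G" using H subgroup.subset by blast
    show "coprime_commuting (G\<lparr>carrier := H\<rparr>)"
    proof (rule less.hyps)
      show "card (carrier (G\<lparr>carrier := H\<rparr>)) < card (carrier G)"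
        using sub H less.prems(2) by (simp add: psubset_card_mono psubset_eq)
      show "group (G\<lparr>carrier := H\<rparr>)" using H subgroup_imp_group by blast
      show "finite (carrier (G\<lparr>carrier := H\<rparr>))" using sub less.prems(2) finite_subset by auto
      show "small_elements_condition (G\<lparr>carrier := H\<rparr>)"
        using small_elements_condition_subset [OF less.prems(3) sub] .
    qed
  qed
qed

section \<open>The p-cores\<close>

text \<open>With a union, both the maximality of O_p(G) and its being a \<open>p\<close>-group are
  immediate; closure under products is what has to be shown.\<close>

definition p_core :: "('a, 'b) monoid_scheme \<Rightarrow> nat \<Rightarrow> 'a set" where
  "p_core G p = \<Union>{P. P \<lhd> G \<and> p_group (G\<lparr>carrier := P\<rparr>) p}"

context group
begin

text \<open>Modulo \<open>N\<close> the elements \<open>x \<otimes> n\<close> and \<open>x\<close>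
  agree, so a \<open>p\<close>-power of the product lies in the \<open>p\<close>-group
  \<open>N\<close>.\<close>

lemma p_element_mult_normal:
  assumes N: "N \<lhd> G" "p_group (G\<lparr>carrier := N\<rparr>) p"
    and x: "x \<in> carrier G" "x [^] (p ^ e) = \<one>" and n: "n \<in> N"
  obtains f where "(x \<otimes> n) [^] (p ^ f) = \<one>"
proof -
  interpret N: normal N G by fact
  interpret Q: group "G Mod N" by (rule N.factorgroup_is_group)
  have nG: "n \<in> carrier G" using n N.subset by blast
  have "x \<otimes> n = (x \<otimes> n \<otimes> inv x) \<otimes> x" using x nG by (simp add: m_assoc)
  then have "N #> (x \<otimes> n) = N #> x"
    using N.inv_op_closed2 [OF x(1) n] x nG
    by (metis N.rcos_eq_iff N.subset coset_mult_assoc inv_closed m_closed)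
  then have "N #> ((x \<otimes> n) [^] (p ^ e)) = N #> (x [^] (p ^ e))"
    using x nG by (metis N.FactGroup_pow m_closed)
  then have xn: "(x \<otimes> n) [^] (p ^ e) \<in> N"
    using x nG N.rcos_eq_iff N.subset by (simp add: coset_mult_one)
  then obtain d where "((x \<otimes> n) [^] (p ^ e)) [^] (p ^ d) = \<one>"
    using N(2) by (auto simp: p_group_def)
  then have "(x \<otimes> n) [^] (p ^ (e + d)) = \<one>" using x nG by (simp add: nat_pow_pow power_add)
  then show ?thesis by (rule that)
qed

lemma p_core_upper: "P \<lhd> G \<Longrightarrow> p_group (G\<lparr>carrier := P\<rparr>) p \<Longrightarrow> P \<subseteq> p_core G p"
  unfolding p_core_def by blast

lemma p_core_p_group: "p_group (G\<lparr>carrier := p_core G p\<rparr>) p"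
  unfolding p_core_def p_group_def by auto

lemma p_core_subgroup: "subgroup (p_core G p) G"
proof (rule subgroupI)
  show "p_core G p \<subseteq> carrier G"
    unfolding p_core_def using normal_imp_subgroup subgroup.subset by blast
  have "p_group (G\<lparr>carrier := {\<one>}\<rparr>) p" by (auto simp: p_group_def)
  then have "{\<one>} \<subseteq> p_core G p" using p_core_upper one_is_normal by blast
  then show "p_core G p \<noteq> {}" by blast
  fix a assume "a \<in> p_core G p"
  then obtain P where P: "P \<lhd> G" "p_group (G\<lparr>carrier := P\<rparr>) p" "a \<in> P" unfolding p_core_def by blast
  then show "inv a \<in> p_core G p"
    using p_core_upper normal_imp_subgroup subgroup.m_inv_closed by (metis subsetD)
  fix b assume "b \<in> p_core G p"
  then obtain Q where Q: "Q \<lhd> G" "p_group (G\<lparr>carrier := Q\<rparr>) p" "b \<in> Q" unfolding p_core_def by blast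
  have Ps: "subgroup P G" and Qs: "subgroup Q G" using P Q normal_imp_subgroup by blast+
  have Pc: "P \<subseteq> carrier G" and Qc: "Q \<subseteq> carrier G" using Ps Qs subgroup.subset by blast+
  interpret S: second_isomorphism_grp P G Q
    using P(1) Qs by (simp add: second_isomorphism_grp_def second_isomorphism_grp_axioms_def)
  have "P <#> Q \<lhd> G"
  proof (rule normal_conjugate_byI [OF S.normal_set_mult_subgroup])
    fix x z assume x: "x \<in> carrier G" and "z \<in> P <#> Q"
    then obtain u v where uv: "u \<in> P" "v \<in> Q" "z = u \<otimes> v" unfolding set_mult_def by blast
    then have "conjugate_by G x z = conjugate_by G x u \<otimes> conjugate_by G x v"
      using x Pc Qc conjugate_by_mult by blast
    then show "conjugate_by G x z \<in> P <#> Q"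
      using normal_conjugate_by [OF P(1) x uv(1)] normal_conjugate_by [OF Q(1) x uv(2)]
      unfolding set_mult_def by blast
  qed
  moreover have "p_group (G\<lparr>carrier := P <#> Q\<rparr>) p"
  proof -
    have "\<exists>f. (u \<otimes> v) [^] (p ^ f) = \<one>" if uv: "u \<in> P" "v \<in> Q" for u v
    proof -
      obtain e where "u [^] (p ^ e) = \<one>" using P(2) uv by (auto simp: p_group_def)
      then show ?thesis using p_element_mult_normal [OF Q(1,2) _ _ uv(2)] uv Pc by blast
    qed
    then show ?thesis unfolding p_group_def set_mult_def by auto
  qed
  ultimately have "P <#> Q \<subseteq> p_core G p" by (rule p_core_upper)
  then show "a \<otimes> b \<in> p_core G p" using P Q unfolding set_mult_def by blast
qed

text \<open>Conjugation by an element of \<open>G\<close> maps normal \<open>p\<close>-subgroups of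
  \<open>E\<close> to normal \<open>p\<close>-subgroups of \<open>E\<close>, so it preserves their
  union.\<close>

lemma p_core_of_normal:
  assumes E: "E \<lhd> G"
  shows "p_core (G\<lparr>carrier := E\<rparr>) p \<lhd> G"
proof -
  have Es: "subgroup E G" using E normal_imp_subgroup by blast
  have Ec: "E \<subseteq> carrier G" using Es subgroup.subset by blast
  interpret EG: group "G\<lparr>carrier := E\<rparr>" using Es subgroup_imp_group by blast
  have "subgroup (p_core (G\<lparr>carrier := E\<rparr>) p) G"
    using EG.p_core_subgroup Es incl_subgroup by blast
  then show ?thesis
  proof (rule normal_conjugate_byI)
    fix x z assume x: "x \<in> carrier G" and "z \<in> p_core (G\<lparr>carrier := E\<rparr>) p"
    then obtain P where P: "P \<lhd> G\<lparr>carrier := E\<rparr>" "p_group (G\<lparr>carrier := P\<rparr>) p" "z \<in> P"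
      unfolding p_core_def by auto
    have "subgroup P (G\<lparr>carrier := E\<rparr>)" using P normal_imp_subgroup by blast
    then have PE: "P \<subseteq> E" and Ps: "subgroup P G"
      using subgroup.subset [of P "G\<lparr>carrier := E\<rparr>"] Es incl_subgroup by auto
    let ?Q = "conjugate_by G x ` P"
    have QE: "?Q \<subseteq> E" using normal_conjugate_by [OF E x] PE by blast
    have "?Q \<lhd> G\<lparr>carrier := E\<rparr>"
    proof (rule EG.normal_conjugate_byI)
      show "subgroup ?Q (G\<lparr>carrier := E\<rparr>)"
        using subgroup_conjugate_image [OF Ps x] QE Es subgroup_incl by blast
      fix e w assume e: "e \<in> carrier (G\<lparr>carrier := E\<rparr>)" and "w \<in> ?Q"
      then obtain v where v: "v \<in> P" "w = conjugate_by G x v" by blast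
      have eE: "e \<in> E" and eG: "e \<in> carrier G" and vG: "v \<in> carrier G" using e v PE Ec by auto
      \<comment> \<open>Conjugating by \<open>x\<close> and then by \<open>e\<close> is the same as
        conjugating by \<open>?e\<close> and then by \<open>x\<close>.\<close>
      let ?e = "x \<otimes> e \<otimes> inv x"
      have e': "?e \<in> E" using normal.inv_op_closed2 [OF E x eE] .
      have "conjugate_by G e w = conjugate_by G x (conjugate_by G ?e v)"
        using v x eG vG by (simp add: conjugate_by_conjugate_by m_assoc)
      moreover have "conjugate_by G ?e v \<in> P"
        using EG.normal_conjugate_by [OF P(1), of ?e v] e' v(1) conjugate_by_carrier_update [OF Es e'] by simp
      ultimately show "conjugate_by (G\<lparr>carrier := E\<rparr>) e w \<in> ?Q"
        using conjugate_by_carrier_update [OF Es eE] by simp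
    qed
    moreover have "p_group (G\<lparr>carrier := ?Q\<rparr>) p"
    proof -
      have "\<exists>f. conjugate_by G x v [^] (p ^ f) = \<one>" if v: "v \<in> P" for v
      proof -
        obtain f where "v [^] (p ^ f) = \<one>" using P(2) v by (auto simp: p_group_def)
        moreover have "v \<in> carrier G" using v PE Ec by blast
        ultimately have "conjugate_by G x v [^] (p ^ f) = \<one>"
          using x by (simp add: conjugate_by_pow) (simp add: conjugate_by_def)
        then show ?thesis by blast
      qed
      then show ?thesis by (auto simp: p_group_def)
    qed
    ultimately have "?Q \<subseteq> p_core (G\<lparr>carrier := E\<rparr>) p" using EG.p_core_upper by simp
    then show "conjugate_by G x z \<in> p_core (G\<lparr>carrier := E\<rparr>) p" using P(3) by blast
  qed
qed

lemma p_core_normal: "p_core G p \<lhd> G"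
  using p_core_of_normal [OF normal_self] by simp

lemma subnormal_subgroup: "subnormal G K \<Longrightarrow> subgroup K G"
proof (induction rule: subnormal.induct)
  case whole
  then show ?case by (rule subgroup_self)
next
  case (step K H)
  then show ?case using incl_subgroup normal_imp_subgroup by blast
qed

lemma p_core_subnormal: "subnormal G K \<Longrightarrow> p_core (G\<lparr>carrier := K\<rparr>) p \<subseteq> p_core G p"
proof (induction rule: subnormal.induct)
  case whole
  have "p_core (G\<lparr>carrier := carrier G\<rparr>) p = p_core G p" by simp
  then show ?case by blast
next
  case (step K H)
  interpret KG: group "G\<lparr>carrier := K\<rparr>" using step(1) subnormal_subgroup subgroup_imp_group by blast
  have "subgroup H (G\<lparr>carrier := K\<rparr>)" using step(2) normal_imp_subgroup by blast
  then interpret HG: group "G\<lparr>carrier := H\<rparr>" using KG.subgroup_imp_group [of H] by simp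
  have "p_core (G\<lparr>carrier := H\<rparr>) p \<lhd> G\<lparr>carrier := K\<rparr>" using KG.p_core_of_normal [OF step(2)] by simp
  moreover have "p_group (G\<lparr>carrier := p_core (G\<lparr>carrier := H\<rparr>) p\<rparr>) p" using HG.p_core_p_group by simp
  ultimately have "p_core (G\<lparr>carrier := H\<rparr>) p \<subseteq> p_core (G\<lparr>carrier := K\<rparr>) p"
    using KG.p_core_upper by simp
  then show ?case using step by blast
qed

definition p_cores_centralizer :: "'a set" where
  "p_cores_centralizer = set_centralizer (\<Union>p \<in> {p. Factorial_Ring.prime p}. p_core G p)"

text \<open>A minimal counterexample among the subnormal subgroups of the centralizer is quasisimple.\<close>

lemma p_cores_centralizer_coprime_commuting:
  assumes fin: "finite (carrier G)" and C_normal: "p_cores_centralizer \<lhd> G"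
    and qs: "\<And>K. \<lbrakk>subnormal G K; quasisimple (G\<lparr>carrier := K\<rparr>)\<rbrakk> \<Longrightarrow> coprime_commuting (G\<lparr>carrier := K\<rparr>)"
  shows "coprime_commuting (G\<lparr>carrier := p_cores_centralizer\<rparr>)"
proof (rule ccontr)
  let ?C = "p_cores_centralizer"
  assume not: "\<not> coprime_commuting (G\<lparr>carrier := ?C\<rparr>)"
  define S where "S = {K. subnormal G K \<and> K \<subseteq> ?C \<and> \<not> coprime_commuting (G\<lparr>carrier := K\<rparr>)}"
  have "S \<subseteq> Pow (carrier G)" unfolding S_def using subnormal_subgroup subgroup.subset by blast
  then have "finite S" using fin finite_subset by blast
  moreover have "?C \<lhd> G\<lparr>carrier := carrier G\<rparr>" using C_normal by simp
  then have "subnormal G ?C" by (rule subnormal.step [OF subnormal.whole])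
  then have "?C \<in> S" unfolding S_def using not by blast
  ultimately obtain K where KS: "K \<in> S" and Kmin: "\<And>N. N \<in> S \<Longrightarrow> N \<subseteq> K \<Longrightarrow> K = N"
    using finite_has_minimal [of S] by (metis empty_iff)
  then have K: "subnormal G K" "K \<subseteq> ?C" "\<not> coprime_commuting (G\<lparr>carrier := K\<rparr>)" unfolding S_def by blast+
  let ?K = "G\<lparr>carrier := K\<rparr>"
  have Ks: "subgroup K G" using K subnormal_subgroup by blast
  have Kc: "K \<subseteq> carrier G" using Ks subgroup.subset by blast
  have finK: "finite K" using Kc fin finite_subset by blast
  interpret KG: group ?K using Ks subgroup_imp_group by blast
  \<comment> \<open>By minimality of \<open>K\<close>, coprime elements of \<open>N\<close> commute,
    so its \<open>p\<close>-elements form a normal \<open>p\<close>-subgroup of \<open>K\<close>. By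
    subnormality it lies in the \<open>p\<close>-core of \<open>G\<close>, which \<open>K\<close>
    centralizes as a part of \<open>?C\<close>. Thus all prime-power parts of elements of
    \<open>N\<close> are central in \<open>K\<close>.\<close>
  have central: "N \<subseteq> group_center ?K" if N: "N \<lhd> ?K" "N \<noteq> K" for N
  proof
    fix y assume y: "y \<in> N"
    have Ns: "subgroup N ?K" using N normal_imp_subgroup by blast
    have NK: "N \<subseteq> K" using subgroup.subset [OF Ns] by simp
    have yK: "y \<in> carrier ?K" using y NK by auto
    have "subnormal G N" using subnormal.step [OF K(1) N(1)] .
    then have "coprime_commuting (G\<lparr>carrier := N\<rparr>)" using Kmin NK K(2) N(2) unfolding S_def by blast
    then have ccN: "coprime_commuting (?K\<lparr>carrier := N\<rparr>)" by simp
    show "y \<in> group_center ?K"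
    proof (rule KG.prime_power_parts_in_subgroup [OF KG.group_center_subgroup yK KG.pow_order_eq_1 [OF yK]])
      show "order ?K > 0" using finK KG.order_gt_0_iff_finite by simp
      fix p e k :: nat
      assume p: "Factorial_Ring.prime p" and pe: "(y [^]\<^bsub>?K\<^esub> k) [^]\<^bsub>?K\<^esub> (p ^ e) = \<one>\<^bsub>?K\<^esub>"
      have "y [^] k \<in> N" using KG.subgroup_nat_pow_closed [OF Ns y] by simp
      then have "y [^] k \<in> p_elements (?K\<lparr>carrier := N\<rparr>) p" using pe by (auto simp: p_elements_def)
      moreover have "p_elements (?K\<lparr>carrier := N\<rparr>) p \<subseteq> p_core ?K p"
        using KG.p_core_upper KG.p_elements_normal [OF _ N(1) ccN p] finK by simp
      ultimately have core: "y [^] k \<in> p_core G p" using p_core_subnormal [OF K(1)] by blast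
      have "y [^] k \<otimes> g = g \<otimes> y [^] k" if g: "g \<in> K" for g
      proof -
        have "g \<in> ?C" using g K(2) by blast
        then show ?thesis
          using core p unfolding p_cores_centralizer_def by (metis UN_I mem_Collect_eq set_centralizerD(2))
      qed
      then show "y [^]\<^bsub>?K\<^esub> k \<in> group_center ?K"
        using \<open>y [^] k \<in> N\<close> NK by (intro group_centerI) auto
    qed
  qed
  have Z: "group_center ?K \<lhd> ?K" by (rule KG.group_center_normal)
  interpret Z: normal "group_center ?K" ?K by (rule Z)
  interpret Q: group "?K Mod group_center ?K" by (rule Z.factorgroup_is_group)
  have Zne: "group_center ?K \<noteq> K"
  proof
    assume eq: "group_center ?K = K"
    have "x \<otimes> y = y \<otimes> x" if xy: "x \<in> K" "y \<in> K" for x y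
    proof -
      have "x \<in> group_center ?K" using eq xy by simp
      then show ?thesis using group_centerD(2) [of x ?K y] xy by simp
    qed
    then show False using K(3) unfolding coprime_commuting_def by simp
  qed
  \<comment> \<open>Otherwise all commutators are central, and
    \<open>central_commutator_commute\<close> makes coprime elements commute, contrary to the choice
    of \<open>K\<close>.\<close>
  have perfect: "derived ?K (carrier ?K) = carrier ?K"
  proof (rule ccontr)
    assume "derived ?K (carrier ?K) \<noteq> carrier ?K"
    then have D: "derived ?K (carrier ?K) \<subseteq> group_center ?K"
      using central KG.derived_self_is_normal by simp
    have "z \<otimes>\<^bsub>?K\<^esub> x = x \<otimes>\<^bsub>?K\<^esub> z"
      if zx: "z \<in> carrier ?K" "x \<in> carrier ?K" "coprime a b" "z [^]\<^bsub>?K\<^esub> a = \<one>\<^bsub>?K\<^esub>" "x [^]\<^bsub>?K\<^esub> b = \<one>\<^bsub>?K\<^esub>"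
      for z x and a b :: nat
    proof -
      \<comment> \<open>The generators of \<open>derived\<close> are
        \<open>h1 h2 h1^-1 h2^-1\<close>; the commutator \<open>?c\<close> has this form with
        \<open>h1 = z^-1\<close> and \<open>h2 = x^-1\<close>.\<close>
      let ?c = "inv\<^bsub>?K\<^esub> z \<otimes>\<^bsub>?K\<^esub> conjugate_by ?K x z"
      have "inv\<^bsub>?K\<^esub> z \<otimes>\<^bsub>?K\<^esub> inv\<^bsub>?K\<^esub> x \<otimes>\<^bsub>?K\<^esub> inv\<^bsub>?K\<^esub> (inv\<^bsub>?K\<^esub> z) \<otimes>\<^bsub>?K\<^esub> inv\<^bsub>?K\<^esub> (inv\<^bsub>?K\<^esub> x) \<in> derived ?K (carrier ?K)"
        unfolding derived_def using KG.inv_closed [OF zx(1)] KG.inv_closed [OF zx(2)]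
        by (intro generate.incl) blast
      moreover have "?c = inv\<^bsub>?K\<^esub> z \<otimes>\<^bsub>?K\<^esub> inv\<^bsub>?K\<^esub> x \<otimes>\<^bsub>?K\<^esub> inv\<^bsub>?K\<^esub> (inv\<^bsub>?K\<^esub> z) \<otimes>\<^bsub>?K\<^esub> inv\<^bsub>?K\<^esub> (inv\<^bsub>?K\<^esub> x)"
        using KG.inv_inv [OF zx(1)] KG.inv_inv [OF zx(2)] KG.inv_closed [OF zx(1)] KG.inv_closed [OF zx(2)] zx(1,2)
        by (simp only: conjugate_by_def KG.m_assoc KG.m_closed)
      ultimately have "?c \<in> group_center ?K" using D by auto
      then show ?thesis
        using KG.central_commutator_commute [OF zx(2,1,4,5,3)] group_centerD(2) zx(1,2) by metis
    qed
    then show False using K(3) unfolding coprime_commuting_def by blast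
  qed
  have "simple_group (?K Mod group_center ?K)"
  proof (intro simple_group.intro Q.is_group simple_group_axioms.intro)
    obtain w where w: "w \<in> carrier ?K" "w \<notin> group_center ?K"
      using Zne Z.subset by auto
    have fin_Q: "finite (carrier (?K Mod group_center ?K))"
      unfolding carrier_FactGroup using finK by simp
    have "{group_center ?K, group_center ?K #>\<^bsub>?K\<^esub> w} \<subseteq> carrier (?K Mod group_center ?K)"
      using w Q.one_closed unfolding carrier_FactGroup by auto
    moreover have "group_center ?K #>\<^bsub>?K\<^esub> w \<noteq> group_center ?K" using w Z.rcos_eq_iff by blast
    ultimately show "1 < order (?K Mod group_center ?K)"
      unfolding order_def using card_mono [OF fin_Q, of "{group_center ?K, group_center ?K #>\<^bsub>?K\<^esub> w}"] by auto
  next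
    fix M assume M: "M \<lhd> ?K Mod group_center ?K"
    have Mc: "M \<subseteq> carrier (?K Mod group_center ?K)"
      using M normal_imp_subgroup subgroup.subset by blast
    have M1: "group_center ?K \<in> M"
      using subgroup.one_closed [OF normal_imp_subgroup [OF M]] by simp
    define N where "N = {x \<in> carrier ?K. group_center ?K #>\<^bsub>?K\<^esub> x \<in> M}"
    have N: "N \<lhd> ?K" unfolding N_def by (rule KG.coset_preimage_normal [OF Z M])
    show "M = carrier (?K Mod group_center ?K) \<or> M = {\<one>\<^bsub>?K Mod group_center ?K\<^esub>}"
    proof (cases "N = K")
      case True
      then have "carrier (?K Mod group_center ?K) \<subseteq> M" unfolding N_def carrier_FactGroup by auto
      then show ?thesis using Mc by blast
    next
      case False
      then have NZ: "N \<subseteq> group_center ?K" by (rule central [OF N])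
      have "U = group_center ?K" if "U \<in> M" for U
      proof -
        have "U \<in> carrier (?K Mod group_center ?K)" using that Mc by blast
        then obtain x where x: "x \<in> carrier ?K" "U = group_center ?K #>\<^bsub>?K\<^esub> x"
          unfolding carrier_FactGroup by blast
        have "x \<in> N" unfolding N_def using x that by simp
        then have "x \<in> group_center ?K" using NZ by blast
        then show ?thesis unfolding x(2) using Z.rcos_eq_iff [OF x(1)] by simp
      qed
      then have "M = {group_center ?K}" using M1 by blast
      then show ?thesis by simp
    qed
  qed
  then have "quasisimple ?K" unfolding quasisimple_def using perfect KG.is_group by blast
  then show False using qs K by blast
qed

end

section \<open>Proof of the theorem\<close>

context group
begin

text \<open>Membership in a conjugate of \<open>generate G {a}\<close> and in its normalizer is
  rewritten as two equations between products. The result is \<open>rigid_element\<close> with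
  \<open>u\<close> restricted to \<open>T\<close>; to get rigidity it remains to see that
  \<open>T\<close> is large enough.\<close>

lemma HC_subgroup_generate_rigid:
  assumes fin: "finite (carrier G)" and a: "a \<in> carrier G" and HC: "HC_subgroup G (generate G {a})"
  obtains T where "T \<lhd> G" "carrier G = generate G {a} <#> T"
    "\<And>g u (i::nat) (j::nat). \<lbrakk>g \<in> carrier G; u \<in> T; g \<otimes> u = a [^] i \<otimes> g; u \<otimes> a = a [^] j \<otimes> u\<rbrakk>
      \<Longrightarrow> \<exists>k::nat. u = a [^] k"
proof -
  let ?H = "generate G {a}"
  have H: "?H = {a [^] k | k::nat. k \<in> UNIV}" by (rule generate_pow_on_finite_carrier [OF fin a])
  have Hs: "subgroup ?H G" using a generate_is_subgroup by simp
  have Hc: "?H \<subseteq> carrier G" using Hs subgroup.subset by blast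
  obtain T where T: "T \<lhd> G" "carrier G = ?H <#> T"
    "\<And>g. g \<in> carrier G \<Longrightarrow> (inv g <# ?H #> g) \<inter> (T \<inter> normalizer G ?H) \<subseteq> ?H"
    using HC unfolding HC_subgroup_def by blast
  have "\<exists>k::nat. u = a [^] k"
    if g: "g \<in> carrier G" and u: "u \<in> T" and gu: "g \<otimes> u = a [^] i \<otimes> g" and ua: "u \<otimes> a = a [^] j \<otimes> u"
    for g u and i j :: nat
  proof -
    have uG: "u \<in> carrier G" using u T(1) normal_imp_subgroup subgroup.mem_carrier by metis
    have "u = inv g \<otimes> (g \<otimes> u)" using g uG by (simp add: m_assoc [symmetric])
    then have "u = inv g \<otimes> a [^] i \<otimes> g" using gu g a by (simp add: m_assoc)
    then have 1: "u \<in> inv g <# ?H #> g" unfolding H l_coset_def r_coset_def by blast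
    have "conjugate_by G (inv u) a = a [^] j"
    proof -
      have "a \<otimes> inv u = inv u \<otimes> (u \<otimes> a) \<otimes> inv u" using uG a by (simp add: m_assoc [symmetric])
      also have "\<dots> = inv u \<otimes> a [^] j" unfolding ua using uG a by (simp add: m_assoc)
      finally show ?thesis using uG a conjugate_by_eq_iff [of "inv u" a "a [^] j"] by simp
    qed
    then have "conjugate_by G (inv u) (a [^] l) = a [^] (j * l)" for l :: nat
      using conjugate_by_pow [of "inv u" a l] uG a by (simp add: nat_pow_pow)
    then have "conjugate_by G (inv u) h \<in> ?H" if "h \<in> ?H" for h using that unfolding H by blast
    then have "inv u \<in> normalizer G ?H" using uG by (intro normalizer_memI [OF fin Hs]) auto
    then have 2: "u \<in> normalizer G ?H"
      using normalizer_imp_subgroup [OF Hc] subgroup.m_inv_closed uG by (metis inv_inv)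
    show ?thesis using 1 2 u T(3) [OF g] H by blast
  qed
  then show ?thesis using that T(1,2) by blast
qed

text \<open>Used for two consequences of \<open>G Mod T\<close> being cyclic: it is abelian, and it
  has exponent 4 if \<open>a\<close> has.\<close>

lemma coset_generate_mult:
  assumes T: "T \<lhd> G" and a: "a \<in> carrier G" and fin: "finite (carrier G)"
    and eq: "carrier G = generate G {a} <#> T" and x: "x \<in> carrier G"
  obtains k :: nat where "T #> x = T #> (a [^] k)"
proof -
  interpret T: normal T G by fact
  obtain h t where ht: "h \<in> generate G {a}" "t \<in> T" "x = h \<otimes> t"
    using x unfolding eq set_mult_def by blast
  then obtain k :: nat where k: "h = a [^] k" unfolding generate_pow_on_finite_carrier [OF fin a] by blast
  have tG: "t \<in> carrier G" using ht T.subset by blast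
  have "(T #> h) <#> (T #> t) = T #> x" using ht k a tG T.rcos_sum by simp
  moreover have "T #> t = T" using ht tG T.rcos_eq_iff by blast
  moreover have "(T #> h) <#> T = T #> h"
    using T.rcos_sum [of h \<one>] k a by (simp add: coset_mult_one T.subset)
  ultimately show ?thesis using that k by metis
qed

end

section \<open>The situation of the theorem\<close>

context
  fixes G :: "('a, 'b) monoid_scheme" (structure) and E :: "'a set"
  assumes G_group: "group G" and fin: "finite (carrier G)"
    and E_normal: "E \<lhd> G"
    and quotient_nilpotent: "nilpotent_group (G Mod E)"
    and minimal_subgroups: "\<And>H. subgroup H G \<Longrightarrow> H \<subseteq> generalized_fitting (G\<lparr>carrier := E\<rparr>) \<Longrightarrow>
           Factorial_Ring.prime (card H) \<Longrightarrow> H \<subseteq> hypercenter G"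
    and cyclic_four: "\<And>H. subgroup H G \<Longrightarrow> H \<subseteq> generalized_fitting (G\<lparr>carrier := E\<rparr>) \<Longrightarrow>
           cyclic_group (G\<lparr>carrier := H\<rparr>) \<Longrightarrow> card H = 4 \<Longrightarrow> HC_subgroup G H"
begin

interpretation group G by (rule G_group)

lemma E_subgroup: "subgroup E G" and E_carrier: "E \<subseteq> carrier G" and E_finite: "finite E"
  using E_normal normal_imp_subgroup subgroup.subset fin finite_subset by metis+

interpretation EG: group "G\<lparr>carrier := E\<rparr>" using E_subgroup subgroup_imp_group by blast

lemma fitting_subset: "fitting_subgroup (G\<lparr>carrier := E\<rparr>) \<subseteq> generalized_fitting (G\<lparr>carrier := E\<rparr>)"
proof
  fix x assume x: "x \<in> fitting_subgroup (G\<lparr>carrier := E\<rparr>)"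
  have "fitting_subgroup (G\<lparr>carrier := E\<rparr>) \<subseteq> carrier (G\<lparr>carrier := E\<rparr>)"
    unfolding fitting_subgroup_def
    by (rule EG.generate_incl) (use normal_imp_subgroup subgroup.subset in blast)
  then have "x \<in> carrier G" using x E_carrier by auto
  then have "x = x \<otimes> \<one>" by simp
  moreover have "\<one> \<in> layer (G\<lparr>carrier := E\<rparr>)"
    unfolding layer_def using generate.one [of "G\<lparr>carrier := E\<rparr>"] by simp
  ultimately show "x \<in> generalized_fitting (G\<lparr>carrier := E\<rparr>)"
    unfolding generalized_fitting_def set_mult_def using x by auto
qed

lemma layer_subset: "layer (G\<lparr>carrier := E\<rparr>) \<subseteq> generalized_fitting (G\<lparr>carrier := E\<rparr>)"
proof
  fix x assume x: "x \<in> layer (G\<lparr>carrier := E\<rparr>)"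
  have "layer (G\<lparr>carrier := E\<rparr>) \<subseteq> carrier (G\<lparr>carrier := E\<rparr>)"
    unfolding layer_def
    by (rule EG.generate_incl) (use EG.subnormal_subgroup subgroup.subset in blast)
  then have "x \<in> carrier G" using x E_carrier by auto
  then have "x = \<one> \<otimes> x" by simp
  moreover have "\<one> \<in> fitting_subgroup (G\<lparr>carrier := E\<rparr>)"
    unfolding fitting_subgroup_def using generate.one [of "G\<lparr>carrier := E\<rparr>"] by simp
  ultimately show "x \<in> generalized_fitting (G\<lparr>carrier := E\<rparr>)"
    unfolding generalized_fitting_def set_mult_def using x by auto
qed

lemma quasisimple_subset:
  assumes "subnormal (G\<lparr>carrier := E\<rparr>) K" "quasisimple (G\<lparr>carrier := K\<rparr>)"
  shows "K \<subseteq> generalized_fitting (G\<lparr>carrier := E\<rparr>)"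
proof -
  have "K \<subseteq> layer (G\<lparr>carrier := E\<rparr>)" unfolding layer_def using assms by (auto intro: generate.incl)
  then show ?thesis using layer_subset by blast
qed

abbreviation "E_core p \<equiv> p_core (G\<lparr>carrier := E\<rparr>) p"

lemma core_normal: "E_core p \<lhd> G"
  by (rule p_core_of_normal [OF E_normal])

lemma core_p_group: "p_group (G\<lparr>carrier := E_core p\<rparr>) p"
  using EG.p_core_p_group by simp

lemma core_subset:
  assumes p: "Factorial_Ring.prime p"
  shows "E_core p \<subseteq> generalized_fitting (G\<lparr>carrier := E\<rparr>)"
proof -
  have N: "E_core p \<lhd> G\<lparr>carrier := E\<rparr>" by (rule EG.p_core_normal)
  have s: "subgroup (E_core p) G" using core_normal normal_imp_subgroup by blast
  interpret CG: group "G\<lparr>carrier := E_core p\<rparr>" using s subgroup_imp_group by blast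
  have "finite (E_core p)" using s subgroup.subset fin finite_subset by metis
  then have "nilpotent_group (G\<lparr>carrier := E_core p\<rparr>)"
    using CG.coprime_commuting_imp_nilpotent CG.p_group_imp_coprime_commuting [OF core_p_group p] by simp
  then have "E_core p \<subseteq> fitting_subgroup (G\<lparr>carrier := E\<rparr>)"
    unfolding fitting_subgroup_def using N by (auto intro!: generate.incl)
  then show ?thesis using fitting_subset by blast
qed

text \<open>The subgroup \<open>W\<close> keeps \<open>generate G {z}\<close> inside F*(E), which is
  handled here only as a product of two sets. That minimal subgroup is hypercentral, and
  \<open>hypercenter_commute\<close> applies.\<close>

lemma prime_order_commute:
  assumes W: "subgroup W G" "W \<subseteq> generalized_fitting (G\<lparr>carrier := E\<rparr>)" and z: "z \<in> W" "z [^] p = \<one>"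
    and p: "Factorial_Ring.prime (p::nat)" and x: "x \<in> carrier G" "x [^] (b::nat) = \<one>" "coprime p b"
  shows "z \<otimes> x = x \<otimes> z"
proof (cases "z = \<one>")
  case False
  have zG: "z \<in> carrier G" using z W subgroup.mem_carrier by metis
  have "ord z dvd p" using z zG pow_eq_id by blast
  then have "ord z = p" using p False zG ord_eq_1 by (metis prime_nat_iff)
  then have "card (generate G {z}) = p" using generate_pow_card zG by simp
  moreover have "generate G {z} \<subseteq> W" using generate_subgroup_incl z W by simp
  moreover have "subgroup (generate G {z}) G" using zG generate_is_subgroup by simp
  ultimately have "generate G {z} \<subseteq> hypercenter G" using minimal_subgroups W(2) p by (metis order_trans)
  then have "z \<in> hypercenter G" using generate.incl by (metis insertI1 subsetD)
  then show ?thesis using hypercenter_commute z(2) x by blast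
qed (use x in simp)

lemma order_four_HC:
  assumes W: "subgroup W G" "W \<subseteq> generalized_fitting (G\<lparr>carrier := E\<rparr>)"
    and a: "a \<in> W" "a [^] (4::nat) = \<one>" "a [^] (2::nat) \<noteq> \<one>"
  shows "HC_subgroup G (generate G {a})"
proof -
  have aG: "a \<in> carrier G" using a W subgroup.mem_carrier by metis
  have d: "ord a dvd 2 ^ 2" using a aG pow_eq_id by simp
  then obtain i where i: "i \<le> 2" "ord a = 2 ^ i" using divides_primepow_nat two_is_prime_nat by blast
  have nd: "\<not> 2 ^ i dvd (2::nat)" using i(2) a(3) aG pow_eq_id [of a 2] by simp
  have "i \<noteq> 0" "i \<noteq> 1" using nd by (metis one_dvd power_0, metis dvd_refl power_one_right)
  then have "i = 2" using i(1) by linarith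
  then have "card (generate G {a}) = 4" using i generate_pow_card aG by simp
  moreover have "generate G {a} \<subseteq> W" using generate_subgroup_incl a W by simp
  moreover have "subgroup (generate G {a}) G" using aG generate_is_subgroup by simp
  moreover have "cyclic_group (G\<lparr>carrier := generate G {a}\<rparr>)"
    using cyclic_group_generated [of a] aG by (simp add: subgroup_generated_def)
  ultimately show ?thesis using cyclic_four W(2) by (metis order_trans)
qed

text \<open>Inside the subgroup generated by the elements of odd order, the supplement in the
  definition of an HC-subgroup has to be the whole group.\<close>

lemma rigid_in_residual:
  assumes W: "subgroup W G" "W \<subseteq> generalized_fitting (G\<lparr>carrier := E\<rparr>)"
    and a: "a \<in> W" "a [^] (4::nat) = \<one>" "a [^] (2::nat) \<noteq> \<one>" and res: "a \<in> p_residual G 2"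
  shows "rigid_element G a"
proof -
  have aG: "a \<in> carrier G" using a W subgroup.mem_carrier by metis
  obtain T where T: "T \<lhd> G" "carrier G = generate G {a} <#> T"
    "\<And>g u (i::nat) (j::nat). \<lbrakk>g \<in> carrier G; u \<in> T; g \<otimes> u = a [^] i \<otimes> g; u \<otimes> a = a [^] j \<otimes> u\<rbrakk>
      \<Longrightarrow> \<exists>k::nat. u = a [^] k"
    using HC_subgroup_generate_rigid [OF fin aG order_four_HC [OF W a]] by metis
  interpret T: normal T G by (rule T(1))
  interpret Q: group "G Mod T" by (rule T.factorgroup_is_group)
  \<comment> \<open>The quotient by \<open>T\<close> has exponent 4, so elements of odd exponent are
    trivial in it. Then \<open>T\<close> contains \<open>a\<close>, hence
    \<open>generate G {a}\<close>, hence all of \<open>G\<close>.\<close>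
  have "p_residual G 2 \<subseteq> T"
  proof (rule p_residual_subset [OF T.subgroup_axioms])
    fix x and c :: nat assume x: "x \<in> carrier G" "x [^] c = \<one>" "coprime 2 c"
    obtain k :: nat where k: "T #> x = T #> (a [^] k)" using coset_generate_mult [OF T(1) aG fin T(2) x(1)] .
    have "(T #> x) [^]\<^bsub>G Mod T\<^esub> (4::nat) = T #> ((a [^] k) [^] (4::nat))"
      unfolding k using aG by (simp add: T.FactGroup_pow)
    also have "(a [^] k) [^] (4::nat) = (a [^] (4::nat)) [^] k" using aG by (simp add: nat_pow_pow mult.commute)
    also have "\<dots> = \<one>" using a(2) by simp
    finally have 4: "(T #> x) [^]\<^bsub>G Mod T\<^esub> (4::nat) = \<one>\<^bsub>G Mod T\<^esub>" by (simp add: coset_mult_one T.subset)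
    have c: "(T #> x) [^]\<^bsub>G Mod T\<^esub> c = \<one>\<^bsub>G Mod T\<^esub>"
      using x by (simp add: T.FactGroup_pow coset_mult_one T.subset)
    have "coprime (2 ^ 2) c" using x(3) coprime_power_left_iff by blast
    then have "coprime 4 c" by simp
    then have "T #> x = \<one>\<^bsub>G Mod T\<^esub>"
      using Q.pow_coprime_one [OF _ 4 c] x by (auto simp: carrier_FactGroup)
    then show "x \<in> T" using T.rcos_eq_iff x by simp
  qed
  then have "{a} \<subseteq> T" using res by blast
  then have "generate G {a} \<subseteq> T" using T.subgroup_axioms by (rule generate_subgroup_incl)
  then have "carrier G \<subseteq> T" unfolding T(2) set_mult_def using T.m_closed by blast
  then show ?thesis unfolding rigid_element_def using T(3) by blast
qed

text \<open>Rigidity is available only in \<open>R\<close>, the part of the core inside O^p(G), so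
  \<open>x\<close> is first shown to centralize \<open>R\<close>. The commutator \<open>?c\<close>
  belongs to \<open>R\<close>: to the core because of \<open>z\<close>, to the residual because of
  \<open>x\<close>. Being fixed by \<open>x\<close> and of \<open>p\<close>-power order, it is
  trivial.\<close>

lemma core_commute:
  assumes p: "Factorial_Ring.prime p" and z: "z \<in> E_core p"
    and x: "x \<in> carrier G" "x [^] (b::nat) = \<one>" "coprime p b"
  shows "z \<otimes> x = x \<otimes> z"
proof -
  have Ps: "subgroup (E_core p) G" using core_normal normal_imp_subgroup by blast
  have Os: "subgroup (p_residual G p) G" using p_residual_normal normal_imp_subgroup by blast
  have zG: "z \<in> carrier G" using z Ps subgroup.mem_carrier by metis
  define R where "R = E_core p \<inter> p_residual G p"
  have R: "R \<lhd> G" unfolding R_def using normal_subgroup_intersect core_normal p_residual_normal by blast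
  have Rs: "subgroup R G" using R normal_imp_subgroup by blast
  have RF: "R \<subseteq> generalized_fitting (G\<lparr>carrier := E\<rparr>)" using core_subset [OF p] R_def by blast
  have Rp: "p_group (G\<lparr>carrier := R\<rparr>) p" using core_p_group unfolding p_group_def R_def by auto
  let ?c = "inv z \<otimes> conjugate_by G x z"
  have cP: "?c \<in> E_core p"
    using normal_conjugate_by [OF core_normal x(1) z] subgroup.m_closed [OF Ps]
      subgroup.m_inv_closed [OF Ps z] by blast
  have "?c \<in> p_residual G p"
  proof -
    have xO: "x \<in> p_residual G p" using p_residual_incl x by blast
    have "?c = conjugate_by G z (inv x) \<otimes> x" using x zG by (simp add: conjugate_by_def m_assoc)
    moreover have "conjugate_by G z (inv x) \<in> p_residual G p"
      using normal_conjugate_by [OF p_residual_normal zG] subgroup.m_inv_closed [OF Os xO] by blast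
    ultimately show ?thesis using subgroup.m_closed [OF Os] xO by simp
  qed
  then have cR: "?c \<in> R" using cP R_def by blast
  have "?c \<otimes> x = x \<otimes> ?c"
  proof (rule normal_p_subgroup_coprime_centralized [OF fin R p Rp _ _ x cR])
    show "w \<otimes> y = y \<otimes> w" if "w \<in> R" "w [^] p = \<one>" "y \<in> carrier G" "y [^] (d::nat) = \<one>" "coprime p d" for w y d
      using prime_order_commute [OF Rs RF that(1,2) p that(3-5)] .
    show "rigid_element G a" if "p = 2" "a \<in> R" "a [^] (4::nat) = \<one>" "a [^] (2::nat) \<noteq> \<one>" for a
      using rigid_in_residual [OF Rs RF that(2-4)] that(1,2) R_def by blast
  qed
  moreover obtain e where "?c [^] (p ^ e) = \<one>" using Rp cR by (auto simp: p_group_def)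
  ultimately show ?thesis
    using fixed_commutator_commute [OF x(1) zG x(2)] x(3) by simp
qed

text \<open>Here \<open>T\<close> may be proper, so rigidity is derived only within
  \<open>K\<close>. This suffices because the quotient by \<open>T\<close> is abelian and
  \<open>K\<close> is perfect, so every \<open>u\<close> in \<open>K\<close> is in
  \<open>T\<close>.\<close>

lemma quasisimple_coprime_commuting:
  assumes K: "subnormal (G\<lparr>carrier := E\<rparr>) K" "quasisimple (G\<lparr>carrier := K\<rparr>)"
  shows "coprime_commuting (G\<lparr>carrier := K\<rparr>)"
proof -
  have Ks: "subgroup K G" using EG.subnormal_subgroup [OF K(1)] E_subgroup incl_subgroup by blast
  have Kc: "K \<subseteq> carrier G" using Ks subgroup.subset by blast
  have KF: "K \<subseteq> generalized_fitting (G\<lparr>carrier := E\<rparr>)" by (rule quasisimple_subset [OF K])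
  have "derived (G\<lparr>carrier := K\<rparr>) K = K" using K(2) unfolding quasisimple_def by simp
  then have perfect: "derived G K = K" using derived_consistent [OF order_refl Ks] by simp
  have "rigid_element (G\<lparr>carrier := K\<rparr>) a"
    if a: "a \<in> K" "a [^] (4::nat) = \<one>" "a [^] (2::nat) \<noteq> \<one>" for a
  proof -
    have aG: "a \<in> carrier G" using a Kc by blast
    obtain T where T: "T \<lhd> G" "carrier G = generate G {a} <#> T"
      "\<And>g u (i::nat) (j::nat). \<lbrakk>g \<in> carrier G; u \<in> T; g \<otimes> u = a [^] i \<otimes> g; u \<otimes> a = a [^] j \<otimes> u\<rbrakk>
        \<Longrightarrow> \<exists>k::nat. u = a [^] k"
      using HC_subgroup_generate_rigid [OF fin aG order_four_HC [OF Ks KF a]] by metis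
    interpret T: normal T G by (rule T(1))
    have comm: "inv x \<otimes> conjugate_by G y x \<in> T" if xy: "x \<in> carrier G" "y \<in> carrier G" for x y
    proof -
      obtain k l :: nat where "T #> x = T #> (a [^] k)" "T #> y = T #> (a [^] l)"
        using coset_generate_mult [OF T(1) aG fin T(2)] xy by metis
      then have "(T #> x) <#> (T #> y) = (T #> y) <#> (T #> x)"
        using aG by (simp add: T.rcos_sum nat_pow_mult add.commute)
      then show ?thesis using quotient_commute_iff [OF T(1) xy] by simp
    qed
    have "derived G K \<subseteq> T"
      unfolding derived_def
    proof (rule generate_subgroup_incl [OF _ T.subgroup_axioms])
      show "derived_set G K \<subseteq> T"
      proof clarify
        fix h1 h2 assume "h1 \<in> K" "h2 \<in> K"
        then have h: "h1 \<in> carrier G" "h2 \<in> carrier G" using Kc by auto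
        have "h1 \<otimes> h2 \<otimes> inv h1 \<otimes> inv h2 = inv (inv h1) \<otimes> conjugate_by G (inv h2) (inv h1)"
          using h by (simp add: conjugate_by_def m_assoc)
        moreover have "\<dots> \<in> T" using h by (intro comm) simp_all
        ultimately show "h1 \<otimes> h2 \<otimes> inv h1 \<otimes> inv h2 \<in> T" by (simp only:)
      qed
    qed
    then have KT: "K \<subseteq> T" using perfect by simp
    have "\<exists>k::nat. u = a [^] k"
      if "g \<in> K" "u \<in> K" "g \<otimes> u = a [^] i \<otimes> g" "u \<otimes> a = a [^] j \<otimes> u" for g u and i j :: nat
      using T(3) [OF _ _ that(3,4)] that(1,2) KT Kc by blast
    then show ?thesis unfolding rigid_element_def by simp
  qed
  moreover have "z \<otimes> x = x \<otimes> z"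
    if "z \<in> K" "x \<in> K" "Factorial_Ring.prime (p::nat)" "z [^] p = \<one>" "x [^] (b::nat) = \<one>" "coprime p b" for z x p b
    using prime_order_commute [OF Ks KF that(1,4,3) _ that(5,6)] that(2) Kc by blast
  ultimately have "small_elements_condition (G\<lparr>carrier := K\<rparr>)"
    unfolding small_elements_condition_def by simp blast
  moreover have "finite (carrier (G\<lparr>carrier := K\<rparr>))" using Kc fin finite_subset by auto
  ultimately show ?thesis
    using small_elements_imp_coprime_commuting [OF subgroup_imp_group [OF Ks]] by blast
qed

section \<open>The centralizer in \<open>E\<close> of its p-cores, and commutators of coprime
  elements\<close>

abbreviation "core_centralizer \<equiv> E \<inter> set_centralizer (\<Union>p \<in> {p. Factorial_Ring.prime p}. E_core p)"

lemma core_centralizer_normal: "core_centralizer \<lhd> G"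
proof (rule normal_conjugate_byI)
  have sub: "(\<Union>p \<in> {p. Factorial_Ring.prime p}. E_core p) \<subseteq> carrier G"
    using core_normal normal_imp_subgroup subgroup.subset by blast
  show "subgroup core_centralizer G" using subgroups_Inter_pair [OF E_subgroup set_centralizer_subgroup [OF sub]] .
  fix x z assume x: "x \<in> carrier G" and z: "z \<in> core_centralizer"
  have "conjugate_by G x z \<otimes> d = d \<otimes> conjugate_by G x z" if p: "Factorial_Ring.prime p" "d \<in> E_core p" for p d
  proof -
    have "z \<in> set_centralizer (E_core p)" using z p(1) unfolding set_centralizer_def by blast
    then have "conjugate_by G x z \<in> set_centralizer (E_core p)"
      by (rule normal_conjugate_by [OF set_centralizer_normal [OF core_normal] x])
    then show ?thesis using p(2) by (rule set_centralizerD(2))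
  qed
  moreover have "z \<in> E" "z \<in> carrier G" using z E_carrier by auto
  ultimately show "conjugate_by G x z \<in> core_centralizer"
    using normal_conjugate_by [OF E_normal x] x by (intro IntI set_centralizerI) auto
qed

lemma p_cores_centralizer_eq: "group.p_cores_centralizer (G\<lparr>carrier := E\<rparr>) = core_centralizer"
  unfolding EG.p_cores_centralizer_def EG.set_centralizer_def set_centralizer_def using E_carrier by auto

lemma core_centralizer_coprime_commuting: "coprime_commuting (G\<lparr>carrier := core_centralizer\<rparr>)"
proof -
  have "core_centralizer \<lhd> G\<lparr>carrier := E\<rparr>"
    using normal_restrict_supergroup [OF E_subgroup core_centralizer_normal] by simp
  then show ?thesis
    using EG.p_cores_centralizer_coprime_commuting quasisimple_coprime_commuting E_finite p_cores_centralizer_eq by simp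
qed

text \<open>Coprime elements of the centralizer commute, so its \<open>p\<close>-elements form a
  normal \<open>p\<close>-subgroup of \<open>E\<close>. Prime by prime, this says that the
  centralizer of the Fitting subgroup is contained in it.\<close>

lemma core_centralizer_p_elements_core:
  assumes p: "Factorial_Ring.prime p" and u: "u \<in> core_centralizer" "u [^] (p ^ e) = \<one>"
  shows "u \<in> E_core p"
proof -
  have "p_elements (G\<lparr>carrier := core_centralizer\<rparr>) p \<lhd> G"
    by (rule p_elements_normal(1) [OF fin core_centralizer_normal core_centralizer_coprime_commuting p])
  moreover have "p_elements (G\<lparr>carrier := core_centralizer\<rparr>) p \<subseteq> E" by (auto simp: p_elements_def)
  ultimately have "p_elements (G\<lparr>carrier := core_centralizer\<rparr>) p \<lhd> G\<lparr>carrier := E\<rparr>"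
    using normal_restrict_supergroup [OF E_subgroup] by blast
  then have "p_elements (G\<lparr>carrier := core_centralizer\<rparr>) p \<subseteq> E_core p"
    using EG.p_core_upper p_elements_normal(2) [OF fin core_centralizer_normal core_centralizer_coprime_commuting p] by simp
  then show ?thesis using u by (auto simp: p_elements_def)
qed

text \<open>Each \<open>p\<close>-part of \<open>u\<close> lies in a core. It commutes with
  \<open>w\<close> if \<open>p\<close> does not divide \<open>n\<close>; otherwise \<open>p\<close>
  does not divide \<open>m\<close>, and the part is trivial.\<close>

lemma core_centralizer_coprime_commute:
  assumes u: "u \<in> core_centralizer" "u [^] m = \<one>" and w: "w \<in> carrier G" "w [^] n = \<one>" and mn: "coprime m (n::nat)"
    and m: "m > 0"
  shows "u \<otimes> w = w \<otimes> u"
proof -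
  have uG: "u \<in> carrier G" using u E_carrier by auto
  have Cs: "subgroup core_centralizer G" using core_centralizer_normal normal_imp_subgroup by blast
  have "u \<in> centralizer_of w"
  proof (rule prime_power_parts_in_subgroup [OF centralizer_of_subgroup [OF w(1)] uG u(2) m])
    fix p e k :: nat
    assume p: "Factorial_Ring.prime p" and pe: "(u [^] k) [^] (p ^ e) = \<one>"
    have ukG: "u [^] k \<in> carrier G" using uG by simp
    have uk: "u [^] k \<in> E_core p" using core_centralizer_p_elements_core [OF p _ pe] subgroup_nat_pow_closed [OF Cs u(1)] by blast
    have "u [^] k \<otimes> w = w \<otimes> u [^] k"
    proof (cases "coprime p n")
      case True
      then show ?thesis using core_commute [OF p uk w] by blast
    next
      case False
      then have "p dvd n" using p prime_imp_coprime by blast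
      then have "coprime m p" using coprime_divisors [OF dvd_refl _ mn] by simp
      then have "coprime (p ^ e) m" by (simp add: coprime_commute)
      moreover have "(u [^] k) [^] m = \<one>"
        using u(2) uG by (metis nat_pow_pow mult.commute nat_pow_one)
      ultimately have "u [^] k = \<one>" using pow_coprime_one [OF ukG pe] by blast
      then show ?thesis using w by simp
    qed
    then show "u [^] k \<in> centralizer_of w" using ukG unfolding centralizer_of_def by simp
  qed
  then show ?thesis unfolding centralizer_of_def by simp
qed

text \<open>Nilpotency of \<open>G Mod E\<close> puts the commutator into \<open>E\<close>. For each
  prime \<open>p\<close>, one of \<open>x\<close> and \<open>y\<close> has exponent prime to
  \<open>p\<close> and centralizes the \<open>p\<close>-core of \<open>E\<close>; that centralizer
  is normal in \<open>G\<close>, so it contains the commutator.\<close>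

lemma commutator_in_core_centralizer:
  assumes x: "x \<in> carrier G" "x [^] (a::nat) = \<one>" and y: "y \<in> carrier G" "y [^] (b::nat) = \<one>" and ab: "coprime a b"
  shows "inv x \<otimes> conjugate_by G y x \<in> core_centralizer"
proof -
  let ?c = "inv x \<otimes> conjugate_by G y x"
  interpret N: normal E G by (rule E_normal)
  interpret Q: group "G Mod E" by (rule N.factorgroup_is_group)
  have "(E #> x) \<otimes>\<^bsub>G Mod E\<^esub> (E #> y) = (E #> y) \<otimes>\<^bsub>G Mod E\<^esub> (E #> x)"
  proof (rule coprime_commutingD [OF Q.nilpotent_imp_coprime_commuting [OF quotient_nilpotent] _ _ ab])
    show "(E #> x) [^]\<^bsub>G Mod E\<^esub> a = \<one>\<^bsub>G Mod E\<^esub>" "(E #> y) [^]\<^bsub>G Mod E\<^esub> b = \<one>\<^bsub>G Mod E\<^esub>"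
      using x y by (simp_all add: N.FactGroup_pow coset_mult_one N.subset)
  qed (use x y in \<open>auto simp: carrier_FactGroup\<close>)
  then have cE: "?c \<in> E" using quotient_commute_iff [OF E_normal x(1) y(1)] by blast
  have "?c \<otimes> d = d \<otimes> ?c" if p: "Factorial_Ring.prime p" and d: "d \<in> E_core p" for p d
  proof -
    let ?S = "set_centralizer (E_core p)"
    have Sn: "?S \<lhd> G" by (rule set_centralizer_normal [OF core_normal])
    have Ss: "subgroup ?S G" using Sn normal_imp_subgroup by blast
    have S: "w \<in> ?S" if "w \<in> carrier G" "w [^] (n::nat) = \<one>" "coprime p n" for w n
      using core_commute [OF p _ that] that(1) by (intro set_centralizerI) auto
    have "coprime p a \<or> coprime p b"
      using ab p by (metis coprime_common_divisor not_prime_unit prime_imp_coprime)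
    then have "?c \<in> ?S"
    proof
      assume "coprime p a"
      then have "x \<in> ?S" using S x by blast
      then show ?thesis using normal_conjugate_by [OF Sn y(1)] Ss
        by (meson subgroup.m_closed subgroup.m_inv_closed)
    next
      assume "coprime p b"
      then have yS: "y \<in> ?S" using S y by blast
      have "?c = conjugate_by G x (inv y) \<otimes> y" using x y by (simp add: conjugate_by_def m_assoc)
      moreover have "conjugate_by G x (inv y) \<in> ?S"
        using normal_conjugate_by [OF Sn x(1)] subgroup.m_inv_closed [OF Ss yS] by blast
      ultimately show ?thesis using subgroup.m_closed [OF Ss _ yS] by simp
    qed
    then show ?thesis using d by (rule set_centralizerD(2))
  qed
  then show ?thesis using cE x y by (intro IntI set_centralizerI) auto
qed

text \<open>The commutator \<open>c = [x, y]\<close> splits as \<open>v \<otimes> inv w\<close> with \<open>v\<close> its \<open>p\<close>-part. Both \<open>x \<otimes> v\<close> and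
  \<open>x \<otimes> c\<close>, a conjugate of \<open>x\<close>, are \<open>p\<close>-elements and \<open>inv w\<close> commutes with \<open>x \<otimes> v\<close>, so
  \<open>w = \<one>\<close>.\<close>

lemma p_element_commute:
  assumes p: "Factorial_Ring.prime p" and x: "x \<in> carrier G" "x [^] (p ^ e) = \<one>"
    and y: "y \<in> carrier G" "y [^] b = \<one>" and b: "coprime p (b::nat)"
  shows "x \<otimes> y = y \<otimes> x"
proof -
  let ?c = "inv x \<otimes> conjugate_by G y x"
  have cC: "?c \<in> core_centralizer" using commutator_in_core_centralizer [OF x y] b by simp
  have Cs: "subgroup core_centralizer G" using core_centralizer_normal normal_imp_subgroup by blast
  have cG: "?c \<in> carrier G" using x y by simp
  have "ord ?c > 0" using ord_ge_1 [OF fin cG] by simp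
  then obtain s m where s: "ord ?c = p ^ s * m" "coprime p m" "m > 0"
    by (metis multiplicity_decompose' not_prime_unit p prime_imp_coprime mult.commute
      gr0I less_numeral_extra(3) mult_0_right)
  \<comment> \<open>The exponents \<open>m * k\<close> and \<open>p ^ s * l\<close> differ by 1, so
    the corresponding powers satisfy \<open>v = ?c \<otimes> w\<close>; \<open>v\<close> has
    exponent \<open>p ^ s\<close> and \<open>w\<close> has exponent \<open>m\<close>.\<close>
  obtain k l where kl: "m * k = p ^ s * l + 1"
    using bezout_nat [of m "p ^ s"] s(2,3) by (metis coprime_commute coprime_iff_gcd_eq_1 coprime_power_left_iff neq0_conv)
  define v w where "v = ?c [^] (m * k)" and "w = ?c [^] (p ^ s * l)"
  have vG: "v \<in> carrier G" and wG: "w \<in> carrier G" unfolding v_def w_def using cG by auto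
  have vC: "v \<in> core_centralizer" and wC: "w \<in> core_centralizer" unfolding v_def w_def using subgroup_nat_pow_closed [OF Cs cC] by blast+
  have vw: "v = ?c \<otimes> w" unfolding v_def w_def kl by (simp only: Suc_eq_plus1 [symmetric] nat_pow_Suc2 [OF cG])
  have v1: "v [^] (p ^ s) = \<one>"
  proof -
    have "ord ?c dvd m * k * p ^ s" unfolding s(1) by (metis dvd_triv_left mult.assoc mult.commute)
    then show ?thesis unfolding v_def using cG pow_eq_id by (simp add: nat_pow_pow)
  qed
  have w1: "w [^] m = \<one>"
  proof -
    have "ord ?c dvd p ^ s * l * m" unfolding s(1) by (metis dvd_triv_left mult.assoc mult.commute)
    then show ?thesis unfolding w_def using cG pow_eq_id by (simp add: nat_pow_pow)
  qed
  have w2: "inv w [^] m = \<one>" using w1 wG by (simp add: nat_pow_inv)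
  have iwC: "inv w \<in> core_centralizer" using subgroup.m_inv_closed [OF Cs wC] .
  have xw: "inv w \<otimes> x = x \<otimes> inv w"
    by (rule core_centralizer_coprime_commute [OF iwC w2 x _ s(3)]) (use s(2) in \<open>simp add: coprime_commute\<close>)
  have vwc: "inv w \<otimes> v = v \<otimes> inv w"
    by (rule core_centralizer_coprime_commute [OF iwC w2 vG v1 _ s(3)]) (use s(2) in \<open>simp add: coprime_commute\<close>)
  have core_v: "v \<in> E_core p" using core_centralizer_p_elements_core [OF p vC v1] .
  obtain f where f: "(x \<otimes> v) [^] (p ^ f) = \<one>"
    using p_element_mult_normal [OF core_normal core_p_group x core_v] by blast
  have xvG: "x \<otimes> v \<in> carrier G" using x vG by simp
  have cvw: "?c = v \<otimes> inv w" using vw cG wG by (simp add: m_assoc)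
  have "conjugate_by G y x = x \<otimes> ?c" using x y by (simp add: m_assoc [symmetric])
  then have xy: "conjugate_by G y x = (x \<otimes> v) \<otimes> inv w" unfolding cvw using x vG wG by (simp add: m_assoc)
  have com: "inv w \<otimes> (x \<otimes> v) = (x \<otimes> v) \<otimes> inv w"
    using mult_commute_closed [of x "inv w" v] xw vwc x vG wG by simp
  have "inv w [^] (p ^ (e + f)) = \<one>"
  proof -
    have "conjugate_by G y x [^] (p ^ (e + f)) = \<one>"
      using x y pow_dvd_one [OF x(1,2), of "p ^ (e + f)"]
      by (simp add: conjugate_by_pow power_add) (simp add: conjugate_by_def)
    moreover have "(x \<otimes> v) [^] (p ^ (e + f)) = \<one>" using pow_dvd_one [OF xvG f] by (simp add: power_add)
    ultimately show ?thesis
      unfolding xy using pow_mult_distrib [of "x \<otimes> v" "inv w" "p ^ (e + f)"] com xvG wG by simp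
  qed
  then have "inv w = \<one>" using pow_coprime_one [OF _ w2] wG s(2) by (simp add: coprime_commute)
  then have c: "?c = v" using cvw vG by simp
  \<comment> \<open>The commutator now lies in the \<open>p\<close>-core, which \<open>y\<close>
    centralizes. So the displacement of \<open>x\<close> under conjugation by \<open>y\<close> is
    fixed, and by coprimality it is trivial.\<close>
  have vy: "v \<otimes> y = y \<otimes> v" by (rule core_commute [OF p core_v y b])
  show ?thesis
    using fixed_commutator_commute [OF y(1) x(1) y(2), of "p ^ s"] vy v1 b unfolding c by simp
qed

text \<open>It is enough to treat the prime-power parts of \<open>x\<close>; a part for a prime
  dividing \<open>b\<close> is trivial because that prime does not divide \<open>a\<close>.\<close>

lemma G_coprime_commuting: "coprime_commuting G"
  unfolding coprime_commuting_def
proof (intro ballI allI impI)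
  fix x y and a b :: nat
  assume x: "x \<in> carrier G" and y: "y \<in> carrier G" and ab: "coprime a b"
    and xa: "x [^] a = \<one>" and yb: "y [^] b = \<one>"
  show "x \<otimes> y = y \<otimes> x"
  proof (cases "a = 0")
    case True
    then show ?thesis using ab yb x y by simp
  next
    case False
    have "x \<in> centralizer_of y"
    proof (rule prime_power_parts_in_subgroup [OF centralizer_of_subgroup [OF y] x xa])
      fix p e k :: nat
      assume p: "Factorial_Ring.prime p" and pe: "(x [^] k) [^] (p ^ e) = \<one>"
      have xk: "x [^] k \<in> carrier G" using x by simp
      have "x [^] k \<otimes> y = y \<otimes> x [^] k"
      proof (cases "coprime p b")
        case True
        then show ?thesis using p_element_commute [OF p xk pe y yb] by blast
      next
        case False
        then have "p dvd b" using p prime_imp_coprime by blast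
        then have "coprime a p" using coprime_divisors [OF dvd_refl _ ab] by simp
        then have "coprime (p ^ e) a" by (simp add: coprime_commute)
        moreover have "(x [^] k) [^] a = \<one>"
          using xa x by (metis nat_pow_pow mult.commute nat_pow_one)
        ultimately have "x [^] k = \<one>" using pow_coprime_one [OF xk pe] by blast
        then show ?thesis using y by simp
      qed
      then show "x [^] k \<in> centralizer_of y" using xk unfolding centralizer_of_def by simp
    qed (use False in simp)
    then show ?thesis unfolding centralizer_of_def by simp
  qed
qed

lemma G_nilpotent: "nilpotent_group G"
  by (rule coprime_commuting_imp_nilpotent [OF fin G_coprime_commuting])

end

theorem theorem3p6:
  fixes G :: "('a, 'b) monoid_scheme" and E :: "'a set"
  assumes "group G" and "finite (carrier G)"
    and "E \<lhd> G"
    and "nilpotent_group (G Mod E)"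
    and "\<And>H. subgroup H G \<Longrightarrow> H \<subseteq> generalized_fitting (G\<lparr>carrier := E\<rparr>) \<Longrightarrow>
           Factorial_Ring.prime (card H) \<Longrightarrow> H \<subseteq> hypercenter G"
    and "\<And>H. subgroup H G \<Longrightarrow> H \<subseteq> generalized_fitting (G\<lparr>carrier := E\<rparr>) \<Longrightarrow>
           cyclic_group (G\<lparr>carrier := H\<rparr>) \<Longrightarrow> card H = 4 \<Longrightarrow> HC_subgroup G H"
  shows "nilpotent_group G"
  by (rule G_nilpotent [OF assms])

end
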